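(* Let $p\ge 1$ be a constant and let $\varepsilon\in(0,1)$. There exists a one-pass insertion-only streaming algorithm that makes $\mathcal{O}(n^{1-1/p})\cdot\mathrm{poly}\left(\log(nm),\frac{1}{\varepsilon}\right)$ internal state changes and solves the $L_p$-heavy hitter problem. That is, on an insertion-only stream of length $m$ over the universe $[n]$ with frequency vector $f$, it outputs a vector $\widehat{f}\in\mathbb{R}^n$ such that \[\Pr\left[\|\widehat{f}-f\|_\infty\le\frac{\varepsilon}{2}\cdot\|f\|_p\right]\ge\frac{2}{3}.\] For $p\in[1,2]$ the algorithm uses $\mathcal{O}\left(\frac{1}{\varepsilon^{4+4p}}\right)\cdot\mathrm{polylog}(mn)$ bits of space, and for $p>2$ it uses $\widetilde{\mathcal{O}}\left(\frac{1}{\varepsilon^{4+4p}}n^{1-2/p}\right)$ bits of space.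
   Context: An insertion-only stream is a sequence of updates $u_1,\ldots,u_m$ with each $u_t\in[n]=\{1,\ldots,n\}$; it defines the frequency vector $f\in\mathbb{R}^n$ by $f_i=|\{t: u_t=i\}|$, and $\|f\|_p=(\sum_i f_i^p)^{1/p}$. A streaming algorithm processes the updates one at a time and maintains a memory state $\sigma_t$ after processing update $t$ (with $\sigma_0=\emptyset$); the number of internal state changes is the number of $t\in[m]$ with $\sigma_t\neq\sigma_{t-1}$. A word is $\mathcal{O}(\log n+\log m)$ bits. The notation $\widetilde{\mathcal{O}}(g)$ means $g\cdot\mathrm{poly}(\log g)$ (here allowed to hide polylogarithmic factors in $n,m$). *)

theory Defs
  imports "HOL-Probability.Probability"
begin

text \<open>
  Vectors in \<open>\<real>\<^sup>n\<close> are functions \<open>nat \<Rightarrow> real\<close> of which only the coordinates \<open>1, \<dots>, n\<close> matter.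
  Streams are lists: \<open>us ! (t - 1)\<close> is the update \<open>u\<^sub>t\<close>.
\<close>

definition insertion_stream :: "nat \<Rightarrow> nat \<Rightarrow> nat list \<Rightarrow> bool" where
  "insertion_stream n m us \<longleftrightarrow> length us = m \<and> set us \<subseteq> {1..n}"

definition freq :: "nat list \<Rightarrow> nat \<Rightarrow> real" where
  "freq us i = real (card {t \<in> {1..length us}. us ! (t - 1) = i})"

definition lp_norm :: "nat \<Rightarrow> real \<Rightarrow> (nat \<Rightarrow> real) \<Rightarrow> real" where
  "lp_norm n p x = (\<Sum>i = 1..n. \<bar>x i\<bar> powr p) powr (1 / p)"

text \<open>Meaningful for \<open>n \<ge> 1\<close> only, as it is the maximum of an empty set otherwise.\<close>

definition linf_norm :: "nat \<Rightarrow> (nat \<Rightarrow> real) \<Rightarrow> real" where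
  "linf_norm n x = Max ((\<lambda>i. \<bar>x i\<bar>) ` {1..n})"

text \<open>
  A memory state is the bit string held in memory between two updates. Processing an update
  replaces the state by a random one whose distribution depends on the current state and the
  update only: the coins of a step are fresh, anything that is to be remembered (random seeds,
  clocks) has to be part of the state, and there is no free access to the time.
  The output is read off the final state.
\<close>

record stream_alg =
  step :: "bool list \<Rightarrow> nat \<Rightarrow> bool list pmf"
  result :: "bool list \<Rightarrow> nat \<Rightarrow> real"

text \<open>\<open>trajectory_from A \<sigma> us\<close> is the distribution of the list of all states
  visited on \<open>us\<close> when starting in \<open>\<sigma>\<close>, including \<open>\<sigma>\<close> itself; thus
  its length is \<open>length us + 1\<close>.\<close>

primrec trajectory_from :: "stream_alg \<Rightarrow> bool list \<Rightarrow> nat list \<Rightarrow> bool list list pmf" where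
  "trajectory_from A \<sigma> [] = return_pmf [\<sigma>]"
| "trajectory_from A \<sigma> (u # us) =
     bind_pmf (step A \<sigma> u) (\<lambda>\<sigma>'. map_pmf (\<lambda>\<tau>. \<sigma> # \<tau>) (trajectory_from A \<sigma>' us))"

text \<open>The initial state \<open>\<sigma>\<^sub>0 = \<emptyset>\<close> is the empty memory.\<close>

definition trajectory :: "stream_alg \<Rightarrow> nat list \<Rightarrow> bool list list pmf" where
  "trajectory A us = trajectory_from A [] us"

definition state_changes :: "bool list list \<Rightarrow> nat" where
  "state_changes \<tau> = card {t \<in> {1..<length \<tau>}. \<tau> ! t \<noteq> \<tau> ! (t - 1)}"

text \<open>Both resource bounds are worst-case: they hold for every outcome of the coins.\<close>

definition state_changes_at_most :: "stream_alg \<Rightarrow> nat list \<Rightarrow> real \<Rightarrow> bool" where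
  "state_changes_at_most A us K \<longleftrightarrow>
     (\<forall>\<tau> \<in> set_pmf (trajectory A us). real (state_changes \<tau>) \<le> K)"

definition bits_at_most :: "stream_alg \<Rightarrow> nat list \<Rightarrow> real \<Rightarrow> bool" where
  "bits_at_most A us S \<longleftrightarrow>
     (\<forall>\<tau> \<in> set_pmf (trajectory A us). \<forall>\<sigma> \<in> set \<tau>. real (length \<sigma>) \<le> S)"

definition final_output :: "stream_alg \<Rightarrow> nat list \<Rightarrow> (nat \<Rightarrow> real) pmf" where
  "final_output A us = map_pmf (\<lambda>\<tau>. result A (last \<tau>)) (trajectory A us)"

end

theory Submission
  imports Defs
begin

text \<open>
  Write \<open>F\<close> for the \<open>L\<^sub>p\<close> norm of the frequencies. An item is picked up at each of its occurrences with
  probability about \<open>q = log / (\<epsilon>\<^sup>2 F)\<close>, so that heavy items are picked up early, and from then on its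
  occurrences are counted approximately by a Morris counter. Since \<open>F \<ge> m / n powr (1 - 1/p)\<close>, only about
  \<open>n powr (1 - 1/p)\<close> items are ever picked up, and each counter changes few times.

  To save space, the counters that have reached level \<open>x\<close> sit in a first-in-first-out buffer of fixed
  capacity. At most about \<open>q F\<^sub>2 / S\<^sub>x\<close> counters ever enter level \<open>x\<close>, where \<open>S\<^sub>x\<close> is the count that the
  level stands for and \<open>F\<^sub>2\<close> the second moment, whereas a heavy item leaves level \<open>x\<close> after about \<open>S\<^sub>x\<close> further
  occurrences. Hence only about \<open>q F\<^sub>2\<close> divided by the capacity of its occurrences are starting points from
  which the item would be pushed out of level \<open>x\<close>. Which starting points these are depends on the coins
  of the other items only, so the item is picked up at one of the remaining early occurrences with
  high probability. No clock is needed: age is measured in occurrences of the item itself.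

  As \<open>F\<close> is unknown, copies for all guesses \<open>m / 2 ^ k\<close> run in parallel on the same coins. No copy
  overestimates, so the largest estimate is a correct one.
\<close>

section \<open>Weights of the levels of a counter\<close>

text \<open>The main obstacle is that evictions depend on all coins, those of the heavy item
  included. The analysis therefore compares the buffers with ideal counters \<open>level\<close>
  that are never evicted. Each buffer entry agrees with some ideal counter, so evictions cannot
  cause overestimates. The traffic through a level is bounded by the ideal counters of the other
  items, which do not read the coins of the heavy item. Conditioning on the other coins then freezes
  the bad starting points, and picking up one of the good ones is a matter of independent trials.
  All random decisions at time \<open>t\<close> are comparisons of one geometric variable
  \<open>V t\<close> with thresholds. One draw serves all copies and levels, and since each time
  belongs to a single item, the coins of different items stay independent. Success is only probable,
  whereas the resource bounds must hold for every outcome. So the automaton freezes once its budget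
  of state changes is spent, and its memory is about the logarithm of the number of its
  states.\<close>

text \<open>
  A counter at level \<open>k\<close> moves up with probability \<open>1 / weight d h k\<close> at each occurrence; the levels up to \<open>h\<close>
  (truncated subtraction) count exactly. Plain Morris counters, \<open>h = 0\<close>, err at tiny counts with
  probability about \<open>d\<close>, which is too much for a union bound.
\<close>

definition weight :: "real \<Rightarrow> nat \<Rightarrow> nat \<Rightarrow> real" where
  "weight d h k = (1 + d) ^ (k - h)"

definition estimate :: "real \<Rightarrow> nat \<Rightarrow> nat \<Rightarrow> real" where
  "estimate d h y = (\<Sum>k<y. weight d h k)"

lemma estimate_0 [simp]: "estimate d h 0 = 0"
  and estimate_Suc [simp]: "estimate d h (Suc y) = estimate d h y + weight d h y"
  by (simp_all add: estimate_def)

lemma weight_ge_1: "d \<ge> 0 \<Longrightarrow> weight d h k \<ge> 1"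
  by (simp add: weight_def)

lemma weight_Suc_le: "d \<ge> 0 \<Longrightarrow> weight d h (Suc k) \<le> (1 + d) * weight d h k"
  by (cases "k < h") (auto simp: weight_def Suc_diff_le not_less)

lemma estimate_ge: "d \<ge> 0 \<Longrightarrow> real y \<le> estimate d h y"
proof (induction y)
  case (Suc y)
  then show ?case using weight_ge_1[of d h y] by simp
qed simp

lemma estimate_mono: "d \<ge> 0 \<Longrightarrow> x \<le> y \<Longrightarrow> estimate d h x \<le> estimate d h y"
  unfolding estimate_def using weight_ge_1[of d h]
  by (intro sum_mono2) (auto intro: order_trans[OF zero_le_one])

text \<open>For \<open>h = 0\<close> the geometric sum makes this an equality; exact levels add to
  the estimate without raising the weight. The two quadratic bounds below follow from it.\<close>

lemma weight_le_estimate: "d \<ge> 0 \<Longrightarrow> weight d h k - 1 \<le> d * estimate d h k"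
proof (induction k)
  case (Suc k)
  then show ?case using weight_Suc_le[of d h k] by (simp add: algebra_simps)
qed (simp add: weight_def)

text \<open>A sum compared with the integral of \<open>d * s\<close>: a step of length
  \<open>a\<close> from \<open>S\<close> has excess \<open>a - 1 \<le> d * S\<close>, while
  \<open>d * s\<^sup>2 / 2\<close> grows by \<open>d * (S * a + a\<^sup>2 / 2)\<close>.\<close>

lemma estimate_minus_le:
  assumes "d \<ge> 0"
  shows "estimate d h y - real y \<le> d * (estimate d h y)\<^sup>2 / 2"
proof (induction y)
  case (Suc y)
  let ?S = "estimate d h y" and ?a = "weight d h y"
  have a: "?a \<ge> 1" "?S \<ge> 0" using weight_ge_1 estimate_ge[of d y h] assms by auto
  have "?a - 1 \<le> d * ?S" by (rule weight_le_estimate) fact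
  also have "\<dots> \<le> d * (?S * ?a + ?a\<^sup>2 / 2)"
    using assms a mult_left_mono[OF a(1) a(2)] by (intro mult_left_mono) (auto intro: add_increasing2)
  finally show ?case using Suc by (simp add: power2_eq_square algebra_simps)
qed simp

text \<open>The squares are the second-order terms in the logarithms of the potentials. One factor
  \<open>a - 1\<close> is traded for \<open>d * S\<close>, after which the previous comparison
  applies.\<close>

lemma sum_weight_sq_le:
  assumes "d \<ge> 0"
  shows "(\<Sum>k<y. (weight d h k - 1)\<^sup>2) \<le> d * (estimate d h y)\<^sup>2 / 2"
proof (induction y)
  case (Suc y)
  let ?S = "estimate d h y" and ?a = "weight d h y"
  have a: "?a \<ge> 1" "?S \<ge> 0" using weight_ge_1 estimate_ge[of d y h] assms by auto
  have "(?a - 1)\<^sup>2 \<le> d * ?S * (?a - 1)"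
    unfolding power2_eq_square using a weight_le_estimate[OF assms, of h y] by (intro mult_right_mono) auto
  also have "\<dots> \<le> d * (?S * ?a + ?a\<^sup>2 / 2)"
    using assms a by (simp add: algebra_simps add_increasing2)
  finally show ?case using Suc by (simp add: power2_eq_square algebra_simps)
qed simp

lemma ln_add_one_ge: "z \<ge> 0 \<Longrightarrow> z - z\<^sup>2 \<le> ln (1 + z)" for z :: real
proof (cases "z \<le> 1")
  case False
  assume "z \<ge> 0"
  have "z - z\<^sup>2 \<le> 0" using False by (simp add: power2_eq_square)
  also have "0 \<le> ln (1 + z)" using \<open>z \<ge> 0\<close> by simp
  finally show ?thesis .
qed (auto intro: ln_one_plus_pos_lower_bound)

text \<open>
  With \<open>\<theta> = \<mu> / (1 + \<mu>)\<close> the factors become \<open>(1 + \<mu>) * (1 + \<theta> * (weight d h k - 1))\<close>. Splitting off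
  \<open>1 + \<mu>\<close> is what makes the exponent independent of the size of \<open>N\<close>.
\<close>

lemma upper_potential:
  assumes d: "d > 0" and \<eta>: "0 < \<eta>" "\<eta> < 1" and yN: "y \<le> N"
    and dev: "estimate d h y - real N \<ge> \<eta> * estimate d h y" and y: "y > 0"
  shows "\<exists>\<mu>>0. (1 + \<mu>) ^ N \<le> exp (- \<eta>\<^sup>2 / (6 * d)) * (\<Prod>k<y. 1 + \<mu> * weight d h k)"
proof -
  define S where "S = estimate d h y"
  define a where "a = weight d h"
  \<comment> \<open>The minimiser of \<open>3 * \<theta>\<^sup>2 * (d * S\<^sup>2 / 2) - \<theta> *
    \<eta> * S\<close>, the exponent left after all estimates; the minimum is
    \<open>- \<eta>\<^sup>2 / (6 * d)\<close>.\<close>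
  define \<theta> where "\<theta> = \<eta> / (3 * d * S)"
  define \<mu> where "\<mu> = \<theta> / (1 - \<theta>)"
  define j where "j = real N - real y"
  have d0: "d \<ge> 0" using d by simp
  have S1: "S \<ge> 1" unfolding S_def using estimate_ge[OF d0, of y h] y by linarith
  have D1: "S - real y \<le> d * S\<^sup>2 / 2" unfolding S_def by (rule estimate_minus_le[OF d0])
  have j0: "j \<ge> 0" using yN by (simp add: j_def)
  have jS: "S - real y \<ge> \<eta> * S + j" using dev by (simp add: S_def j_def)
  \<comment> \<open>The deviation itself forces \<open>d * S \<ge> 2 * \<eta>\<close>, which bounds
    \<open>\<theta>\<close> without any assumption on \<open>h\<close>.\<close>
  have "\<eta> * S \<le> d * S * S / 2" using D1 jS j0 by (simp add: power2_eq_square)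
  then have "\<eta> \<le> d * S / 2" using S1 by (simp add: mult_ac pos_le_divide_eq)
  then have th_half: "\<theta> \<le> 1/2" unfolding \<theta>_def using d S1 \<eta> by (simp add: field_simps)
  have th0: "\<theta> > 0" unfolding \<theta>_def using d S1 \<eta> by simp
  have mu0: "\<mu> > 0" unfolding \<mu>_def using th0 th_half by simp
  have one_mu: "1 + \<mu> = 1 / (1 - \<theta>)" unfolding \<mu>_def using th_half by (simp add: field_simps)
  have a1: "a k \<ge> 1" for k unfolding a_def by (rule weight_ge_1[OF d0])
  have mua: "1 + \<mu> * a k > 0" for k using mu0 a1[of k] by (simp add: add_pos_nonneg)
  have fac: "1 + \<mu> * a k = (1 + \<mu>) * (1 + \<theta> * (a k - 1))" for k
    unfolding one_mu unfolding \<mu>_def using th_half by (simp add: field_simps)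
  have lnmu: "ln (1 + \<mu>) \<le> \<theta> + 2 * \<theta>\<^sup>2"
  proof -
    have "ln (1 + \<mu>) \<le> \<mu>" using mu0 by (intro ln_add_one_self_le_self) auto
    also have "\<mu> = \<theta> + \<theta>\<^sup>2 / (1 - \<theta>)" unfolding \<mu>_def using th_half
      by (simp add: field_simps power2_eq_square)
    also have "\<dots> \<le> \<theta> + 2 * \<theta>\<^sup>2" using th_half th0
      mult_right_mono[of "2*\<theta>" 1 "\<theta>\<^sup>2"] by (simp add: divide_le_eq algebra_simps)
    finally show ?thesis .
  qed
  have sums: "(\<Sum>k<y. a k - 1) = S - real y" by (simp add: S_def estimate_def a_def sum_subtractf)
  have Q: "(\<Sum>k<y. (a k - 1)\<^sup>2) \<le> d * S\<^sup>2 / 2"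
    unfolding S_def a_def by (rule sum_weight_sq_le[OF d0])
  have "\<theta> * (S - y) - \<theta>\<^sup>2 * (d * S\<^sup>2 / 2) \<le> \<theta> * (S - y) - \<theta>\<^sup>2 * (\<Sum>k<y. (a k - 1)\<^sup>2)"
    using Q by (intro diff_left_mono mult_left_mono) auto
  also have "\<dots> = (\<Sum>k<y. \<theta> * (a k - 1) - (\<theta> * (a k - 1))\<^sup>2)"
    unfolding sums[symmetric] by (simp add: sum_subtractf power_mult_distrib flip: sum_distrib_left)
  also have "\<dots> \<le> (\<Sum>k<y. ln (1 + \<theta> * (a k - 1)))"
    using th0 a1 by (intro sum_mono ln_add_one_ge) auto
  finally have lb: "\<theta> * (S - y) - \<theta>\<^sup>2 * (d * S\<^sup>2 / 2) \<le> (\<Sum>k<y. ln (1 + \<theta> * (a k - 1)))" .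
  have "ln (\<Prod>k<y. 1 + \<mu> * a k) = (\<Sum>k<y. ln (1 + \<mu> * a k))"
    by (intro ln_prod) (simp, metis mua less_irrefl)
  also have "\<dots> = (\<Sum>k<y. ln (1 + \<mu>) + ln (1 + \<theta> * (a k - 1)))"
  proof (intro sum.cong refl)
    fix k
    have "0 < 1 + \<theta> * (a k - 1)" using th0 a1[of k] by (intro add_pos_nonneg) auto
    then show "ln (1 + \<mu> * a k) = ln (1 + \<mu>) + ln (1 + \<theta> * (a k - 1))"
      unfolding fac using mu0 by (subst ln_mult) auto
  qed
  finally have lnP: "ln (\<Prod>k<y. 1 + \<mu> * a k) = y * ln (1 + \<mu>) + (\<Sum>k<y. ln (1 + \<theta> * (a k - 1)))"
    by (simp add: sum.distrib)
  have jD: "j \<le> d * S\<^sup>2 / 2" using jS D1 \<eta> S1 by (smt (verit) mult_nonneg_nonneg)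
  have "real N * ln (1 + \<mu>) - ln (\<Prod>k<y. 1 + \<mu> * a k) =
      j * ln (1 + \<mu>) - (\<Sum>k<y. ln (1 + \<theta> * (a k - 1)))"
    unfolding lnP j_def by (simp add: algebra_simps)
  also have "\<dots> \<le> j * (\<theta> + 2 * \<theta>\<^sup>2) - (\<theta> * (S - y) - \<theta>\<^sup>2 * (d * S\<^sup>2 / 2))"
    using lnmu j0 lb by (intro diff_mono mult_left_mono) auto
  also have "\<dots> = 2 * \<theta>\<^sup>2 * j + \<theta>\<^sup>2 * (d * S\<^sup>2 / 2) - \<theta> * (S - real N)"
    by (simp add: algebra_simps j_def)
  also have "\<dots> \<le> 2 * \<theta>\<^sup>2 * (d * S\<^sup>2 / 2) + \<theta>\<^sup>2 * (d * S\<^sup>2 / 2) - \<theta> * (\<eta> * S)"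
    using jD dev th0 by (intro diff_mono add_mono mult_left_mono) (auto simp: S_def)
  also have "\<dots> = - \<eta>\<^sup>2 / (6 * d)"
    unfolding \<theta>_def using d S1 by (simp add: field_simps power2_eq_square)
  finally have fin: "real N * ln (1 + \<mu>) \<le> - \<eta>\<^sup>2 / (6 * d) + ln (\<Prod>k<y. 1 + \<mu> * a k)" by simp
  have P0: "(\<Prod>k<y. 1 + \<mu> * a k) > 0"
    using mua by (intro prod_pos) auto
  have "(1 + \<mu>) ^ N = exp (real N * ln (1 + \<mu>))" using mu0 by (simp add: exp_of_nat_mult)
  also have "\<dots> \<le> exp (- \<eta>\<^sup>2 / (6 * d) + ln (\<Prod>k<y. 1 + \<mu> * a k))" using fin by simp
  also have "\<dots> = exp (- \<eta>\<^sup>2 / (6 * d)) * (\<Prod>k<y. 1 + \<mu> * a k)"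
    unfolding exp_add using P0 by simp
  finally show ?thesis using mu0 unfolding a_def by blast
qed

text \<open>Mirror image of the upper bound with \<open>\<theta> = \<nu> / (1 - \<nu>)\<close>: the
  factors become \<open>(1 - \<nu>) * (1 - \<theta> * (weight d h k - 1))\<close>. They are positive
  because \<open>\<theta> * d * S = \<eta> / 6\<close>. The lower bound on
  \<open>d * estimate d h y\<close>, later supplied by the exact levels, keeps
  \<open>\<theta>\<close> itself small.\<close>

lemma lower_potential:
  assumes d: "d > 0" and \<eta>: "0 < \<eta>" "\<eta> < 1" and h: "d * estimate d h y \<ge> 1"
    and dev: "real N - estimate d h y \<ge> \<eta> * real N"
  shows "\<exists>\<nu>>0. \<nu> * weight d h y \<le> 1 \<and> (\<forall>k<y. \<nu> * weight d h k < 1) \<and>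
     (1 - \<nu>) ^ N \<le> exp (- \<eta>\<^sup>2 / (24 * d)) * (\<Prod>k<y. 1 - \<nu> * weight d h k)"
proof -
  define S where "S = estimate d h y"
  define a where "a = weight d h"
  \<comment> \<open>The minimiser of \<open>3 * \<theta>\<^sup>2 * (d * S\<^sup>2 / 2) - \<theta> *
    \<eta> * S / 2\<close>; the last factor 1/2 pays for \<open>1 - \<theta>\<close> in the linear
    term.\<close>
  define \<theta> where "\<theta> = \<eta> / (6 * d * S)"
  define \<nu> where "\<nu> = \<theta> / (1 + \<theta>)"
  define j where "j = real N - real y"
  have d0: "d \<ge> 0" using d by simp
  have dS: "d * S \<ge> 1" using h by (simp add: S_def)
  then have S0: "S > 0" using d by (smt (verit) mult_nonneg_nonpos)
  have yS: "real y \<le> S" unfolding S_def by (rule estimate_ge[OF d0])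
  have D1: "S - real y \<le> d * S\<^sup>2 / 2" unfolding S_def by (rule estimate_minus_le[OF d0])
  have thdS: "\<theta> * (d * S) = \<eta> / 6" unfolding \<theta>_def using d S0 by simp
  have th0: "\<theta> > 0" unfolding \<theta>_def using d S0 \<eta> by simp
  have th_half: "\<theta> \<le> 1/6" using thdS dS \<eta> th0 mult_left_mono[OF dS, of \<theta>] by linarith
  have NS: "real N \<ge> S" using dev \<eta> by (simp add: S_def) (smt (verit) mult_nonneg_nonneg of_nat_0_le_iff)
  have j0: "j \<ge> 0" using NS yS by (simp add: j_def)
  have nu0: "\<nu> > 0" unfolding \<nu>_def using th0 by simp
  have one_nu: "1 - \<nu> = 1 / (1 + \<theta>)" unfolding \<nu>_def using th0 by (simp add: field_simps)
  have a1: "a k \<ge> 1" for k unfolding a_def by (rule weight_ge_1[OF d0])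
  have fac: "1 - \<nu> * a k = (1 - \<nu>) * (1 - \<theta> * (a k - 1))" for k
    unfolding one_nu unfolding \<nu>_def using th0 by (simp add: field_simps)
  have small: "\<theta> * (a k - 1) \<le> 1 / 6" if "k \<le> y" for k
  proof -
    have "a k - 1 \<le> d * estimate d h k" unfolding a_def by (rule weight_le_estimate[OF d0])
    also have "\<dots> \<le> d * S" unfolding S_def using that d0 by (intro mult_left_mono estimate_mono) auto
    finally have "\<theta> * (a k - 1) \<le> \<theta> * (d * S)" using th0 by (intro mult_left_mono) auto
    then show ?thesis using thdS \<eta> by linarith
  qed
  have nua: "\<nu> * a k < 1" if "k \<le> y" for k
  proof -
    have "1 - \<nu> * a k > 0" unfolding fac one_nu using small[OF that] th0 by (intro mult_pos_pos) auto
    then show ?thesis by simp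
  qed
  have sums: "(\<Sum>k<y. a k - 1) = S - real y" by (simp add: S_def estimate_def a_def sum_subtractf)
  have Q: "(\<Sum>k<y. (a k - 1)\<^sup>2) \<le> d * S\<^sup>2 / 2"
    unfolding S_def a_def by (rule sum_weight_sq_le[OF d0])
  have "- (\<Sum>k<y. ln (1 - \<theta> * (a k - 1))) = (\<Sum>k<y. - ln (1 - \<theta> * (a k - 1)))" by (simp add: sum_negf)
  also have "\<dots> \<le> (\<Sum>k<y. \<theta> * (a k - 1) + 2 * (\<theta> * (a k - 1))\<^sup>2)"
  proof (rule sum_mono)
    fix k assume "k \<in> {..<y}"
    then have "\<theta> * (a k - 1) \<le> 1/2" "\<theta> * (a k - 1) \<ge> 0" using small[of k] a1[of k] th0 by auto
    from ln_one_minus_pos_lower_bound[OF this(2,1)]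
    show "- ln (1 - \<theta> * (a k - 1)) \<le> \<theta> * (a k - 1) + 2 * (\<theta> * (a k - 1))\<^sup>2" by simp
  qed
  also have "\<dots> = \<theta> * (S - y) + 2 * \<theta>\<^sup>2 * (\<Sum>k<y. (a k - 1)\<^sup>2)"
    unfolding sums[symmetric] by (simp add: sum.distrib sum_distrib_left power_mult_distrib mult_ac)
  also have "\<dots> \<le> \<theta> * (S - y) + 2 * \<theta>\<^sup>2 * (d * S\<^sup>2 / 2)"
    using Q by (intro add_left_mono mult_left_mono) auto
  finally have ub: "- (\<Sum>k<y. ln (1 - \<theta> * (a k - 1))) \<le> \<theta> * (S - y) + 2 * \<theta>\<^sup>2 * (d * S\<^sup>2 / 2)" .
  have "ln (\<Prod>k<y. 1 - \<nu> * a k) = (\<Sum>k<y. ln (1 - \<nu> * a k))"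
    using nua[OF less_imp_le] by (intro ln_prod) force+
  also have "\<dots> = (\<Sum>k<y. ln (1 - \<nu>) + ln (1 - \<theta> * (a k - 1)))"
  proof (intro sum.cong refl)
    fix k assume "k \<in> {..<y}"
    then have "0 < 1 - \<theta> * (a k - 1)" using small[of k] by auto
    moreover have "1 - \<nu> > 0" unfolding one_nu using th0 by simp
    ultimately show "ln (1 - \<nu> * a k) = ln (1 - \<nu>) + ln (1 - \<theta> * (a k - 1))"
      unfolding fac by (subst ln_mult) auto
  qed
  finally have lnP: "ln (\<Prod>k<y. 1 - \<nu> * a k) = y * ln (1 - \<nu>) + (\<Sum>k<y. ln (1 - \<theta> * (a k - 1)))"
    by (simp add: sum.distrib)
  have lnnu: "ln (1 - \<nu>) \<le> - \<theta> + \<theta>\<^sup>2"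
    unfolding one_nu using ln_add_one_ge[of \<theta>] th0 by (simp add: ln_div)
  have "real N * ln (1 - \<nu>) - ln (\<Prod>k<y. 1 - \<nu> * a k) =
      j * ln (1 - \<nu>) - (\<Sum>k<y. ln (1 - \<theta> * (a k - 1)))"
    unfolding lnP j_def by (simp add: algebra_simps)
  also have "\<dots> \<le> j * (- \<theta> + \<theta>\<^sup>2) + (\<theta> * (S - y) + 2 * \<theta>\<^sup>2 * (d * S\<^sup>2 / 2))"
    using mult_left_mono[OF lnnu j0] ub by linarith
  also have "\<dots> = - \<theta> * (1 - \<theta>) * (real N - S) + \<theta>\<^sup>2 * (S - y) + 2 * \<theta>\<^sup>2 * (d * S\<^sup>2 / 2)"
    by (simp add: algebra_simps j_def power2_eq_square)
  also have "\<dots> \<le> - \<theta> * (1/2) * (\<eta> * S) + \<theta>\<^sup>2 * (d * S\<^sup>2 / 2) + 2 * \<theta>\<^sup>2 * (d * S\<^sup>2 / 2)"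
  proof -
    have "\<eta> * S \<le> real N - S" using dev NS \<eta> by (simp add: S_def) (smt (verit) mult_left_mono)
    then have "\<theta> * (1/2) * (\<eta> * S) \<le> \<theta> * (1 - \<theta>) * (real N - S)"
      using th0 th_half \<eta> S0 by (intro mult_mono) auto
    moreover have "\<theta>\<^sup>2 * (S - y) \<le> \<theta>\<^sup>2 * (d * S\<^sup>2 / 2)" using D1 by (intro mult_left_mono) auto
    ultimately show ?thesis by (linarith | argo)
  qed
  also have "\<dots> = - \<eta>\<^sup>2 / (24 * d)"
    unfolding \<theta>_def using d S0 by (simp add: field_simps power2_eq_square)
  finally have fin: "real N * ln (1 - \<nu>) \<le> - \<eta>\<^sup>2 / (24 * d) + ln (\<Prod>k<y. 1 - \<nu> * a k)" by simp
  have P0: "(\<Prod>k<y. 1 - \<nu> * a k) > 0"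
    using nua by (intro prod_pos) (auto simp: less_imp_le)
  have "1 - \<nu> > 0" unfolding one_nu using th0 by simp
  then have "(1 - \<nu>) ^ N = exp (real N * ln (1 - \<nu>))" by (simp add: exp_of_nat_mult)
  also have "\<dots> \<le> exp (- \<eta>\<^sup>2 / (24 * d) + ln (\<Prod>k<y. 1 - \<nu> * a k))" using fin by simp
  also have "\<dots> = exp (- \<eta>\<^sup>2 / (24 * d)) * (\<Prod>k<y. 1 - \<nu> * a k)"
    unfolding exp_add using P0 by simp
  finally show ?thesis using nu0 nua unfolding a_def by (intro exI[of _ \<nu>]) (auto simp: less_imp_le)
qed

section \<open>Accuracy of the counters\<close>

text \<open>Geometric, so that one draw decides a nested family of events: the value is at least
  \<open>k - h\<close> with probability \<open>1 / weight d h k\<close>. As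
  \<open>geometric_pmf\<close> counts failures, the success probability is
  \<open>d / (1 + d)\<close>.\<close>

definition coin :: "real \<Rightarrow> nat pmf" where
  "coin d = geometric_pmf (d / (1 + d))"

lemma coin_tail:
  assumes "d > 0"
  shows "measure_pmf.prob (coin d) {x..} = (1 / (1 + d)) ^ x"
proof -
  define r where "r = 1 / (1 + d)"
  have r: "1 - d / (1 + d) = r" "d / (1 + d) = 1 - r" "r \<noteq> 1" "0 \<le> r" "r < 1"
    using assms by (auto simp: r_def field_simps)
  have "measure_pmf.prob (coin d) {..<x} = (\<Sum>k<x. pmf (coin d) k)"
    by (rule measure_measure_pmf_finite) simp
  also have "\<dots> = (\<Sum>k<x. r ^ k) * (1 - r)"
    using assms unfolding coin_def by (subst pmf_geometric) (auto simp: r sum_distrib_right)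
  also have "\<dots> = 1 - r ^ x"
    by (simp add: one_diff_power_eq)
  finally have "measure_pmf.prob (coin d) {..<x} = 1 - r ^ x" .
  moreover have "{x..} = UNIV - {..<x}" by auto
  ultimately show ?thesis
    using measure_pmf.prob_compl[of "{..<x}" "coin d"] by (simp add: r_def)
qed

definition coins :: "nat set \<Rightarrow> real \<Rightarrow> (nat \<Rightarrow> nat) pmf" where
  "coins A d = Pi_pmf A 0 (\<lambda>_. coin d)"

text \<open>
  The level at time \<open>t\<close> of a counter for item \<open>i\<close> that is started at time \<open>s\<close> and never evicted. All
  counters use the same coin \<open>V t\<close> at time \<open>t\<close>. Times are positions in the stream, starting from 0.
\<close>

primrec level :: "nat \<Rightarrow> (nat \<Rightarrow> nat) \<Rightarrow> (nat \<Rightarrow> nat) \<Rightarrow> nat \<Rightarrow> nat \<Rightarrow> nat \<Rightarrow> nat" where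
  "level h u V i s 0 = 0"
| "level h u V i s (Suc t) =
     (if s \<le> t \<and> u t = i \<and> level h u V i s t - h \<le> V t
      then Suc (level h u V i s t) else level h u V i s t)"

definition occ :: "(nat \<Rightarrow> nat) \<Rightarrow> nat \<Rightarrow> nat \<Rightarrow> nat \<Rightarrow> nat" where
  "occ u i s t = card {t' \<in> {s..<t}. u t' = i}"

lemma occ_0 [simp]: "occ u i s 0 = 0"
  by (simp add: occ_def)

lemma occ_Suc [simp]: "occ u i s (Suc t) = (if s \<le> t \<and> u t = i then Suc (occ u i s t) else occ u i s t)"
proof (cases "s \<le> t \<and> u t = i")
  case True
  then have "{t' \<in> {s..<Suc t}. u t' = i} = insert t {t' \<in> {s..<t}. u t' = i}" by auto
  then show ?thesis using True by (simp add: occ_def)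
next
  case False
  then have "{t' \<in> {s..<Suc t}. u t' = i} = {t' \<in> {s..<t}. u t' = i}" by (auto simp: less_Suc_eq)
  then show ?thesis using False by (auto simp: occ_def)
qed

lemma level_cong:
  assumes "\<And>t'. t' < t \<Longrightarrow> u t' = i \<Longrightarrow> V t' = W t'"
  shows "level h u V i s t = level h u W i s t"
  using assms by (induction t) auto

lemma level_eq_0: "t \<le> s \<Longrightarrow> level h u V i s t = 0"
  by (induction t) auto

lemma level_le_occ: "level h u V i s t \<le> occ u i s t"
  by (induction t) auto

text \<open>Below level \<open>h\<close> the truncated difference is 0 and every occurrence
  counts.\<close>

lemma level_ge_min: "min (occ u i s t) h \<le> level h u V i s t"
  by (induction t) auto

lemma level_mono: "t \<le> t' \<Longrightarrow> level h u V i s t \<le> level h u V i s t'"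
  by (induction t' rule: dec_induct) auto

lemma nn_integral_coin_if:
  fixes a b :: real
  assumes "d > 0" "a \<ge> 0" "b \<ge> 0"
  shows "(\<integral>\<^sup>+ v. ennreal (if x \<le> v then a else b) \<partial>coin d) =
    ennreal (a * (1 / (1 + d)) ^ x + b * (1 - (1 / (1 + d)) ^ x))"
proof -
  have c: "measure_pmf.prob (coin d) {..<x} = 1 - (1 / (1 + d)) ^ x"
  proof -
    have "{..<x} = UNIV - {x..}" by auto
    then show ?thesis using measure_pmf.prob_compl[of "{x..}" "coin d"] coin_tail[OF assms(1), of x] by simp
  qed
  have p: "(1 / (1 + d)) ^ x \<le> 1" "(1 / (1 + d)) ^ x \<ge> 0" using assms(1) by (auto intro!: power_le_one)
  have "(\<integral>\<^sup>+ v. ennreal (if x \<le> v then a else b) \<partial>coin d) =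
      (\<integral>\<^sup>+ v. ennreal a * indicator {x..} v + ennreal b * indicator {..<x} v \<partial>coin d)"
    by (intro nn_integral_cong) (auto simp: indicator_def)
  also have "\<dots> = ennreal a * emeasure (coin d) {x..} + ennreal b * emeasure (coin d) {..<x}"
    by (subst nn_integral_add) (auto simp: nn_integral_cmult_indicator)
  also have "\<dots> = ennreal (a * (1 / (1 + d)) ^ x + b * (1 - (1 / (1 + d)) ^ x))"
    using assms p unfolding measure_pmf.emeasure_eq_measure coin_tail[OF assms(1)] c
    by (simp add: ennreal_mult ennreal_plus)
  finally show ?thesis .
qed

text \<open>
  Applied with \<open>\<phi> y = (\<Prod>k<y. 1 + \<mu> * weight d h k)\<close> and \<open>r = 1 + \<mu>\<close>, where \<open>step\<close> is an equality.
\<close>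

lemma level_potential:
  fixes \<phi> :: "nat \<Rightarrow> real"
  assumes d: "d > 0" and \<phi>: "\<And>y. \<phi> y \<ge> 0" and r: "r \<ge> 0"
    and step: "\<And>y. \<phi> (Suc y) * (1 / weight d h y) + \<phi> y * (1 - 1 / weight d h y) \<le> r * \<phi> y"
    and A: "finite A" "{..<t} \<subseteq> A"
  shows "(\<integral>\<^sup>+ V. ennreal (\<phi> (level h u V i s t)) \<partial>coins A d) \<le> ennreal (r ^ occ u i s t * \<phi> 0)"
  using A
proof (induction t arbitrary: A)
  case (Suc t)
  show ?case
  proof (cases "s \<le> t \<and> u t = i")
    case False
    then have "(\<lambda>V. ennreal (\<phi> (level h u V i s (Suc t)))) = (\<lambda>V. ennreal (\<phi> (level h u V i s t)))" by auto
    moreover have "{..<t} \<subseteq> A" using Suc.prems(2) by auto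
    ultimately show ?thesis using Suc.IH[of A] Suc.prems False by auto
  next
    case True
    \<comment> \<open>Only the coin of time \<open>t\<close> decides the last step, and the level
      before it does not read this coin, so it is integrated out first. This is why the induction
      ranges over all index sets \<open>A\<close>.\<close>
    define A' where "A' = A - {t}"
    have A': "finite A'" "{..<t} \<subseteq> A'" "t \<notin> A'" "A = insert t A'"
      using Suc.prems by (auto simp: A'_def)
    have lev: "level h u (f(t := v)) i s t = level h u f i s t" for f v by (rule level_cong) auto
    have "(\<integral>\<^sup>+ V. ennreal (\<phi> (level h u V i s (Suc t))) \<partial>coins A d) =
      (\<integral>\<^sup>+ f. \<integral>\<^sup>+ v. ennreal (\<phi> (level h u (f(t := v)) i s (Suc t))) \<partial>coin d \<partial>coins A' d)"
      unfolding coins_def A'(4) Pi_pmf_insert[OF A'(1,3)]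
      by (subst pair_commute_pmf) (simp add: case_prod_unfold nn_integral_pair_pmf' del: level.simps)
    also have "\<dots> \<le> (\<integral>\<^sup>+ f. ennreal r * ennreal (\<phi> (level h u f i s t)) \<partial>coins A' d)"
    proof (intro nn_integral_mono)
      fix f
      define y where "y = level h u f i s t"
      have w: "(1 / (1 + d)) ^ (y - h) = 1 / weight d h y" by (simp add: weight_def power_one_over)
      have "(\<integral>\<^sup>+ v. ennreal (\<phi> (level h u (f(t := v)) i s (Suc t))) \<partial>coin d) =
        (\<integral>\<^sup>+ v. ennreal (if y - h \<le> v then \<phi> (Suc y) else \<phi> y) \<partial>coin d)"
        by (intro nn_integral_cong) (use True in \<open>auto simp: lev y_def\<close>)
      also have "\<dots> \<le> ennreal (r * \<phi> y)"
        using \<phi> step[of y] by (subst nn_integral_coin_if[OF d]) (auto simp: w intro!: ennreal_leI)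
      also have "\<dots> = ennreal r * ennreal (\<phi> y)" using r \<phi> by (simp add: ennreal_mult)
      finally show "(\<integral>\<^sup>+ v. ennreal (\<phi> (level h u (f(t := v)) i s (Suc t))) \<partial>coin d) \<le>
        ennreal r * ennreal (\<phi> (level h u f i s t))" unfolding y_def .
    qed
    also have "\<dots> = ennreal r * (\<integral>\<^sup>+ f. ennreal (\<phi> (level h u f i s t)) \<partial>coins A' d)"
      by (rule nn_integral_cmult) auto
    also have "\<dots> \<le> ennreal r * ennreal (r ^ occ u i s t * \<phi> 0)"
      by (intro mult_left_mono Suc.IH A') auto
    also have "\<dots> = ennreal (r ^ occ u i s (Suc t) * \<phi> 0)"
      using True r \<phi> by (simp add: ennreal_mult[symmetric] mult_ac)
    finally show ?thesis .
  qed
qed (simp add: measure_pmf.emeasure_space_1)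

section \<open>Tail bounds for the level from exponential potentials\<close>

lemma pmf_markov:
  fixes f :: "'a \<Rightarrow> real"
  assumes "(\<integral>\<^sup>+ x. ennreal (f x) \<partial>measure_pmf M) \<le> ennreal c" "b > 0" "c \<ge> 0"
    and "\<And>x. x \<in> E \<Longrightarrow> f x \<ge> b"
  shows "measure_pmf.prob M E \<le> c / b"
proof -
  have "ennreal (b * measure_pmf.prob M E) = (\<integral>\<^sup>+ x. ennreal b * indicator E x \<partial>measure_pmf M)"
    using assms(2) by (simp add: nn_integral_cmult_indicator measure_pmf.emeasure_eq_measure ennreal_mult)
  also have "\<dots> \<le> (\<integral>\<^sup>+ x. ennreal (f x) \<partial>measure_pmf M)"
    by (intro nn_integral_mono) (auto simp: indicator_def intro!: ennreal_leI assms(4))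
  also have "\<dots> \<le> ennreal c" by fact
  finally have "b * measure_pmf.prob M E \<le> c" using assms(3) by simp
  then show ?thesis using assms(2) by (simp add: field_simps)
qed

text \<open>Markov's inequality for an increasing potential whose expectation gains a factor
  \<open>1 + \<mu>\<close> per occurrence. The hypothesis \<open>le\<close> is what
  \<open>upper_potential\<close> provides.\<close>

lemma level_upper_tail:
  assumes d: "d > 0" and A: "finite A" "{..<t} \<subseteq> A" and \<mu>: "\<mu> > 0"
    and le: "(1 + \<mu>) ^ occ u i s t \<le> c * (\<Prod>k<y. 1 + \<mu> * weight d h k)"
  shows "measure_pmf.prob (coins A d) {V. y \<le> level h u V i s t} \<le> c"
proof -
  define \<phi> where "\<phi> y = (\<Prod>k<y. 1 + \<mu> * weight d h k)" for y
  have w1: "weight d h k \<ge> 1" for k using d by (intro weight_ge_1) auto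
  have f1: "1 + \<mu> * weight d h k \<ge> 1" for k using w1[of k] \<mu> by simp
  have \<phi>0: "\<phi> y > 0" for y unfolding \<phi>_def using f1 by (intro prod_pos) (auto intro: less_le_trans[OF zero_less_one])
  have mono: "\<phi> y \<le> \<phi> y'" if "y \<le> y'" for y y'
    using that
  proof (induction y' rule: dec_induct)
    case (step n)
    have "\<phi> y \<le> \<phi> n" by fact
    also have "\<dots> \<le> \<phi> (Suc n)" using \<phi>0[of n] f1[of n] by (simp add: \<phi>_def)
    finally show ?case .
  qed simp
  have "\<phi> (Suc y) * (1 / weight d h y) + \<phi> y * (1 - 1 / weight d h y) \<le> (1 + \<mu>) * \<phi> y" for y
    using w1[of y] by (simp add: \<phi>_def field_simps)
  then have "(\<integral>\<^sup>+ V. ennreal (\<phi> (level h u V i s t)) \<partial>coins A d) \<le> ennreal ((1 + \<mu>) ^ occ u i s t * \<phi> 0)"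
    using \<mu> A d \<phi>0 by (intro level_potential) (auto simp: less_imp_le)
  then have "measure_pmf.prob (coins A d) {V. y \<le> level h u V i s t} \<le> ((1 + \<mu>) ^ occ u i s t * \<phi> 0) / \<phi> y"
    by (rule pmf_markov) (use \<phi>0 \<mu> mono in \<open>auto simp: less_imp_le\<close>)
  also have "\<dots> \<le> c" using le \<phi>0[of y] by (simp add: \<phi>_def field_simps)
  finally show ?thesis .
qed

text \<open>Markov's inequality for a decreasing potential. It is cut off to 0 above level
  \<open>y\<close>, where the factors may become negative; at \<open>y\<close> itself the drift
  condition survives the cut because \<open>\<nu> * weight d h y \<le> 1\<close>.\<close>

lemma level_lower_tail:
  assumes d: "d > 0" and A: "finite A" "{..<t} \<subseteq> A" and \<nu>: "\<nu> > 0"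
    and \<nu>y: "\<nu> * weight d h y \<le> 1" and \<nu>k: "\<And>k. k < y \<Longrightarrow> \<nu> * weight d h k < 1"
    and le: "(1 - \<nu>) ^ occ u i s t \<le> c * (\<Prod>k<y. 1 - \<nu> * weight d h k)"
  shows "measure_pmf.prob (coins A d) {V. level h u V i s t \<le> y} \<le> c"
proof -
  define \<psi> where "\<psi> x = (\<Prod>k<x. 1 - \<nu> * weight d h k)" for x
  define \<phi> where "\<phi> x = (if x \<le> y then \<psi> x else 0)" for x
  have w1: "weight d h k \<ge> 1" for k using d by (intro weight_ge_1) auto
  have \<nu>1: "\<nu> \<le> 1" using \<nu>y mult_left_mono[OF w1[of y], of \<nu>] \<nu> by linarith
  have \<psi>0: "\<psi> x > 0" if "x \<le> y" for x unfolding \<psi>_def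
    by (intro prod_pos) (use that \<nu>k in force)
  have mono: "\<psi> y \<le> \<psi> x" if "x \<le> y" for x
    using that
  proof (induction x rule: inc_induct)
    case (step n)
    have "\<psi> y \<le> \<psi> (Suc n)" by fact
    also have "\<psi> (Suc n) = \<psi> n * (1 - \<nu> * weight d h n)" by (simp add: \<psi>_def)
    also have "\<dots> \<le> \<psi> n * 1" using \<psi>0[of n] step w1[of n] \<nu>
      by (intro mult_left_mono) (auto simp: less_imp_le)
    finally show ?case by simp
  qed simp
  have "\<phi> (Suc x) * (1 / weight d h x) + \<phi> x * (1 - 1 / weight d h x) \<le> (1 - \<nu>) * \<phi> x" for x
  proof -
    consider "x < y" | "x = y" | "x > y" by linarith
    then show ?thesis
    proof cases
      case 1
      then show ?thesis using w1[of x] by (simp add: \<phi>_def \<psi>_def field_simps)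
    next
      case 2
      have "1 - 1 / weight d h y \<le> 1 - \<nu>" using \<nu>y w1[of y] by (simp add: field_simps)
      then have "(1 - 1 / weight d h y) * \<psi> y \<le> (1 - \<nu>) * \<psi> y"
        using \<psi>0[of y] by (intro mult_right_mono) auto
      then show ?thesis using 2 by (simp add: \<phi>_def mult_ac)
    next
      case 3
      then show ?thesis by (simp add: \<phi>_def)
    qed
  qed
  then have "(\<integral>\<^sup>+ V. ennreal (\<phi> (level h u V i s t)) \<partial>coins A d) \<le> ennreal ((1 - \<nu>) ^ occ u i s t * \<phi> 0)"
    using \<nu>1 A d \<psi>0 by (intro level_potential) (auto simp: less_imp_le \<phi>_def)
  then have "measure_pmf.prob (coins A d) {V. level h u V i s t \<le> y} \<le> ((1 - \<nu>) ^ occ u i s t * \<phi> 0) / \<psi> y"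
    by (rule pmf_markov) (use \<psi>0 \<nu>1 mono in \<open>auto simp: less_imp_le \<phi>_def\<close>)
  also have "\<dots> \<le> c" using le \<psi>0[of y] by (simp add: \<phi>_def \<psi>_def field_simps)
  finally show ?thesis .
qed

text \<open>As \<open>estimate\<close> is monotone, an error of either sign means that the level
  crosses a fixed threshold, and each crossing has its potential. The hypothesis on \<open>h\<close>
  matters for underestimates only.\<close>

lemma level_accuracy:
  fixes \<eta> :: real
  assumes d: "d > 0" and dh: "1 \<le> d * real h" and A: "finite A" "{..<t} \<subseteq> A"
    and \<eta>: "0 < \<eta>" "\<eta> < 1"
  shows "measure_pmf.prob (coins A d)
     {V. \<not> ((1 - \<eta>) * occ u i s t \<le> estimate d h (level h u V i s t) \<and>
            estimate d h (level h u V i s t) \<le> (1 + \<eta>) * occ u i s t)} \<le> 2 * exp (- \<eta>\<^sup>2 / (24 * d))"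
proof -
  define N where "N = occ u i s t"
  define c where "c = exp (- \<eta>\<^sup>2 / (24 * d))"
  have c0: "c \<ge> 0" by (simp add: c_def)
  have d0: "d \<ge> 0" using d by simp
  have up: "measure_pmf.prob (coins A d) {V. (1 + \<eta>) * N < estimate d h (level h u V i s t)} \<le> c"
  proof -
    define y where "y = (LEAST y. (1 + \<eta>) * N < estimate d h y)"
    obtain y0 :: nat where "(1 + \<eta>) * N < y0" using reals_Archimedean2 by blast
    then have "(1 + \<eta>) * N < estimate d h y0" using estimate_ge[OF d0, of y0 h] by linarith
    then have y: "(1 + \<eta>) * N < estimate d h y" unfolding y_def by (rule LeastI)
    have "estimate d h y > 0" using y \<eta> by (smt (verit) mult_nonneg_nonneg of_nat_0_le_iff)
    then have ypos: "y > 0" by (cases y) auto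
    have sub: "{V. (1 + \<eta>) * N < estimate d h (level h u V i s t)} \<subseteq> {V. y \<le> level h u V i s t}"
      unfolding y_def by (auto intro: Least_le)
    show ?thesis
    proof (cases "y \<le> N")
      case False
      then have "{V. y \<le> level h u V i s t} = {}"
        using level_le_occ[of h u _ i s t] by (auto simp: N_def) (meson order_trans)
      then show ?thesis using sub c0 by (simp add: subset_empty)
    next
      case True
      \<comment> \<open>An error relative to \<open>N\<close> is turned into one relative to the
        estimate at the price of halving \<open>\<eta>\<close>;
        \<open>(\<eta>/2)\<^sup>2 / (6 * d)\<close> is then the exponent of the lower tail as
        well.\<close>
      have "(1 - \<eta>/2) * ((1 + \<eta>) * N) \<le> (1 - \<eta>/2) * estimate d h y"
        using y \<eta> by (intro mult_left_mono) auto
      moreover have "real N \<le> (1 - \<eta>/2) * ((1 + \<eta>) * N)"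
      proof -
        have "\<eta> * (1 - \<eta>) \<ge> 0" using \<eta> by simp
        then have "1 \<le> (1 - \<eta>/2) * (1 + \<eta>)" by (simp add: algebra_simps)
        from mult_right_mono[OF this, of "real N"] show ?thesis by (simp add: mult_ac)
      qed
      ultimately have dev: "estimate d h y - real N \<ge> (\<eta>/2) * estimate d h y" by (simp add: algebra_simps)
      obtain \<mu> where \<mu>: "\<mu> > 0" "(1 + \<mu>) ^ N \<le> exp (- (\<eta>/2)\<^sup>2 / (6 * d)) * (\<Prod>k<y. 1 + \<mu> * weight d h k)"
        using upper_potential[OF d _ _ True dev ypos] \<eta> by auto
      have "- (\<eta>/2)\<^sup>2 / (6 * d) = - \<eta>\<^sup>2 / (24 * d)" by (simp add: power2_eq_square)
      then have "measure_pmf.prob (coins A d) {V. y \<le> level h u V i s t} \<le> c"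
        using \<mu> unfolding c_def N_def by (intro level_upper_tail[OF d A \<mu>(1)]) simp
      then show ?thesis using measure_pmf.finite_measure_mono[OF sub, of "coins A d"] by simp
    qed
  qed
  have low: "measure_pmf.prob (coins A d) {V. estimate d h (level h u V i s t) < (1 - \<eta>) * N} \<le> c"
  proof (cases "{V. estimate d h (level h u V i s t) < (1 - \<eta>) * N} = {}")
    case True
    then show ?thesis using c0 by (simp only:) simp
  next
    case False
    define Y where "Y = {y. estimate d h y < (1 - \<eta>) * N}"
    have YN: "y < N" if "y \<in> Y" for y
    proof -
      have "real y < (1 - \<eta>) * N" using that estimate_ge[OF d0, of y h] by (auto simp: Y_def)
      also have "\<dots> \<le> N" using \<eta> by (simp add: mult_left_le_one_le)
      finally show ?thesis by simp
    qed
    then have fin: "finite Y" by (meson finite_nat_set_iff_bounded)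
    obtain V0 where V0: "level h u V0 i s t \<in> Y" using False by (auto simp: Y_def)
    define y where "y = Max Y"
    have yY: "y \<in> Y" unfolding y_def using fin V0 by (intro Max_in) auto
    have le: "level h u V i s t \<le> y" if "level h u V i s t \<in> Y" for V
      unfolding y_def using fin that by simp
    \<comment> \<open>A counter below level \<open>h\<close> is exact and cannot underestimate. This
      supplies \<open>1 \<le> d * estimate d h y\<close>.\<close>
    have "y \<ge> h"
    proof (rule ccontr)
      assume "\<not> y \<ge> h"
      then have "level h u V0 i s t < h" using le[OF V0] by simp
      then have "occ u i s t \<le> level h u V0 i s t" using level_ge_min[of u i s t h V0] by simp
      then show False using YN[OF yY] le[OF V0] by (simp add: N_def)
    qed
    then have "d * real h \<le> d * estimate d h y"
      using estimate_ge[OF d0, of y h] d by (intro mult_left_mono) auto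
    then have dS: "d * estimate d h y \<ge> 1" using dh by simp
    have dev: "real N - estimate d h y \<ge> \<eta> * real N" using yY by (simp add: Y_def algebra_simps)
    obtain \<nu> where \<nu>: "\<nu> > 0" "\<nu> * weight d h y \<le> 1" "\<And>k. k < y \<Longrightarrow> \<nu> * weight d h k < 1"
       "(1 - \<nu>) ^ N \<le> c * (\<Prod>k<y. 1 - \<nu> * weight d h k)"
      using lower_potential[OF d \<eta> dS dev] unfolding c_def by blast
    have "measure_pmf.prob (coins A d) {V. level h u V i s t \<le> y} \<le> c"
      using \<nu> unfolding N_def by (intro level_lower_tail[OF d A \<nu>(1)])
    moreover have "{V. estimate d h (level h u V i s t) < (1 - \<eta>) * N} \<subseteq> {V. level h u V i s t \<le> y}"
      using le by (auto simp: Y_def)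
    ultimately show ?thesis
      using measure_pmf.finite_measure_mono[of "{V. estimate d h (level h u V i s t) < (1 - \<eta>) * N}"
         "{V. level h u V i s t \<le> y}" "coins A d"] by simp
  qed
  have "measure_pmf.prob (coins A d)
     ({V. estimate d h (level h u V i s t) < (1 - \<eta>) * N} \<union> {V. (1 + \<eta>) * N < estimate d h (level h u V i s t)}) \<le> c + c"
    using low up by (intro order_trans[OF measure_Un_le] add_mono) auto
  then show ?thesis
    by (simp add: N_def c_def Collect_disj_eq[symmetric] not_le de_Morgan_conj)
qed

section \<open>Buffers and survival\<close>

context
  fixes h K B X :: nat and u :: "nat \<Rightarrow> nat"
begin

text \<open>
  The parameter \<open>K\<close> is the coin value that picks up an item, \<open>B\<close> the capacity of a buffer and \<open>X\<close> the top
  level. An item that is picked up starts at level 1, as its counter includes the current occurrence.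
\<close>

definition enters :: "(nat \<Rightarrow> nat list) \<Rightarrow> nat \<Rightarrow> nat \<Rightarrow> nat \<Rightarrow> bool" where
  "enters b i v x \<longleftrightarrow> x - 1 - h \<le> v \<and> (if x = 1 then K \<le> v else i \<in> set (b (x - 1)))"

text \<open>A buffer holds item names only; the level is the index of the buffer. New entries go to
  the front, so \<open>take B\<close> evicts the oldest. An item may be picked up again while it is
  stored and then sits in several buffers; two of its counters that meet in one buffer merge, as
  \<open>removeAll\<close> precedes the insertion.\<close>

definition buffer_step :: "(nat \<Rightarrow> nat list) \<Rightarrow> nat \<Rightarrow> nat \<Rightarrow> nat \<Rightarrow> nat list" where
  "buffer_step b i v = (\<lambda>x. if x = 0 \<or> X < x then []
     else if enters b i v x then take B (i # removeAll i (b x))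
     else if x - h \<le> v then removeAll i (b x) else b x)"

primrec buffers :: "(nat \<Rightarrow> nat) \<Rightarrow> nat \<Rightarrow> nat \<Rightarrow> nat list" where
  "buffers V 0 = (\<lambda>_. [])"
| "buffers V (Suc t) = buffer_step (buffers V t) (u t) (V t)"

text \<open>The counter that is started at time \<open>s\<close> and never evicted moves to level \<open>x\<close> at time \<open>t\<close>.\<close>

definition reaches :: "(nat \<Rightarrow> nat) \<Rightarrow> nat \<Rightarrow> nat \<Rightarrow> nat \<Rightarrow> bool" where
  "reaches V s t x \<longleftrightarrow> s \<le> t \<and> u s = u t \<and> K \<le> V s \<and> 0 < x \<and>
     level h u V (u t) s t = x - 1 \<and> level h u V (u t) s (Suc t) = x"

lemma buffers_outside: "x = 0 \<or> X < x \<Longrightarrow> buffers V t x = []"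
  by (cases t) (auto simp: buffer_step_def)

lemma buffers_range: "i \<in> set (buffers V t x) \<Longrightarrow> 0 < x \<and> x \<le> X"
  using buffers_outside[of x V t] by (cases "x = 0 \<or> X < x") auto

text \<open>Evictions lose counters but never create wrong ones: an item that moves up inherits the
  starting point it had in the buffer below, and one that stays keeps its own.\<close>

lemma buffers_origin:
  "i \<in> set (buffers V t x) \<Longrightarrow> \<exists>s<t. u s = i \<and> K \<le> V s \<and> level h u V i s t = x"
proof (induction t arbitrary: i x)
  case (Suc t)
  have x: "0 < x" "x \<le> X" using buffers_range[OF Suc.prems] by auto
  show ?case
  proof (cases "u t = i \<and> enters (buffers V t) (u t) (V t) x")
    case True
    show ?thesis
    proof (cases "x = 1")
      case True
      with \<open>u t = i \<and> _\<close> show ?thesis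
        by (intro exI[of _ t]) (auto simp: enters_def level_eq_0)
    next
      case False
      then have "i \<in> set (buffers V t (x - 1))" using True by (auto simp: enters_def)
      from Suc.IH[OF this] obtain s where "s < t" "u s = i" "K \<le> V s" "level h u V i s t = x - 1" by blast
      then show ?thesis using True x by (intro exI[of _ s]) (auto simp: enters_def)
    qed
  next
    case False
    then have "i \<in> set (buffers V t x)"
      using Suc.prems x by (auto simp: buffer_step_def dest!: in_set_takeD split: if_splits)
    from Suc.IH[OF this] obtain s where s: "s < t" "u s = i" "K \<le> V s" "level h u V i s t = x" by blast
    \<comment> \<open>An item whose coin moves it out of buffer \<open>x\<close> is still there
      afterwards only if it has entered anew, which is the other case.\<close>
    moreover have "\<not> (u t = i \<and> x - h \<le> V t)"
      using False Suc.prems x by (auto simp: buffer_step_def split: if_splits)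
    ultimately show ?thesis by (intro exI[of _ s]) auto
  qed
qed simp

section \<open>Charging state changes to sampled starting points\<close>

lemma enters_reaches:
  assumes "enters (buffers V t) (u t) (V t) x" "x > 0"
  shows "\<exists>s. reaches V s t x"
proof (cases "x = 1")
  case True
  then show ?thesis using assms
    by (intro exI[of _ t]) (auto simp: enters_def level_eq_0 reaches_def)
next
  case False
  then have "u t \<in> set (buffers V t (x - 1))" using assms by (auto simp: enters_def)
  from buffers_origin[OF this] obtain s where
    "s < t" "u s = u t" "K \<le> V s" "level h u V (u t) s t = x - 1" by blast
  then show ?thesis using assms by (intro exI[of _ s]) (auto simp: enters_def reaches_def)
qed

text \<open>The range ends at \<open>Suc X\<close> because an item that leaves the top buffer
  changes the state too; its ideal counter arrives in a level that has no buffer.\<close>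

lemma change_reaches:
  assumes "buffers V (Suc t) \<noteq> buffers V t"
  shows "\<exists>x\<in>{1..Suc X}. \<exists>s. reaches V s t x"
proof -
  obtain x where ne: "buffers V (Suc t) x \<noteq> buffers V t x" using assms by (auto simp: fun_eq_iff)
  have x: "0 < x" "x \<le> X"
    using ne buffers_outside[of x V t] buffers_outside[of x V "Suc t"] by (metis neq0_conv, metis not_le)
  show ?thesis
  proof (cases "enters (buffers V t) (u t) (V t) x")
    case True
    then show ?thesis using enters_reaches[OF True] x by auto
  next
    case False
    have "buffers V (Suc t) x = (if x - h \<le> V t then removeAll (u t) (buffers V t x) else buffers V t x)"
      using False x by (simp add: buffer_step_def)
    then have *: "x - h \<le> V t" "u t \<in> set (buffers V t x)"
      using ne removeAll_id[of "u t" "buffers V t x"] by argo+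
    from buffers_origin[OF *(2)] obtain s where
      "s < t" "u s = u t" "K \<le> V s" "level h u V (u t) s t = x" by blast
    then have "reaches V s t (Suc x)" using * by (auto simp: reaches_def)
    then show ?thesis using x by (intro bexI[of _ "Suc x"]) auto
  qed
qed

lemma reaches_unique:
  assumes "reaches V s t x" "reaches V s t' x"
  shows "t = t'"
proof -
  have *: "\<not> t < t'" if "reaches V s t x" "reaches V s t' x" for t t'
  proof
    assume "t < t'"
    then have "level h u V (u s) s (Suc t) \<le> level h u V (u s) s t'" by (intro level_mono) auto
    moreover have "level h u V (u s) s (Suc t) = x" "level h u V (u s) s t' = x - 1" "0 < x"
      using that unfolding reaches_def by metis+
    ultimately show False by linarith
  qed
  show ?thesis using *[OF assms] *[OF assms(2,1)] by simp
qed

text \<open>Each change is charged to a starting point and a level reached from it, and a counter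
  reaches a level only once. Evictions cost nothing extra, since they coincide with the entry of
  another item.\<close>

lemma card_changes:
  "card {t \<in> {..<m}. buffers V (Suc t) \<noteq> buffers V t} \<le> card {s \<in> {..<m}. K \<le> V s} * Suc X"
proof -
  let ?C = "{t \<in> {..<m}. buffers V (Suc t) \<noteq> buffers V t}"
  have "\<forall>t\<in>?C. \<exists>p. snd p \<in> {1..Suc X} \<and> reaches V (fst p) t (snd p)"
    using change_reaches by fastforce
  then obtain g where g: "\<And>t. t \<in> ?C \<Longrightarrow> snd (g t) \<in> {1..Suc X} \<and> reaches V (fst (g t)) t (snd (g t))"
    by metis
  have "card ?C \<le> card ({s \<in> {..<m}. K \<le> V s} \<times> {1..Suc X})"
  proof (rule card_inj_on_le[of g])
    show "inj_on g ?C"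
    proof (rule inj_onI)
      fix t t' assume "t \<in> ?C" "t' \<in> ?C" "g t = g t'"
      then show "t = t'" using g[of t] g[of t'] reaches_unique[of V "fst (g t)" t "snd (g t)" t'] by simp
    qed
    show "g ` ?C \<subseteq> {s \<in> {..<m}. K \<le> V s} \<times> {1..Suc X}"
    proof
      fix p assume "p \<in> g ` ?C"
      then obtain t where "t \<in> ?C" "p = g t" by blast
      then show "p \<in> {s \<in> {..<m}. K \<le> V s} \<times> {1..Suc X}"
        using g[of t] by (auto simp: reaches_def mem_Times_iff simp del: level.simps buffers.simps)
    qed
  qed auto
  then show ?thesis by (simp add: card_cartesian_product)
qed

section \<open>Survival of an item in the buffers\<close>

lemma level_le_top:
  assumes "\<And>t'. t' < t \<Longrightarrow> V t' < X - h"
  shows "level h u V i s t \<le> X"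
  using assms
proof (induction t)
  case (Suc t)
  then have "level h u V i s t \<le> X" "V t < X - h" by auto
  then show ?case by auto
qed simp

lemma removeAll_position:
  assumes "b = xs @ i # ys" "i \<noteq> j"
  obtains xs' ys' where "removeAll j b = xs' @ i # ys'" "length xs' \<le> length xs"
  using assms that[of "removeAll j xs" "removeAll j ys"] by (simp add: length_removeAll_less_eq)

text \<open>The item is at the front when its counter has just moved, and only an entry of another
  item into the same buffer pushes it back, by one place. Its position is thus bounded by the number
  of such entries, and fewer than \<open>B\<close> of them cannot make \<open>take B\<close> cut it
  off.\<close>

lemma survival:
  assumes s: "K \<le> V s" "u s = i" "s < m"
    and top: "\<And>t. t < m \<Longrightarrow> V t < X - h" and X: "X > 0"
    and few: "\<And>x. x \<in> {1..X} \<Longrightarrow>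
      card {t \<in> {s..<m}. u t \<noteq> i \<and> level h u V i s t = x \<and> enters (buffers V t) (u t) (V t) x} < B"
    and t: "s < t" "t \<le> m"
  shows "\<exists>xs ys. buffers V t (level h u V i s t) = xs @ i # ys \<and>
    length xs \<le> card {t' \<in> {s..<t}. u t' \<noteq> i \<and> level h u V i s t' = level h u V i s t
       \<and> enters (buffers V t') (u t') (V t') (level h u V i s t)}"
proof -
  define E where "E t x = {t' \<in> {s..<t}. u t' \<noteq> i \<and> level h u V i s t' = x \<and> enters (buffers V t') (u t') (V t') x}" for t x
  have finE: "finite (E t x)" for t x by (simp add: E_def)
  have B0: "B > 0" using few[of 1] X by simp
  have EB: "card (E t x) < B" if "x \<in> {1..X}" "t \<le> m" for t x
  proof -
    have "card (E t x) \<le> card (E m x)" using that(2) finE by (intro card_mono) (auto simp: E_def)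
    also have "\<dots> < B" unfolding E_def by (rule few[OF that(1)])
    finally show ?thesis .
  qed
  have "\<exists>xs ys. buffers V t (level h u V i s t) = xs @ i # ys \<and> length xs \<le> card (E t (level h u V i s t))"
    using t
  proof (induction t)
    case 0
    then show ?case by simp
  next
    case (Suc t)
    let ?b = "buffers V t"
    have lX: "level h u V i s (Suc t) \<le> X" using top Suc.prems by (intro level_le_top) auto
    have front: "\<exists>xs ys. take B (i # l) = xs @ i # ys \<and> length xs \<le> c" for l c
      using B0 by (intro exI[of _ "[]"] exI[of _ "take (B - 1) l"]) (cases B; simp)
    show ?case
    proof (cases "s = t")
      case True
      then have "level h u V i s (Suc t) = 1" "enters ?b (u t) (V t) 1"
        using s by (auto simp: level_eq_0 enters_def)
      then show ?thesis using X s True front by (simp add: buffer_step_def)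
    next
      case False
      define x where "x = level h u V i s t"
      obtain xs ys where b: "?b x = xs @ i # ys" and len: "length xs \<le> card (E t x)"
        using Suc False unfolding x_def by fastforce
      have x: "0 < x" "x \<le> X" using buffers_range[of i V t x] b by auto
      show ?thesis
      proof (cases "u t = i")
        case True
        show ?thesis
        proof (cases "x - h \<le> V t")
          case leave: True
          then have l: "level h u V i s (Suc t) = Suc x" using True Suc.prems by (simp add: x_def)
          have "enters ?b (u t) (V t) (Suc x)" using leave True b x by (simp add: enters_def)
          then show ?thesis using l lX True front by (simp add: buffer_step_def)
        next
          case stay: False
          then have l: "level h u V i s (Suc t) = x" using True Suc.prems by (simp add: x_def)
          show ?thesis
          proof (cases "enters ?b (u t) (V t) x")
            case e: True
            show ?thesis unfolding l using e x True front by (simp add: buffer_step_def)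
          next
            case e: False
            have "E (Suc t) x = E t x" using True by (auto simp: E_def less_Suc_eq)
            then show ?thesis unfolding l using e x stay b len
              by (intro exI[of _ xs] exI[of _ ys]) (simp add: buffer_step_def)
          qed
        qed
      next
        case other: False
        then have l: "level h u V i s (Suc t) = x" by (simp add: x_def)
        obtain xs' ys' where r: "removeAll (u t) (?b x) = xs' @ i # ys'" "length xs' \<le> length xs"
          using removeAll_position[OF b] other by metis
        show ?thesis
        proof (cases "enters ?b (u t) (V t) x")
          case e: True
          have "E (Suc t) x = insert t (E t x)" using other e Suc.prems by (auto simp: E_def x_def less_Suc_eq)
          moreover have "t \<notin> E t x" by (simp add: E_def)
          ultimately have cE: "card (E (Suc t) x) = Suc (card (E t x))" using finE by simp
          then have "Suc (card (E t x)) < B" using EB[of x "Suc t"] x Suc.prems by simp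
          then have lB: "Suc (length xs') < B" using r len by simp
          \<comment> \<open>The 2 accounts for the new front entry and for \<open>i\<close>
            itself.\<close>
          have "take B (u t # removeAll (u t) (?b x)) = (u t # xs') @ i # take (B - length xs' - 2) ys'"
            unfolding r using lB by (simp add: take_Cons' less_imp_Suc_add) 
          then show ?thesis unfolding l using e x r len cE
            by (intro exI[of _ "u t # xs'"] exI[of _ "take (B - length xs' - 2) ys'"]) (simp add: buffer_step_def)
        next
          case e: False
          have E: "E (Suc t) x = E t x" using e by (auto simp: E_def less_Suc_eq)
          show ?thesis
          proof (cases "x - h \<le> V t")
            case True
            then show ?thesis unfolding l E using e x r len
              by (intro exI[of _ xs'] exI[of _ ys']) (simp add: buffer_step_def)
          next
            case False
            then show ?thesis unfolding l E using e x b len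
              by (intro exI[of _ xs] exI[of _ ys]) (simp add: buffer_step_def)
          qed
        qed
      qed
    qed
  qed
  then show ?thesis unfolding E_def .
qed

text \<open>Actual entries into a buffer depend on earlier evictions and hence on the coins of
  \<open>i\<close>. The moves of ideal counters of other items contain all these entries and do not
  depend on the coins of \<open>i\<close>.\<close>

definition rivals :: "nat \<Rightarrow> (nat \<Rightarrow> nat) \<Rightarrow> nat \<Rightarrow> nat \<Rightarrow> nat set" where
  "rivals m V i x = {t \<in> {..<m}. u t \<noteq> i \<and> (\<exists>s. reaches V s t x)}"

text \<open>
  The starting points of \<open>i\<close> from which it may be evicted. The window consists of the times at which
  an accurate counter of \<open>i\<close> can still be at level \<open>x\<close>; it is described without the coins of \<open>i\<close>.
\<close>

definition crowded :: "real \<Rightarrow> nat \<Rightarrow> (nat \<Rightarrow> nat) \<Rightarrow> nat \<Rightarrow> nat set" where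
  "crowded d m V i = {s \<in> {..<m}. u s = i \<and> (\<exists>x\<in>{1..X}.
     B \<le> card {t \<in> rivals m V i x. s \<le> t \<and> occ u i s t \<le> 2 * estimate d h x})}"

lemma rivals_cong:
  assumes "\<And>t. t < m \<Longrightarrow> u t \<noteq> i \<Longrightarrow> V t = W t"
  shows "rivals m V i x = rivals m W i x"
proof -
  have "reaches V s t x = reaches W s t x" if "t < m" "u t \<noteq> i" for s t
  proof (cases "s \<le> t \<and> u s = u t")
    case True
    have "level h u V (u t) s t = level h u W (u t) s t"
      "level h u V (u t) s (Suc t) = level h u W (u t) s (Suc t)"
      using that assms by (auto intro!: level_cong simp del: level.simps)
    moreover have "V s = W s" using True that assms by auto
    ultimately show ?thesis by (simp add: reaches_def)
  qed (auto simp: reaches_def)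
  then show ?thesis by (auto simp: rivals_def)
qed

text \<open>This is the source of independence: the coins drawn at occurrences of \<open>i\<close>
  are not read, so they stay free once the crowded starting points are fixed.\<close>

lemma crowded_cong:
  assumes "\<And>t. t < m \<Longrightarrow> u t \<noteq> i \<Longrightarrow> V t = W t"
  shows "crowded d m V i = crowded d m W i"
proof -
  have "rivals m V i = rivals m W i" by (rule ext, rule rivals_cong) (fact assms)
  then show ?thesis by (simp add: crowded_def)
qed

text \<open>While the counter is at level \<open>x\<close>, accuracy keeps its age within
  \<open>2 * estimate d h x\<close> occurrences. Every entry that could push it back then lies in
  the window used by \<open>crowded\<close>, so fewer than \<open>B\<close> such entries
  occur.\<close>

lemma uncrowded_survives:
  assumes s: "K \<le> V s" "u s = i" "s < m" "s \<notin> crowded d m V i"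
    and top: "\<And>t. t < m \<Longrightarrow> V t < X - h" and X: "X > 0"
    and acc: "\<And>t. t < m \<Longrightarrow> occ u i s t \<le> 2 * estimate d h (level h u V i s t)"
  shows "i \<in> set (buffers V m (level h u V i s m))"
proof -
  have few: "card {t \<in> {s..<m}. u t \<noteq> i \<and> level h u V i s t = x \<and> enters (buffers V t) (u t) (V t) x} < B"
    if x: "x \<in> {1..X}" for x
  proof -
    have "{t \<in> {s..<m}. u t \<noteq> i \<and> level h u V i s t = x \<and> enters (buffers V t) (u t) (V t) x} \<subseteq>
       {t \<in> rivals m V i x. s \<le> t \<and> occ u i s t \<le> 2 * estimate d h x}"
    proof
      fix t assume t: "t \<in> {t \<in> {s..<m}. u t \<noteq> i \<and> level h u V i s t = x \<and> enters (buffers V t) (u t) (V t) x}"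
      then have "\<exists>s. reaches V s t x" using x by (intro enters_reaches) auto
      then show "t \<in> {t \<in> rivals m V i x. s \<le> t \<and> occ u i s t \<le> 2 * estimate d h x}"
        using t acc[of t] unfolding rivals_def by simp
    qed
    moreover have "finite {t \<in> rivals m V i x. s \<le> t \<and> occ u i s t \<le> 2 * estimate d h x}"
      by (simp add: rivals_def)
    ultimately have "card {t \<in> {s..<m}. u t \<noteq> i \<and> level h u V i s t = x \<and> enters (buffers V t) (u t) (V t) x} \<le>
       card {t \<in> rivals m V i x. s \<le> t \<and> occ u i s t \<le> 2 * estimate d h x}" by (rule card_mono[rotated])
    also have "\<dots> < B" using s x unfolding crowded_def by (auto simp: not_le)
    finally show ?thesis .
  qed
  obtain xs ys where "buffers V m (level h u V i s m) = xs @ i # ys"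
    using survival[where t = m, OF s(1-3) top X few] s(3) by blast
  then show ?thesis by simp
qed

section \<open>Counting the crowded starting points\<close>

lemma occ_strict:
  assumes "s < s'" "s' \<le> t" "u s = i"
  shows "occ u i s' t < occ u i s t"
proof -
  have "{t' \<in> {s'..<t}. u t' = i} \<subseteq> {t' \<in> {s..<t}. u t' = i} - {s}" using assms(1) by auto
  then have "card {t' \<in> {s'..<t}. u t' = i} \<le> card ({t' \<in> {s..<t}. u t' = i} - {s})" by (intro card_mono) auto
  also have "\<dots> < card {t' \<in> {s..<t}. u t' = i}" using assms by (intro card_Diff1_less) auto
  finally show ?thesis by (simp add: occ_def)
qed

lemma occ_mono: "s' \<le> s \<Longrightarrow> t \<le> t' \<Longrightarrow> occ u i s t \<le> occ u i s' t'"
  unfolding occ_def by (intro card_mono) auto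

text \<open>Listed backwards from \<open>t\<close>, the occurrences of \<open>i\<close> have counts
  1, 2, 3 and so on.\<close>

lemma card_recent:
  fixes c :: real
  assumes "c \<ge> 0"
  shows "card {s \<in> {..<t}. u s = i \<and> occ u i s t \<le> c} \<le> c"
proof -
  let ?A = "{s \<in> {..<t}. u s = i \<and> occ u i s t \<le> c}"
  have "card ?A \<le> card {1..nat \<lfloor>c\<rfloor>}"
  proof (rule card_inj_on_le[of "\<lambda>s. occ u i s t"])
    show "inj_on (\<lambda>s. occ u i s t) ?A"
    proof (rule inj_onI, rule ccontr)
      fix s s' assume "s \<in> ?A" "s' \<in> ?A" "occ u i s t = occ u i s' t" "s \<noteq> s'"
      then show False using occ_strict[of s s' t i] occ_strict[of s' s t i] by (auto simp: neq_iff)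
    qed
    have "0 < occ u i s t" if "s < t" "u s = i" for s
      using occ_strict[of s t t i] that by simp
    then show "(\<lambda>s. occ u i s t) ` ?A \<subseteq> {1..nat \<lfloor>c\<rfloor>}"
      by (force simp: le_nat_floor Suc_le_eq)
  qed simp
  then show ?thesis using assms by simp linarith
qed

text \<open>Each arrival is charged to its starting point, injectively because a counter arrives in
  a level once. By accuracy, an item whose counter gets to level \<open>x\<close> occurs at least
  \<open>estimate d h x / 2\<close> times.\<close>

lemma card_rivals:
  assumes acc: "\<And>s t. s < t \<Longrightarrow> t \<le> m \<Longrightarrow> estimate d h (level h u V (u s) s t) \<le> 2 * occ u (u s) s t"
  shows "card (rivals m V i x) \<le> card {s \<in> {..<m}. K \<le> V s \<and> estimate d h x \<le> 2 * occ u (u s) 0 m}"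
proof -
  let ?S = "{s \<in> {..<m}. K \<le> V s \<and> estimate d h x \<le> 2 * occ u (u s) 0 m}"
  obtain g where g: "\<And>t. t \<in> rivals m V i x \<Longrightarrow> reaches V (g t) t x"
  proof -
    have "\<forall>t\<in>rivals m V i x. \<exists>s. reaches V s t x" by (simp add: rivals_def)
    then show thesis using that by metis
  qed
  show ?thesis
  proof (rule card_inj_on_le[of g])
    show "inj_on g (rivals m V i x)"
    proof (rule inj_onI)
      fix t t' assume "t \<in> rivals m V i x" "t' \<in> rivals m V i x" "g t = g t'"
      then show "t = t'" using g[of t] g[of t'] reaches_unique[of V "g t" t x t'] by simp
    qed
    show "g ` rivals m V i x \<subseteq> ?S"
    proof safe
      fix t assume t: "t \<in> rivals m V i x"
      then have tm: "t < m" by (simp add: rivals_def)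
      have r: "g t \<le> t" "u (g t) = u t" "K \<le> V (g t)" "level h u V (u (g t)) (g t) (Suc t) = x"
        using g[OF t] by (auto simp: reaches_def simp del: level.simps)
      show "K \<le> V (g t)" by (rule r)
      show "g t < m" using r tm by simp
      have "estimate d h x \<le> 2 * occ u (u (g t)) (g t) (Suc t)"
        using acc[of "g t" "Suc t"] r tm by (simp del: level.simps occ_Suc)
      also have "\<dots> \<le> 2 * occ u (u (g t)) 0 m"
        using tm occ_mono[of 0 "g t" "Suc t" m] by (simp del: occ_Suc)
      finally show "estimate d h x \<le> real (2 * occ u (u (g t)) 0 m)" by simp
    qed
  qed simp
qed

text \<open>
  Double counting: an entry into level \<open>x\<close> lies in the windows of at most \<open>2 * estimate d h x\<close> starting
  points, and only items of frequency at least \<open>estimate d h x / 2\<close> cause such entries.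
\<close>

lemma card_crowded:
  assumes d: "d \<ge> 0"
    and acc: "\<And>s t. s < t \<Longrightarrow> t \<le> m \<Longrightarrow> estimate d h (level h u V (u s) s t) \<le> 2 * occ u (u s) s t"
  shows "real (card (crowded d m V i)) * B \<le> 4 * X * (\<Sum>s\<in>{s \<in> {..<m}. K \<le> V s}. real (occ u (u s) 0 m))"
proof -
  define W where "W s x = {t \<in> rivals m V i x. s \<le> t \<and> occ u i s t \<le> 2 * estimate d h x}" for s x
  define Occs where "Occs = {s \<in> {..<m}. u s = i}"
  have finR: "finite (rivals m V i x)" for x by (simp add: rivals_def)
  have finW: "finite (W s x)" for s x using finR by (simp add: W_def)
  have est0: "estimate d h x \<ge> 0" for x using estimate_ge[OF d, of x h] by linarith
  have "real (card (crowded d m V i)) * B = (\<Sum>s\<in>crowded d m V i. real B)" by simp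
  also have "\<dots> \<le> (\<Sum>s\<in>crowded d m V i. \<Sum>x=1..X. real (card (W s x)))"
  proof (rule sum_mono)
    fix s assume "s \<in> crowded d m V i"
    then obtain x where x: "x \<in> {1..X}" "B \<le> card (W s x)" unfolding crowded_def W_def by blast
    have "real (card (W s x)) \<le> (\<Sum>x=1..X. real (card (W s x)))" by (rule member_le_sum) (use x in auto)
    then show "real B \<le> (\<Sum>x=1..X. real (card (W s x)))" using x by linarith
  qed
  also have "\<dots> \<le> (\<Sum>s\<in>Occs. \<Sum>x=1..X. real (card (W s x)))"
    by (intro sum_mono2) (auto simp: Occs_def crowded_def intro: sum_nonneg)
  also have "\<dots> = (\<Sum>x=1..X. \<Sum>s\<in>Occs. real (card (W s x)))" by (rule sum.swap)
  also have "\<dots> \<le> (\<Sum>x=1..X. 4 * (\<Sum>s\<in>{s \<in> {..<m}. K \<le> V s}. real (occ u (u s) 0 m)))"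
  proof (rule sum_mono)
    fix x
    let ?e = "estimate d h x"
    have "(\<Sum>s\<in>Occs. real (card (W s x))) = (\<Sum>s\<in>Occs. \<Sum>t\<in>rivals m V i x. if s \<le> t \<and> occ u i s t \<le> 2 * ?e then 1 else 0)"
      unfolding W_def using finR by (intro sum.cong refl) (simp add: sum.If_cases Int_def conj_commute)
    also have "\<dots> = (\<Sum>t\<in>rivals m V i x. \<Sum>s\<in>Occs. if s \<le> t \<and> occ u i s t \<le> 2 * ?e then 1 else 0)" by (rule sum.swap)
    also have "\<dots> \<le> (\<Sum>t\<in>rivals m V i x. 2 * ?e)"
    proof (rule sum_mono)
      fix t assume t: "t \<in> rivals m V i x"
      have "(\<Sum>s\<in>Occs. if s \<le> t \<and> occ u i s t \<le> 2 * ?e then 1 else 0) = real (card {s\<in>Occs. s \<le> t \<and> occ u i s t \<le> 2 * ?e})"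
        unfolding Occs_def by (simp add: sum.If_cases Int_def conj_commute)
      also have "{s\<in>Occs. s \<le> t \<and> occ u i s t \<le> 2 * ?e} = {s \<in> {..<t}. u s = i \<and> occ u i s t \<le> 2 * ?e}"
        using t by (auto simp: Occs_def rivals_def order_le_less)
      also have "real (card \<dots>) \<le> 2 * ?e" using est0 by (intro card_recent) simp
      finally show "(\<Sum>s\<in>Occs. if s \<le> t \<and> occ u i s t \<le> 2 * ?e then 1 else 0) \<le> 2 * ?e" .
    qed
    also have "\<dots> \<le> real (card {s \<in> {..<m}. K \<le> V s \<and> ?e \<le> 2 * occ u (u s) 0 m}) * (2 * ?e)"
    proof -
      have "card (rivals m V i x) \<le> card {s \<in> {..<m}. K \<le> V s \<and> ?e \<le> 2 * occ u (u s) 0 m}"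
        by (rule card_rivals) (rule acc)
      then have "real (card (rivals m V i x)) * (2 * ?e) \<le> real (card {s \<in> {..<m}. K \<le> V s \<and> ?e \<le> 2 * occ u (u s) 0 m}) * (2 * ?e)"
        using est0 by (intro mult_right_mono) auto
      then show ?thesis by simp
    qed
    also have "\<dots> = (\<Sum>s\<in>{s \<in> {..<m}. K \<le> V s \<and> ?e \<le> 2 * occ u (u s) 0 m}. 2 * ?e)" by simp
    \<comment> \<open>Here the size of the level cancels: long windows are paid for by the high
      frequency of the items that get this far. The sum over levels then costs only the factor
      \<open>X\<close>.\<close>
    also have "\<dots> \<le> (\<Sum>s\<in>{s \<in> {..<m}. K \<le> V s \<and> ?e \<le> 2 * occ u (u s) 0 m}. 4 * real (occ u (u s) 0 m))"
      by (rule sum_mono) auto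
    also have "\<dots> \<le> (\<Sum>s\<in>{s \<in> {..<m}. K \<le> V s}. 4 * real (occ u (u s) 0 m))"
      by (rule sum_mono2) auto
    finally show "(\<Sum>s\<in>Occs. real (card (W s x))) \<le> 4 * (\<Sum>s\<in>{s \<in> {..<m}. K \<le> V s}. real (occ u (u s) 0 m))"
      by (simp add: sum_distrib_left)
  qed
  finally show ?thesis by simp
qed

end

section \<open>Streaming algorithms from finite automata\<close>

lemma state_changes_Cons:
  "state_changes (a # b # \<tau>) = (if a \<noteq> b then 1 else 0) + state_changes (b # \<tau>)"
proof -
  let ?A = "\<lambda>\<tau>. {t \<in> {1..<length \<tau>}. \<tau> ! t \<noteq> \<tau> ! (t - 1)}"
  have "?A (a # b # \<tau>) = (if a \<noteq> b then {1} else {}) \<union> Suc ` ?A (b # \<tau>)" (is "?l = ?r")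
  proof (rule set_eqI)
    fix t
    show "t \<in> ?l \<longleftrightarrow> t \<in> ?r"
    proof (cases t)
      case (Suc t')
      then show ?thesis by (cases t') auto
    qed auto
  qed
  moreover have "card ((if a \<noteq> b then {1} else {}) \<union> Suc ` ?A (b # \<tau>)) =
      card (if a \<noteq> b then {1::nat} else {}) + card (Suc ` ?A (b # \<tau>))"
    by (rule card_Un_disjoint) auto
  ultimately show ?thesis by (simp add: state_changes_def card_image)
qed

primrec run :: "('s \<Rightarrow> nat \<Rightarrow> nat \<Rightarrow> 's) \<Rightarrow> 's \<Rightarrow> nat list \<Rightarrow> nat \<Rightarrow> (nat \<Rightarrow> nat) \<Rightarrow> 's list" where
  "run f s [] t V = [s]"
| "run f s (i # us) t V = s # run f (f s i (V t)) us (Suc t) V"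

primrec state_at :: "('s \<Rightarrow> nat \<Rightarrow> nat \<Rightarrow> 's) \<Rightarrow> 's \<Rightarrow> (nat \<Rightarrow> nat) \<Rightarrow> (nat \<Rightarrow> nat) \<Rightarrow> nat \<Rightarrow> 's" where
  "state_at f s u V 0 = s"
| "state_at f s u V (Suc t) = f (state_at f s u V t) (u t) (V t)"

lemma run_not_Nil [simp]: "run f s us t V \<noteq> []"
  by (cases us) auto

lemma run_upd: "t' < t \<Longrightarrow> run f s us t (V(t' := v)) = run f s us t V"
  by (induction us arbitrary: s t) auto

lemma last_run_aux:
  "t \<le> length us \<Longrightarrow> last (run f (state_at f s ((!) us) V t) (drop t us) t V) = state_at f s ((!) us) V (length us)"
proof (induction t rule: inc_induct)
  case (step t)
  then show ?case by (simp add: Cons_nth_drop_Suc[symmetric])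
qed simp

lemma last_run: "last (run f s us 0 V) = state_at f s ((!) us) V (length us)"
  using last_run_aux[of 0 us f s V] by simp

text \<open>The fresh coins of the single steps may all be drawn in advance. This replaces the
  recursive distribution by a deterministic run over the product space \<open>coins\<close>, with
  one coin per time.\<close>

lemma trajectory_from_run:
  assumes step: "\<And>s i. s \<in> Q \<Longrightarrow> i \<in> U \<Longrightarrow> step A (enc s) i = map_pmf (\<lambda>v. enc (f s i v)) (coin d)"
    and closed: "\<And>s i v. s \<in> Q \<Longrightarrow> i \<in> U \<Longrightarrow> f s i v \<in> Q"
    and "s \<in> Q" "set us \<subseteq> U"
  shows "trajectory_from A (enc s) us = map_pmf (\<lambda>V. map enc (run f s us t V)) (coins {t..<t + length us} d)"
  using assms(3,4)
proof (induction us arbitrary: s t)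
  case Nil
  then show ?case by (simp add: coins_def)
next
  case (Cons i us)
  have ins: "{t..<t + length (i # us)} = insert t {Suc t..<Suc t + length us}" by auto
  have "trajectory_from A (enc s) (i # us) =
     bind_pmf (coin d) (\<lambda>v. map_pmf (\<lambda>\<tau>. enc s # \<tau>) (trajectory_from A (enc (f s i v)) us))"
    using Cons.prems by (simp add: step bind_map_pmf)
  also have "\<dots> = bind_pmf (coin d) (\<lambda>v. map_pmf (\<lambda>\<tau>. enc s # \<tau>)
      (map_pmf (\<lambda>V. map enc (run f (f s i v) us (Suc t) V)) (coins {Suc t..<Suc t + length us} d)))"
    using Cons.prems closed by (subst Cons.IH[where t = "Suc t"]) auto
  also have "\<dots> = map_pmf (\<lambda>V. map enc (run f s (i # us) t V)) (coins {t..<t + length (i # us)} d)"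
    unfolding coins_def ins
    by (subst Pi_pmf_insert') (auto simp: map_bind_pmf map_pmf_comp run_upd map_pmf_def[symmetric] bind_return_pmf intro!: bind_pmf_cong)
  finally show ?case .
qed

text \<open>The change budget is respected with high probability only, but the bound must hold
  always, so the automaton freezes after \<open>c\<close> changes. The number of changes is stored
  in the state and moves only together with it, hence recording it causes no further
  changes.\<close>

definition capped :: "nat \<Rightarrow> ('s \<Rightarrow> nat \<Rightarrow> nat \<Rightarrow> 's) \<Rightarrow> 's \<times> nat \<Rightarrow> nat \<Rightarrow> nat \<Rightarrow> 's \<times> nat" where
  "capped c f = (\<lambda>(s, k) i v. if f s i v = s \<or> c \<le> k then (s, k) else (f s i v, Suc k))"

lemma state_changes_capped:
  "snd p \<le> c \<Longrightarrow> state_changes (map enc (run (capped c f) p us t V)) \<le> c - snd p"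
proof (induction us arbitrary: p t)
  case Nil
  then show ?case by (simp add: state_changes_def)
next
  case (Cons i us)
  define p' where "p' = capped c f p i (V t)"
  have p': "snd p' \<le> c" "p' = p \<or> snd p' = Suc (snd p)"
    using Cons.prems by (auto simp: p'_def capped_def split: prod.splits)
  obtain \<tau> where \<tau>: "map enc (run (capped c f) p' us (Suc t) V) = enc p' # \<tau>" by (cases us) auto
  have "state_changes (map enc (run (capped c f) p (i # us) t V)) =
     (if enc p \<noteq> enc p' then 1 else 0) + state_changes (map enc (run (capped c f) p' us (Suc t) V))"
    unfolding run.simps list.map p'_def[symmetric] \<tau> by (rule state_changes_Cons)
  also have "\<dots> \<le> (if enc p \<noteq> enc p' then 1 else 0) + (c - snd p')" using Cons.IH[OF p'(1)] by simp
  also have "\<dots> \<le> c - snd p" using p' by auto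
  finally show ?case .
qed

lemma state_at_capped:
  assumes "card {t \<in> {..<m}. state_at f s u V (Suc t) \<noteq> state_at f s u V t} \<le> c"
  shows "state_at (capped c f) (s, 0) u V m =
    (state_at f s u V m, card {t \<in> {..<m}. state_at f s u V (Suc t) \<noteq> state_at f s u V t})"
  using assms
proof (induction m)
  case (Suc m)
  let ?C = "\<lambda>m. {t \<in> {..<m}. state_at f s u V (Suc t) \<noteq> state_at f s u V t}"
  show ?case
  proof (cases "state_at f s u V (Suc m) = state_at f s u V m")
    case True
    then have C: "?C (Suc m) = ?C m" by (auto simp: less_Suc_eq simp del: state_at.simps(2))
    then have "state_at (capped c f) (s, 0) u V m = (state_at f s u V m, card (?C m))"
      using Suc.IH Suc.prems unfolding C by blast
    then show ?thesis unfolding C using True by (simp add: capped_def)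
  next
    case False
    then have "?C (Suc m) = insert m (?C m)" by (auto simp: less_Suc_eq simp del: state_at.simps(2))
    then have C: "card (?C (Suc m)) = Suc (card (?C m))" by simp
    then have lt: "card (?C m) < c" using Suc.prems by linarith
    then have "state_at (capped c f) (s, 0) u V m = (state_at f s u V m, card (?C m))"
      by (intro Suc.IH less_imp_le)
    with lt show ?thesis unfolding C using False by (simp add: capped_def)
  qed
qed simp

text \<open>All states but the initial one get strings of length exactly \<open>l\<close>; as
  \<open>l \<ge> 1\<close>, the empty string remains free for the initial state.\<close>

lemma finite_encoding:
  assumes "finite Q" "s0 \<in> Q" "card Q \<le> 2 ^ l" "l \<ge> 1"
  shows "\<exists>enc :: 's \<Rightarrow> bool list. inj_on enc Q \<and> enc s0 = [] \<and> (\<forall>s\<in>Q. length (enc s) \<le> l)"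
proof -
  let ?L = "{xs :: bool list. length xs = l}"
  have fin: "finite ?L" "card ?L = 2 ^ l"
    using finite_lists_length_eq[of "UNIV :: bool set" l] card_lists_length_eq[of "UNIV :: bool set" l] by auto
  have "card Q \<le> card ?L" using assms(3) fin(2) by simp
  then obtain g where g: "g ` Q \<subseteq> ?L" "inj_on g Q"
    using card_le_inj[OF assms(1) fin(1)] by blast
  have len: "length (g s) = l" if "s \<in> Q" for s using g(1) that by blast
  have "inj_on (\<lambda>s. if s = s0 then [] else g s) Q"
  proof (rule inj_onI)
    fix x y assume xy: "x \<in> Q" "y \<in> Q" "(if x = s0 then [] else g x) = (if y = s0 then [] else g y)"
    show "x = y"
      using xy(3) len[OF xy(1)] len[OF xy(2)] assms(4) inj_onD[OF g(2) _ xy(1,2)]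
      by (cases "x = s0"; cases "y = s0") auto
  qed
  then show ?thesis
    using len by (intro exI[of _ "\<lambda>s. if s = s0 then [] else g s"]) simp
qed

text \<open>Space depends only on the number of states, the factor \<open>Suc c\<close> being for
  the change count, so no concrete memory layout is fixed. The probability is compared on the event
  that the budget suffices, where the capped automaton agrees with the original one.\<close>

lemma finite_state_algorithm:
  fixes f :: "'s \<Rightarrow> nat \<Rightarrow> nat \<Rightarrow> 's" and out :: "'s \<Rightarrow> nat \<Rightarrow> real"
  assumes Q: "finite Q" "s0 \<in> Q" and closed: "\<And>s i v. s \<in> Q \<Longrightarrow> i \<in> U \<Longrightarrow> f s i v \<in> Q"
    and card: "card Q * Suc c \<le> 2 ^ l" "l \<ge> 1"
  shows "\<exists>A. \<forall>us. set us \<subseteq> U \<longrightarrow> state_changes_at_most A us c \<and> bits_at_most A us l \<and>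
     (\<forall>E. measure_pmf.prob (coins {..<length us} d)
         {V. card {t \<in> {..<length us}. state_at f s0 ((!) us) V (Suc t) \<noteq> state_at f s0 ((!) us) V t} \<le> c
           \<and> out (state_at f s0 ((!) us) V (length us)) \<in> E} \<le> measure_pmf.prob (final_output A us) E)"
proof -
  define Q' where "Q' = Q \<times> {..c}"
  obtain enc :: "'s \<times> nat \<Rightarrow> bool list" where enc: "inj_on enc Q'" "enc (s0, 0) = []" "\<And>p. p \<in> Q' \<Longrightarrow> length (enc p) \<le> l"
  proof -
    have "finite Q'" "(s0, 0) \<in> Q'" "card Q' \<le> 2 ^ l" using Q card by (auto simp: Q'_def card_cartesian_product)
    from finite_encoding[OF this card(2)] show thesis using that by blast
  qed
  define dec where "dec = inv_into Q' enc"
  have dec: "dec (enc p) = p" if "p \<in> Q'" for p using enc(1) that by (simp add: dec_def)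
  define A where "A = \<lparr>step = (\<lambda>\<sigma> i. map_pmf (\<lambda>v. enc (capped c f (dec \<sigma>) i v)) (coin d)),
     result = (\<lambda>\<sigma>. out (fst (dec \<sigma>)))\<rparr>"
  have closed': "capped c f p i v \<in> Q'" if "p \<in> Q'" "i \<in> U" for p i v
    using that closed by (auto simp: Q'_def capped_def)
  have p0: "(s0, 0) \<in> Q'" using Q by (simp add: Q'_def)
  have run_Q: "set (run (capped c f) p us t V) \<subseteq> Q'" if "p \<in> Q'" "set us \<subseteq> U" for p us t V
    using that closed' by (induction us arbitrary: p t) auto
  show ?thesis
  proof (intro exI[of _ A] allI impI)
    fix us assume us: "set us \<subseteq> U"
    define m where "m = length us"
    have traj: "trajectory A us = map_pmf (\<lambda>V. map enc (run (capped c f) (s0, 0) us 0 V)) (coins {..<m} d)"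
      using trajectory_from_run[of Q' U A enc "capped c f" d "(s0, 0)" us 0] p0 us closed'
      by (simp add: trajectory_def enc A_def dec m_def lessThan_atLeast0)
    have "state_changes_at_most A us c"
      unfolding state_changes_at_most_def traj
      using state_changes_capped[of "(s0, 0)" c enc f us 0] by auto
    moreover have "bits_at_most A us l"
      unfolding bits_at_most_def traj using run_Q[OF p0 us] enc(3) by (auto, blast)
    moreover have "measure_pmf.prob (coins {..<length us} d)
         {V. card {t \<in> {..<length us}. state_at f s0 ((!) us) V (Suc t) \<noteq> state_at f s0 ((!) us) V t} \<le> c
           \<and> out (state_at f s0 ((!) us) V (length us)) \<in> E} \<le> measure_pmf.prob (final_output A us) E" for E
    proof -
      have lastQ: "state_at (capped c f) (s0, 0) ((!) us) V m \<in> Q'" for V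
        using run_Q[OF p0 us, of 0 V] last_in_set[of "run (capped c f) (s0, 0) us 0 V"]
        unfolding m_def last_run[symmetric] by auto
      have "final_output A us = map_pmf (\<lambda>V. out (fst (state_at (capped c f) (s0, 0) ((!) us) V m))) (coins {..<m} d)"
        unfolding final_output_def traj map_pmf_comp using lastQ
        by (intro map_pmf_cong refl) (simp add: last_map last_run A_def dec m_def)
      then have "measure_pmf.prob (final_output A us) E =
         measure_pmf.prob (coins {..<m} d) {V. out (fst (state_at (capped c f) (s0, 0) ((!) us) V m)) \<in> E}"
        by (simp add: vimage_def)
      also have "\<dots> \<ge> measure_pmf.prob (coins {..<m} d)
         {V. card {t \<in> {..<m}. state_at f s0 ((!) us) V (Suc t) \<noteq> state_at f s0 ((!) us) V t} \<le> c
           \<and> out (state_at f s0 ((!) us) V m) \<in> E}"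
        by (intro measure_pmf.finite_measure_mono) (auto simp: state_at_capped simp del: state_at.simps)
      finally show ?thesis by (simp add: m_def)
    qed
    ultimately show "state_changes_at_most A us c \<and> bits_at_most A us l \<and>
     (\<forall>E. measure_pmf.prob (coins {..<length us} d)
         {V. card {t \<in> {..<length us}. state_at f s0 ((!) us) V (Suc t) \<noteq> state_at f s0 ((!) us) V t} \<le> c
           \<and> out (state_at f s0 ((!) us) V (length us)) \<in> E} \<le> measure_pmf.prob (final_output A us) E)"
      by blast
  qed
qed

section \<open>Sampling by coins\<close>

lemma prob_pair_le:
  assumes "\<And>g. measure_pmf.prob M {f. (f, g) \<in> E} \<le> c" "c \<ge> 0"
  shows "measure_pmf.prob (pair_pmf M N) E \<le> c"
proof -
  have "pair_pmf M N = bind_pmf N (\<lambda>g. map_pmf (\<lambda>f. (f, g)) M)"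
    unfolding pair_pmf_def map_pmf_def by (rule bind_commute_pmf)
  then have "emeasure (pair_pmf M N) E = (\<integral>\<^sup>+ g. emeasure (map_pmf (\<lambda>f. (f, g)) M) E \<partial>N)"
    by simp
  also have "\<dots> \<le> (\<integral>\<^sup>+ g. ennreal c \<partial>N)"
    using assms(1) by (intro nn_integral_mono)
      (auto simp: measure_pmf.emeasure_eq_measure vimage_def intro!: ennreal_leI)
  also have "\<dots> = ennreal c" by (simp add: measure_pmf.emeasure_space_1)
  finally show ?thesis using assms(2) by (simp add: measure_pmf.emeasure_eq_measure)
qed

lemma prob_coin_component:
  assumes "d > 0" "t \<in> A" "finite A"
  shows "measure_pmf.prob (coins A d) {V. K \<le> V t} = (1 / (1 + d)) ^ K"
proof -
  have "measure_pmf.prob (coins A d) {V. K \<le> V t} = measure_pmf.prob (map_pmf (\<lambda>V. V t) (coins A d)) {K..}"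
    by (simp add: vimage_def)
  also have "\<dots> = (1 / (1 + d)) ^ K"
    using assms unfolding coins_def by (subst Pi_pmf_component) (auto simp: coin_tail)
  finally show ?thesis .
qed

lemma prob_no_sample:
  assumes d: "d > 0" and T: "finite A" "T \<subseteq> A"
  shows "measure_pmf.prob (coins A d) {V. \<forall>s\<in>T. V s < K} = (1 - (1 / (1 + d)) ^ K) ^ card T"
proof -
  have c: "measure_pmf.prob (coin d) {..<K} = 1 - (1 / (1 + d)) ^ K"
  proof -
    have "{..<K} = UNIV - {K..}" by auto
    then show ?thesis using measure_pmf.prob_compl[of "{K..}" "coin d"] coin_tail[OF d, of K] by simp
  qed
  have "{V. \<forall>s\<in>T. V s < K} = Pi A (\<lambda>s. if s \<in> T then {..<K} else UNIV)"
    using T(2) by (auto simp: Pi_def)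
  then have "measure_pmf.prob (coins A d) {V. \<forall>s\<in>T. V s < K} =
     (\<Prod>s\<in>A. measure_pmf.prob (coin d) (if s \<in> T then {..<K} else UNIV))"
    unfolding coins_def by (simp add: measure_Pi_pmf_Pi[OF T(1)])
  also have "\<dots> = (\<Prod>s\<in>T. measure_pmf.prob (coin d) {..<K})"
    using T by (intro prod.mono_neutral_cong_right) auto
  finally show ?thesis by (simp add: c)
qed

text \<open>By \<open>cong\<close>, the coins of the other items determine \<open>T V\<close>. Once
  they are fixed, it is a fixed set of occurrences of \<open>i\<close>, whose own coins are still
  independent.\<close>

lemma prob_missed_samples:
  assumes d: "d > 0"
    and cong: "\<And>V W. (\<And>t. t < m \<Longrightarrow> u t \<noteq> i \<Longrightarrow> V t = W t) \<Longrightarrow> T V = T W"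
    and sub: "\<And>V. T V \<subseteq> {s \<in> {..<m}. u s = i}"
  shows "measure_pmf.prob (coins {..<m} d) {V. k \<le> card (T V) \<and> (\<forall>s\<in>T V. V s < K)}
     \<le> (1 - (1 / (1 + d)) ^ K) ^ k"
proof -
  define q where "q = (1 / (1 + d)) ^ K"
  have q: "0 \<le> q" "q \<le> 1" using d unfolding q_def by (auto intro!: power_le_one)
  define A1 where "A1 = {s \<in> {..<m}. u s = i}"
  define A2 where "A2 = {..<m} - A1"
  have un: "{..<m} = A1 \<union> A2" by (auto simp: A1_def A2_def)
  define mix where "mix = (\<lambda>(f :: nat \<Rightarrow> nat, g) x. if x \<in> A1 then f x else g x)"
  let ?E = "{V. k \<le> card (T V) \<and> (\<forall>s\<in>T V. V s < K)}"
  have "coins {..<m} d = map_pmf mix (pair_pmf (coins A1 d) (coins A2 d))"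
    unfolding coins_def un mix_def by (rule Pi_pmf_union) (auto simp: A1_def A2_def)
  then have "measure_pmf.prob (coins {..<m} d) ?E = measure_pmf.prob (pair_pmf (coins A1 d) (coins A2 d)) (mix -` ?E)"
    by simp
  also have "\<dots> \<le> (1 - q) ^ k"
  proof (rule prob_pair_le)
    fix g
    have T: "T (mix (f, g)) = T g" for f
      by (rule cong) (auto simp: mix_def A1_def)
    have sub': "T g \<subseteq> A1" using sub by (simp add: A1_def)
    have "{f. (f, g) \<in> mix -` ?E} = {f. k \<le> card (T g) \<and> (\<forall>s\<in>T g. f s < K)}"
    proof -
      have "mix (f, g) s = f s" if "s \<in> T g" for f s using that sub' by (auto simp: mix_def)
      then show ?thesis by (auto simp: T)
    qed
    also have "measure_pmf.prob (coins A1 d) \<dots> \<le> (1 - q) ^ k"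
    proof (cases "k \<le> card (T g)")
      case True
      then have "measure_pmf.prob (coins A1 d) {f. k \<le> card (T g) \<and> (\<forall>s\<in>T g. f s < K)} = (1 - q) ^ card (T g)"
        using prob_no_sample[OF d _ sub', of K] by (simp add: q_def A1_def)
      also have "\<dots> \<le> (1 - q) ^ k" using True q by (intro power_decreasing) auto
      finally show ?thesis .
    qed (use q in simp)
    finally show "measure_pmf.prob (coins A1 d) {f. (f, g) \<in> mix -` ?E} \<le> (1 - q) ^ k" .
  qed (use q in simp)
  finally show ?thesis by (simp add: q_def)
qed

lemma weighted_samples:
  assumes d: "d > 0" and w: "\<And>s. s < m \<Longrightarrow> w s \<ge> 0"
  shows "(\<integral>\<^sup>+ V. ennreal (\<Sum>s\<in>{s \<in> {..<m}. K \<le> V s}. w s) \<partial>coins {..<m} d)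
    = ennreal ((1 / (1 + d)) ^ K * (\<Sum>s<m. w s))"
proof -
  have eq: "ennreal (\<Sum>s\<in>{s \<in> {..<m}. K \<le> V s}. w s) = (\<Sum>s<m. ennreal (w s) * indicator {V. K \<le> V s} V)" for V
  proof -
    have "(\<Sum>s\<in>{s \<in> {..<m}. K \<le> V s}. w s) = (\<Sum>s<m. w s * indicator {V. K \<le> V s} V)"
      by (rule sum.mono_neutral_cong_left) (auto simp: indicator_def)
    also have "ennreal \<dots> = (\<Sum>s<m. ennreal (w s * indicator {V. K \<le> V s} V))"
      using w by (subst sum_ennreal) (auto simp: indicator_def)
    also have "\<dots> = (\<Sum>s<m. ennreal (w s) * indicator {V. K \<le> V s} V)"
      by (intro sum.cong refl) (auto simp: indicator_def)
    finally show ?thesis .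
  qed
  have "(\<integral>\<^sup>+ V. ennreal (\<Sum>s\<in>{s \<in> {..<m}. K \<le> V s}. w s) \<partial>coins {..<m} d) =
      (\<Sum>s<m. ennreal (w s) * emeasure (coins {..<m} d) {V. K \<le> V s})"
    unfolding eq by (subst nn_integral_sum) (auto simp: nn_integral_cmult_indicator)
  also have "\<dots> = (\<Sum>s<m. ennreal (w s * (1 / (1 + d)) ^ K))"
    using d w by (intro sum.cong refl)
      (auto simp: measure_pmf.emeasure_eq_measure prob_coin_component ennreal_mult)
  also have "\<dots> = ennreal (\<Sum>s<m. w s * (1 / (1 + d)) ^ K)"
    using w d by (intro sum_ennreal) auto
  also have "(\<Sum>s<m. w s * (1 / (1 + d)) ^ K) = (1 / (1 + d)) ^ K * (\<Sum>s<m. w s)"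
    using sum_distrib_right[of w "{..<m}" "(1 / (1 + d)) ^ K"] by (simp only: mult.commute)
  finally show ?thesis .
qed

lemma prob_weighted_samples:
  assumes "d > 0" "\<And>s. s < m \<Longrightarrow> w s \<ge> 0" "b > 0"
  shows "measure_pmf.prob (coins {..<m} d) {V. b \<le> (\<Sum>s\<in>{s \<in> {..<m}. K \<le> V s}. w s)}
     \<le> (1 / (1 + d)) ^ K * (\<Sum>s<m. w s) / b"
proof (rule pmf_markov)
  show "(\<integral>\<^sup>+ V. ennreal (\<Sum>s\<in>{s \<in> {..<m}. K \<le> V s}. w s) \<partial>coins {..<m} d)
    \<le> ennreal ((1 / (1 + d)) ^ K * (\<Sum>s<m. w s))"
    using weighted_samples[where m = m and w = w and K = K, OF assms(1,2)] by simp
  show "0 \<le> (1 / (1 + d)) ^ K * (\<Sum>s<m. w s)"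
    using assms by (intro mult_nonneg_nonneg sum_nonneg) auto
qed (use assms in auto)

lemma prob_many_samples:
  assumes d: "d > 0" and b: "b > 0"
  shows "measure_pmf.prob (coins {..<m} d)
      {V. b \<le> (\<Sum>k\<le>J. real (card {s \<in> {..<m}. K k \<le> V s}))}
     \<le> (\<Sum>k\<le>J. (1 / (1 + d)) ^ K k * real m) / b"
proof (rule pmf_markov)
  have "(\<integral>\<^sup>+ V. ennreal (\<Sum>k\<le>J. real (card {s \<in> {..<m}. K k \<le> V s})) \<partial>coins {..<m} d) =
     (\<Sum>k\<le>J. \<integral>\<^sup>+ V. ennreal (\<Sum>s\<in>{s \<in> {..<m}. K k \<le> V s}. 1) \<partial>coins {..<m} d)"
    by (subst nn_integral_sum[symmetric]) (auto simp: sum_ennreal)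
  also have "\<dots> = (\<Sum>k\<le>J. ennreal ((1 / (1 + d)) ^ K k * real m))"
    using weighted_samples[where m = m and w = "\<lambda>_. 1", OF d] by simp
  also have "\<dots> = ennreal (\<Sum>k\<le>J. (1 / (1 + d)) ^ K k * real m)"
    using d by (intro sum_ennreal) auto
  finally show "(\<integral>\<^sup>+ V. ennreal (\<Sum>k\<le>J. real (card {s \<in> {..<m}. K k \<le> V s})) \<partial>coins {..<m} d)
     \<le> ennreal (\<Sum>k\<le>J. (1 / (1 + d)) ^ K k * real m)" by simp
qed (use d b in \<open>auto intro!: sum_nonneg\<close>)

text \<open>The \<open>Suc\<close> arises because \<open>occ u i 0 s\<close> does not count the
  occurrence at \<open>s\<close> itself, so the first occurrence has count 0.\<close>

lemma card_early:
  "card {s \<in> {..<m}. u s = i \<and> occ u i 0 s \<le> c} = min (Suc c) (occ u i 0 m)"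
proof (induction m)
  case (Suc m)
  let ?E = "\<lambda>m. {s \<in> {..<m}. u s = i \<and> occ u i 0 s \<le> c}"
  have "?E (Suc m) = {s \<in> insert m {..<m}. u s = i \<and> occ u i 0 s \<le> c}" by (simp only: lessThan_Suc)
  also have "\<dots> = (if u m = i \<and> occ u i 0 m \<le> c then insert m (?E m) else ?E m)" by auto
  finally have "card (?E (Suc m)) = (if u m = i \<and> occ u i 0 m \<le> c then Suc (card (?E m)) else card (?E m))"
    by simp
  then show ?case unfolding Suc.IH by auto
qed simp

lemma occ_split: "s \<le> t \<Longrightarrow> occ u i 0 t = occ u i 0 s + occ u i s t"
proof (induction t rule: dec_induct)
  case base
  then show ?case by (simp add: occ_def)
qed auto

section \<open>Parallel copies\<close>

text \<open>All copies see the same coin and differ only in the threshold \<open>K k\<close>.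
  Indices beyond \<open>J\<close> are held at a constant so that finitely many states occur.\<close>

definition bank_step :: "nat \<Rightarrow> (nat \<Rightarrow> nat) \<Rightarrow> nat \<Rightarrow> nat \<Rightarrow> nat \<Rightarrow>
    (nat \<Rightarrow> nat \<Rightarrow> nat list) \<Rightarrow> nat \<Rightarrow> nat \<Rightarrow> (nat \<Rightarrow> nat \<Rightarrow> nat list)" where
  "bank_step h K B X J = (\<lambda>b i v k. if k \<le> J then buffer_step h (K k) B X (b k) i v else (\<lambda>_. []))"

definition readout :: "real \<Rightarrow> nat \<Rightarrow> nat \<Rightarrow> nat \<Rightarrow> (nat \<Rightarrow> nat \<Rightarrow> nat list) \<Rightarrow> nat \<Rightarrow> real" where
  "readout d h X J b i = Max (insert 0 ((\<lambda>p. estimate d h (snd p)) ` {p \<in> {..J} \<times> {1..X}. i \<in> set (b (fst p) (snd p))}))"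

definition banks :: "nat \<Rightarrow> nat \<Rightarrow> nat \<Rightarrow> nat \<Rightarrow> (nat \<Rightarrow> nat \<Rightarrow> nat list) set" where
  "banks n B X J = {b. \<forall>k x. if k \<le> J \<and> x \<in> {1..X} then set (b k x) \<subseteq> {1..n} \<and> length (b k x) \<le> B else b k x = []}"

lemma state_at_bank:
  "state_at (bank_step h K B X J) (\<lambda>_ _. []) u V t = (\<lambda>k. if k \<le> J then buffers h (K k) B X u V t else (\<lambda>_. []))"
proof (induction t)
  case (Suc t)
  show ?case unfolding state_at.simps Suc.IH by (auto simp: bank_step_def fun_eq_iff)
qed auto

lemma card_bank_changes:
  "card {t \<in> {..<m}. state_at (bank_step h K B X J) (\<lambda>_ _. []) u V (Suc t) \<noteq> state_at (bank_step h K B X J) (\<lambda>_ _. []) u V t}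
    \<le> (\<Sum>k\<le>J. card {s \<in> {..<m}. K k \<le> V s}) * Suc X"
proof -
  have "{t \<in> {..<m}. state_at (bank_step h K B X J) (\<lambda>_ _. []) u V (Suc t) \<noteq> state_at (bank_step h K B X J) (\<lambda>_ _. []) u V t}
     \<subseteq> (\<Union>k\<in>{..J}. {t \<in> {..<m}. buffers h (K k) B X u V (Suc t) \<noteq> buffers h (K k) B X u V t})" (is "?L \<subseteq> ?R")
    unfolding state_at_bank by (auto simp: fun_eq_iff simp del: buffers.simps split: if_splits)
  then have "card ?L \<le> card ?R" by (intro card_mono) auto
  also have "\<dots> \<le> (\<Sum>k\<in>{..J}. card {t \<in> {..<m}. buffers h (K k) B X u V (Suc t) \<noteq> buffers h (K k) B X u V t})"
    by (rule card_UN_le) simp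
  also have "\<dots> \<le> (\<Sum>k\<le>J. card {s \<in> {..<m}. K k \<le> V s} * Suc X)"
    by (intro sum_mono card_changes)
  finally show ?thesis by (simp only: sum_distrib_right)
qed

lemma banks_init: "(\<lambda>_ _. []) \<in> banks n B X J"
  by (simp add: banks_def)

lemma banksD:
  assumes "b \<in> banks n B X J" "k \<le> J" "x \<in> {1..X}"
  shows "set (b k x) \<subseteq> {1..n} \<and> length (b k x) \<le> B"
proof -
  have "if k \<le> J \<and> x \<in> {1..X} then set (b k x) \<subseteq> {1..n} \<and> length (b k x) \<le> B else b k x = []"
    using assms(1) unfolding banks_def by blast
  then show ?thesis using assms(2,3) by presburger
qed

lemma banks_closed:
  assumes "b \<in> banks n B X J" "i \<in> {1..n}"
  shows "bank_step h K B X J b i v \<in> banks n B X J"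
proof -
  have "if k \<le> J \<and> x \<in> {1..X}
    then set (bank_step h K B X J b i v k x) \<subseteq> {1..n} \<and> length (bank_step h K B X J b i v k x) \<le> B
    else bank_step h K B X J b i v k x = []" for k x
  proof (cases "k \<le> J \<and> x \<in> {1..X}")
    case True
    then have b: "set (b k x) \<subseteq> {1..n}" "length (b k x) \<le> B" using banksD[OF assms(1)] by blast+
    have *: "set (take B (i # removeAll i (b k x))) \<subseteq> {1..n}"
    proof
      fix y assume "y \<in> set (take B (i # removeAll i (b k x)))"
      then have "y \<in> set (i # removeAll i (b k x))" by (rule in_set_takeD)
      then show "y \<in> {1..n}" using b assms(2) by auto
    qed
    have **: "set (removeAll i (b k x)) \<subseteq> {1..n}" "length (removeAll i (b k x)) \<le> B"
      using b length_removeAll_less_eq[of i "b k x"] by (auto simp del: length_removeAll_less_eq)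
    have l: "length (take B (i # removeAll i (b k x))) \<le> B" by simp
    have "bank_step h K B X J b i v k x \<in> {take B (i # removeAll i (b k x)), removeAll i (b k x), b k x}"
      using True by (simp add: bank_step_def buffer_step_def)
    then show ?thesis using True * ** l b by (elim insertE emptyE) simp_all
  next
    case False
    then show ?thesis by (auto simp: bank_step_def buffer_step_def not_le)
  qed
  then show ?thesis unfolding banks_def by blast
qed

lemma card_short_lists:
  "finite {xs. set xs \<subseteq> {1..n} \<and> length xs \<le> B} \<and> card {xs. set xs \<subseteq> {1..n::nat} \<and> length xs \<le> B} \<le> Suc n ^ B"
proof -
  have "(\<Sum>i\<le>B. n ^ i) \<le> Suc n ^ B"
  proof (induction B)
    case (Suc B)
    have "n * n ^ B \<le> n * Suc n ^ B" by (intro mult_left_mono power_mono) auto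
    have "(\<Sum>i\<le>Suc B. n ^ i) = (\<Sum>i\<le>B. n ^ i) + n * n ^ B" by simp
    also have "\<dots> \<le> Suc n ^ B + n * Suc n ^ B" by (intro add_mono Suc.IH) fact
    finally show ?case by simp
  qed simp
  then show ?thesis
    using finite_lists_length_le[of "{1..n}" B] card_lists_length_le[of "{1..n}" B] by simp
qed

lemma card_banks: "finite (banks n B X J) \<and> card (banks n B X J) \<le> Suc n ^ (B * (Suc J * X))"
proof -
  let ?L = "{xs. set xs \<subseteq> {1..n} \<and> length xs \<le> B}"
  let ?I = "{..J} \<times> {1..X}"
  let ?P = "PiE_dflt ?I [] (\<lambda>_. ?L)"
  have L: "finite ?L" "card ?L \<le> Suc n ^ B" using card_short_lists[of n B] by auto
  have finP: "finite ?P" using L(1) by (intro finite_PiE_dflt) auto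
  have "card ?P = card ?L ^ (Suc J * X)"
    using L(1) by (subst card_PiE_dflt) (auto simp: card_cartesian_product)
  also have "\<dots> \<le> (Suc n ^ B) ^ (Suc J * X)" using L(2) by (intro power_mono) auto
  finally have cP: "card ?P \<le> Suc n ^ (B * (Suc J * X))" by (simp only: power_mult)
  have sub: "banks n B X J \<subseteq> curry ` ?P"
  proof
    fix b assume b: "b \<in> banks n B X J"
    have "(\<lambda>(k, x). b k x) \<in> ?P"
      unfolding PiE_dflt_def
    proof (intro CollectI allI)
      fix p :: "nat \<times> nat"
      obtain k x where p: "p = (k, x)" by (cases p)
      have "if k \<le> J \<and> x \<in> {1..X} then set (b k x) \<subseteq> {1..n} \<and> length (b k x) \<le> B else b k x = []"
        using b unfolding banks_def by blast
      moreover have "p \<in> ?I \<longleftrightarrow> k \<le> J \<and> x \<in> {1..X}" by (simp add: p)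
      ultimately have "if p \<in> ?I then b k x \<in> ?L else b k x = []" by (simp only: mem_Collect_eq)
      then show "(p \<in> ?I \<longrightarrow> (case p of (k, x) \<Rightarrow> b k x) \<in> ?L) \<and> (p \<notin> ?I \<longrightarrow> (case p of (k, x) \<Rightarrow> b k x) = [])"
        by (cases "p \<in> ?I") (simp_all only: p prod.case if_True if_False simp_thms)
    qed
    moreover have "b = curry (\<lambda>(k, x). b k x)" by (simp add: curry_def)
    ultimately show "b \<in> curry ` ?P" using image_eqI[of b curry "\<lambda>(k, x). b k x" ?P] by blast
  qed
  have "card (banks n B X J) \<le> card ?P" using surj_card_le[OF finP sub] .
  moreover have "finite (banks n B X J)" using finite_surj[OF finP sub] .
  ultimately show ?thesis using cP by simp
qed

lemma finite_readout: "finite ((\<lambda>p. estimate d h (snd p)) ` {p \<in> {..J :: nat} \<times> {1..X}. i \<in> set (b (fst p) (snd p))})"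
  by (rule finite_imageI, rule finite_subset[OF Collect_restrict]) simp

lemma readout_nonneg: "readout d h X J b i \<ge> 0"
  unfolding readout_def using finite_readout by (intro Max_ge) auto

lemma readout_ge:
  assumes "k \<le> J" "x \<in> {1..X}" "i \<in> set (b k x)"
  shows "estimate d h x \<le> readout d h X J b i"
  unfolding readout_def using finite_readout assms
  by (intro Max_ge) (auto intro!: image_eqI[of _ _ "(k, x)"])

lemma readout_le:
  assumes "\<And>k x. k \<le> J \<Longrightarrow> x \<in> {1..X} \<Longrightarrow> i \<in> set (b k x) \<Longrightarrow> estimate d h x \<le> c" "c \<ge> 0"
  shows "readout d h X J b i \<le> c"
  unfolding readout_def using finite_readout assms by (subst Max_le_iff) auto

text \<open>Error budget for a heavy item: the occurrences before its starting point cost a fraction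
  \<open>\<epsilon> / 4\<close> and the counter \<open>\<epsilon> / 8\<close>. For a light item
  every readout between 0 and \<open>1 + \<epsilon> / 8\<close> times its frequency is good enough.
  The upper bound holds for each copy separately, because every stored item stems from an accurate
  ideal counter.\<close>

lemma readout_accurate:
  fixes \<epsilon> d F :: real and K :: "nat \<Rightarrow> nat"
  assumes \<epsilon>: "0 < \<epsilon>" "\<epsilon> < 1" and d: "d > 0" and X: "X > 0" and k0: "k0 \<le> J"
    and i: "occ u i 0 m \<le> F" and F: "F > 0"
    and acc: "\<And>s t. s < t \<Longrightarrow> t \<le> m \<Longrightarrow> (1 - \<epsilon> / 8) * occ u (u s) s t \<le> estimate d h (level h u V (u s) s t) \<and>
       estimate d h (level h u V (u s) s t) \<le> (1 + \<epsilon> / 8) * occ u (u s) s t"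
    and top: "\<And>t. t < m \<Longrightarrow> V t < X - h"
    and hit: "\<epsilon> / 2 * F \<le> occ u i 0 m \<Longrightarrow> \<exists>s<m. u s = i \<and> K k0 \<le> V s \<and>
      s \<notin> crowded h (K k0) B X u d m V i \<and> occ u i 0 s \<le> \<epsilon> / 4 * occ u i 0 m"
  shows "\<bar>readout d h X J (state_at (bank_step h K B X J) (\<lambda>_ _. []) u V m) i - occ u i 0 m\<bar> \<le> \<epsilon> / 2 * F"
proof -
  let ?b = "state_at (bank_step h K B X J) (\<lambda>_ _. []) u V m"
  have up: "readout d h X J ?b i \<le> (1 + \<epsilon> / 8) * occ u i 0 m"
  proof (rule readout_le)
    fix k x assume k: "k \<le> J" and "i \<in> set (?b k x)"
    then have "i \<in> set (buffers h (K k) B X u V m x)" by (simp add: state_at_bank)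
    from buffers_origin[OF this] obtain s where s: "s < m" "u s = i" "level h u V i s m = x" by blast
    have "estimate d h x \<le> (1 + \<epsilon> / 8) * occ u i s m" using acc[of s m] s by simp
    also have "\<dots> \<le> (1 + \<epsilon> / 8) * occ u i 0 m" using \<epsilon> occ_mono[of 0 s m m u i] by (intro mult_left_mono) auto
    finally show "estimate d h x \<le> (1 + \<epsilon> / 8) * occ u i 0 m" .
  qed (use \<epsilon> in auto)
  have "\<epsilon> / 8 * occ u i 0 m \<le> \<epsilon> / 2 * F" using \<epsilon> i F by (intro mult_mono) auto
  then have up': "readout d h X J ?b i - occ u i 0 m \<le> \<epsilon> / 2 * F" using up by (simp add: algebra_simps)
  have low: "occ u i 0 m - readout d h X J ?b i \<le> \<epsilon> / 2 * F"
  proof (cases "\<epsilon> / 2 * F \<le> occ u i 0 m")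
    case False
    then show ?thesis using readout_nonneg[of d h X J ?b i] by linarith
  next
    case True
    then obtain s where s: "s < m" "u s = i" "K k0 \<le> V s" "s \<notin> crowded h (K k0) B X u d m V i"
      "occ u i 0 s \<le> \<epsilon> / 4 * occ u i 0 m" using hit by blast
    have acc2: "occ u i s t \<le> 2 * estimate d h (level h u V i s t)" if "t < m" for t
    proof (cases "s < t")
      case True
      have "(1 - \<epsilon> / 8) * occ u i s t \<le> estimate d h (level h u V i s t)" using acc[OF True] that s by simp
      moreover have "(1/2) * occ u i s t \<le> (1 - \<epsilon> / 8) * occ u i s t" using \<epsilon> by (intro mult_right_mono) auto
      ultimately show ?thesis by simp
    next
      case False
      then have "occ u i s t = 0" by (simp add: occ_def)
      then show ?thesis using estimate_ge[of d "level h u V i s t" h] d by simp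
    qed
    have mem: "i \<in> set (buffers h (K k0) B X u V m (level h u V i s m))"
      by (rule uncrowded_survives[OF s(3,2,1,4) top X acc2])
    then have "level h u V i s m \<in> {1..X}" using buffers_range[OF mem] by auto
    then have ge: "estimate d h (level h u V i s m) \<le> readout d h X J ?b i"
      using mem k0 by (intro readout_ge[of k0]) (auto simp: state_at_bank)
    have "occ u i 0 m = occ u i 0 s + occ u i s m" using s by (intro occ_split) simp
    then have "(1 - \<epsilon> / 4) * occ u i 0 m \<le> occ u i s m" using s(5) by (simp add: algebra_simps)
    then have "(1 - \<epsilon> / 8) * ((1 - \<epsilon> / 4) * occ u i 0 m) \<le> (1 - \<epsilon> / 8) * occ u i s m"
      using \<epsilon> by (intro mult_left_mono) auto
    also have "\<dots> \<le> readout d h X J ?b i" using acc[of s m] s ge by auto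
    finally have "(1 - \<epsilon> / 8) * ((1 - \<epsilon> / 4) * occ u i 0 m) \<le> readout d h X J ?b i" .
    moreover have "(1 - \<epsilon> / 2) * occ u i 0 m \<le> (1 - \<epsilon> / 8) * ((1 - \<epsilon> / 4) * occ u i 0 m)"
      unfolding mult.assoc[symmetric] using \<epsilon> by (intro mult_right_mono) (auto simp: algebra_simps)
    ultimately have "(1 - \<epsilon> / 2) * occ u i 0 m \<le> readout d h X J ?b i" by linarith
    then have "occ u i 0 m - readout d h X J ?b i \<le> \<epsilon> / 2 * occ u i 0 m" by (simp add: left_diff_distrib)
    also have "\<dots> \<le> \<epsilon> / 2 * F" using \<epsilon> i by (intro mult_left_mono) auto
    finally show ?thesis .
  qed
  show ?thesis unfolding abs_le_iff using up' low by linarith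
qed

section \<open>Union bound over the failure events\<close>

lemma prob_UN_le:
  fixes c :: real
  assumes "finite I" "\<And>i. i \<in> I \<Longrightarrow> measure_pmf.prob M (E i) \<le> c"
  shows "measure_pmf.prob M (\<Union>i\<in>I. E i) \<le> card I * c"
proof -
  have "measure_pmf.prob M (\<Union>i\<in>I. E i) \<le> (\<Sum>i\<in>I. measure_pmf.prob M (E i))"
    using assms(1) by (intro measure_pmf.finite_measure_subadditive_finite) auto
  also have "\<dots> \<le> card I * c" using assms(2) sum_bounded_above[of I "\<lambda>i. measure_pmf.prob M (E i)" c] by simp
  finally show ?thesis .
qed

lemma one_minus_power_le: "0 \<le> q \<Longrightarrow> q \<le> 1 \<Longrightarrow> (1 - q) ^ k \<le> exp (- q * real k)" for q :: real
proof -
  assume q: "0 \<le> q" "q \<le> 1"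
  have "(1 - q) ^ k \<le> exp (- q) ^ k" using q exp_ge_add_one_self[of "- q"] by (intro power_mono) auto
  then show ?thesis by (simp add: exp_of_nat_mult[symmetric] mult.commute)
qed

text \<open>Five failure events of probability at most \<open>1 / 30\<close> each: an inaccurate
  counter, a coin beyond the top level, too much sampled frequency in copy \<open>k0\<close>, a
  heavy item all of whose safe early occurrences are missed, too many samples over all copies. Copy
  \<open>k0\<close> has a guess between \<open>F\<close> and \<open>2 * F\<close>; its sampling rate
  lies between \<open>lam / (4 * F)\<close> and \<open>lam / F\<close>, unless it is capped at
  1.\<close>

lemma bank_success_probability:
  fixes \<epsilon> d F lam H :: real and K :: "nat \<Rightarrow> nat"
  assumes \<epsilon>: "0 < \<epsilon>" "\<epsilon> < 1" and d: "d > 0" and dh: "1 \<le> d * real h" and X: "X > 0" and m: "m > 0"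
    and u: "\<And>t. t < m \<Longrightarrow> u t \<in> {1..n}"
    and F: "F > 0" "\<And>i. i \<in> {1..n} \<Longrightarrow> occ u i 0 m \<le> F"
    and F2: "(\<Sum>t<m. real (occ u (u t) 0 m)) \<le> H * F\<^sup>2"
    and acc: "2 * (real m)\<^sup>2 * exp (- (\<epsilon> / 8)\<^sup>2 / (24 * d)) \<le> 1 / 30"
    and top: "m * (1 / (1 + d)) ^ (X - h) \<le> 1 / 30"
    and k0: "k0 \<le> J" "2 ^ k0 * F \<le> m" "m \<le> 2 * 2 ^ k0 * F"
    and lam: "lam > 0" "lam * \<epsilon>\<^sup>2 / 64 \<ge> ln (30 * n)"
    and K: "\<And>k. k \<le> J \<Longrightarrow> (1 / (1 + d)) ^ K k \<le> lam * 2 ^ k / m"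
      "\<And>k. k \<le> J \<Longrightarrow> K k = 0 \<or> lam * 2 ^ k / (2 * m) \<le> (1 / (1 + d)) ^ K k"
    and B: "1920 * X * lam * H \<le> B * \<epsilon>\<^sup>2"
    and c: "30 * Suc X * lam * 2 ^ Suc J \<le> c"
  shows "measure_pmf.prob (coins {..<m} d)
    {V. card {t \<in> {..<m}. state_at (bank_step h K B X J) (\<lambda>_ _. []) u V (Suc t) \<noteq> state_at (bank_step h K B X J) (\<lambda>_ _. []) u V t} \<le> c \<and>
      (\<forall>i\<in>{1..n}. \<bar>readout d h X J (state_at (bank_step h K B X J) (\<lambda>_ _. []) u V m) i - occ u i 0 m\<bar> \<le> \<epsilon> / 2 * F)} \<ge> 2 / 3"
    (is "measure_pmf.prob ?M ?G \<ge> _")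
proof -
  define f where "f i = real (occ u i 0 m)" for i
  define q where "q = (1 / (1 + d)) ^ K k0"
  define F2s where "F2s = (\<Sum>t<m. f (u t))"
  define T where "T i V = {s \<in> {..<m}. u s = i \<and> real (occ u i 0 s) \<le> \<epsilon> / 4 * f i} - crowded h (K k0) B X u d m V i" for i V
  \<comment> \<open>More than \<open>\<epsilon> / 4 * f i\<close> occurrences are early and at most
    \<open>\<epsilon> / 8 * f i\<close> are crowded; this is a lower bound for the remaining
    ones.\<close>
  define N0 where "N0 i = nat \<lfloor>\<epsilon> / 8 * f i\<rfloor> + 1" for i
  define heavy where "heavy = {i \<in> {1..n}. \<epsilon> / 2 * F \<le> f i}"
  define miscount where "miscount s t = {V. \<not> ((1 - \<epsilon> / 8) * occ u (u s) s t \<le> estimate d h (level h u V (u s) s t) \<and>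
       estimate d h (level h u V (u s) s t) \<le> (1 + \<epsilon> / 8) * occ u (u s) s t)}" for s t
  define bad_acc where "bad_acc = (\<Union>p\<in>{..<m} \<times> {1..m}. miscount (fst p) (snd p))"
  define bad_top where "bad_top = (\<Union>t\<in>{..<m}. {V. X - h \<le> V t})"
  define bad_mass where "bad_mass = {V. 30 * q * F2s \<le> (\<Sum>s\<in>{s \<in> {..<m}. K k0 \<le> V s}. f (u s))}"
  define bad_miss where "bad_miss = (\<Union>i\<in>heavy. {V. N0 i \<le> card (T i V) \<and> (\<forall>s\<in>T i V. V s < K k0)})"
  \<comment> \<open>Outside this event the sample count times \<open>Suc X\<close> is below
    \<open>Suc c\<close>, which for integers means at most \<open>c\<close>.\<close>
  define bad_many where "bad_many = {V. real (Suc c) / Suc X \<le> (\<Sum>k\<le>J. real (card {s \<in> {..<m}. K k \<le> V s}))}"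
  have d0: "d \<ge> 0" using d by simp
  have q: "0 < q" "q \<le> 1" using d unfolding q_def by (auto intro!: power_le_one)
  have n: "n \<ge> 1" using u[of 0] m by auto
  have f1: "f (u t) \<ge> 1" if "t < m" for t
  proof -
    have "occ u (u t) (Suc t) m < occ u (u t) t m" using that by (intro occ_strict) auto
    then have "1 \<le> occ u (u t) 0 m" using occ_mono[of 0 t m m u "u t"] by simp
    then show ?thesis by (simp add: f_def)
  qed
  have "real m = (\<Sum>t<m. 1)" by simp
  also have "\<dots> \<le> F2s" unfolding F2s_def using f1 by (intro sum_mono) auto
  finally have F2s: "F2s > 0" using m by linarith
  have p_acc: "measure_pmf.prob ?M bad_acc \<le> 1 / 30"
  proof -
    have "measure_pmf.prob ?M bad_acc \<le> card ({..<m} \<times> {1..m}) * (2 * exp (- (\<epsilon> / 8)\<^sup>2 / (24 * d)))"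
      unfolding bad_acc_def
    proof (rule prob_UN_le)
      fix p assume p: "p \<in> {..<m} \<times> {1..m}"
      then have "{..<snd p} \<subseteq> {..<m}" by auto
      then show "measure_pmf.prob ?M (miscount (fst p) (snd p)) \<le> 2 * exp (- (\<epsilon> / 8)\<^sup>2 / (24 * d))"
        unfolding miscount_def using \<epsilon> d dh by (intro level_accuracy) auto
    qed simp
    also have "\<dots> \<le> 1 / 30" using acc by (simp add: card_cartesian_product power2_eq_square mult_ac)
    finally show ?thesis .
  qed
  have p_top: "measure_pmf.prob ?M bad_top \<le> 1 / 30"
  proof -
    have "measure_pmf.prob ?M bad_top \<le> card {..<m} * (1 / (1 + d)) ^ (X - h)"
      unfolding bad_top_def using d by (intro prob_UN_le) (auto simp: prob_coin_component)
    then show ?thesis using top by simp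
  qed
  have p_mass: "measure_pmf.prob ?M bad_mass \<le> 1 / 30"
  proof -
    have "measure_pmf.prob ?M bad_mass \<le> q * F2s / (30 * q * F2s)"
      unfolding bad_mass_def F2s_def q_def
      by (rule prob_weighted_samples) (use d q F2s in \<open>auto simp: f_def F2s_def q_def\<close>)
    also have "\<dots> = 1 / 30" using q F2s by simp
    finally show ?thesis .
  qed
  have p_miss: "measure_pmf.prob ?M bad_miss \<le> 1 / 30"
  proof -
    have "measure_pmf.prob ?M bad_miss \<le> card heavy * (1 / (30 * n))"
      unfolding bad_miss_def
    proof (rule prob_UN_le)
      fix i assume i: "i \<in> heavy"
      have "measure_pmf.prob ?M {V. N0 i \<le> card (T i V) \<and> (\<forall>s\<in>T i V. V s < K k0)} \<le> (1 - q) ^ N0 i"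
        unfolding q_def
      proof (rule prob_missed_samples[OF d])
        fix V W :: "nat \<Rightarrow> nat" assume "\<And>t. t < m \<Longrightarrow> u t \<noteq> i \<Longrightarrow> V t = W t"
        then have "crowded h (K k0) B X u d m V i = crowded h (K k0) B X u d m W i" by (rule crowded_cong)
        then show "T i V = T i W" by (simp add: T_def)
      qed (auto simp: T_def)
      also have "\<dots> \<le> 1 / (30 * n)"
      \<comment> \<open>With threshold 0 every occurrence is sampled, and as \<open>N0 i\<close> is
        positive nothing can be missed. Otherwise the threshold is positive and \<open>K\<close>
        bounds \<open>q\<close> from below.\<close>
      proof (cases "q = 1")
        case True
        then show ?thesis by (simp add: N0_def)
      next
        case False
        then have "lam * 2 ^ k0 / (2 * m) \<le> q" using K(2)[OF k0(1)] by (auto simp: q_def)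
        moreover have "lam / (4 * F) \<le> lam * 2 ^ k0 / (2 * m)"
        proof -
          have "lam * (2 * m) \<le> lam * (2 * (2 * 2 ^ k0 * F))" by (intro mult_left_mono) (use lam k0 in linarith)+
          then show ?thesis using F m by (simp add: field_simps)
        qed
        ultimately have qF: "lam / (4 * F) \<le> q" by simp
        have "real (N0 i) \<ge> \<epsilon> / 8 * f i" unfolding N0_def by linarith
        moreover have "\<epsilon> / 8 * f i \<ge> \<epsilon> / 8 * (\<epsilon> / 2 * F)" using i \<epsilon> by (intro mult_left_mono) (auto simp: heavy_def)
        moreover have "\<epsilon> / 8 * (\<epsilon> / 2 * F) = \<epsilon>\<^sup>2 / 16 * F" by (simp add: power2_eq_square)
        ultimately have N: "real (N0 i) \<ge> \<epsilon>\<^sup>2 / 16 * F" by linarith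
        have "lam * \<epsilon>\<^sup>2 / 64 = lam / (4 * F) * (\<epsilon>\<^sup>2 / 16 * F)" using F by simp
        also have "\<dots> \<le> q * real (N0 i)" using qF N F lam q by (intro mult_mono) auto
        finally have "ln (30 * n) \<le> q * real (N0 i)" using lam by simp
        have "(1 - q) ^ N0 i \<le> exp (- q * real (N0 i))" using q by (intro one_minus_power_le) auto
        also have "\<dots> \<le> exp (- ln (30 * n))" using \<open>ln (30 * n) \<le> q * real (N0 i)\<close> by simp
        also have "\<dots> = 1 / (30 * n)" using n by (simp add: exp_minus inverse_eq_divide)
        finally show ?thesis .
      qed
      finally show "measure_pmf.prob ?M {V. N0 i \<le> card (T i V) \<and> (\<forall>s\<in>T i V. V s < K k0)} \<le> 1 / (30 * n)" .
    qed (simp add: heavy_def)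
    also have "\<dots> \<le> n * (1 / (30 * n))"
    proof (intro mult_right_mono)
      have "card heavy \<le> card {1..n}" by (intro card_mono) (auto simp: heavy_def)
      then show "real (card heavy) \<le> real n" by simp
    qed simp
    also have "\<dots> = 1 / 30" using n by simp
    finally show ?thesis .
  qed
  have p_many: "measure_pmf.prob ?M bad_many \<le> 1 / 30"
  proof -
    have "measure_pmf.prob ?M bad_many \<le> (\<Sum>k\<le>J. (1 / (1 + d)) ^ K k * real m) / (real (Suc c) / Suc X)"
      unfolding bad_many_def by (rule prob_many_samples[OF d]) simp
    also have "\<dots> \<le> (\<Sum>k\<le>J. lam * 2 ^ k) / (real (Suc c) / Suc X)"
    proof (intro divide_right_mono sum_mono)
      fix k assume "k \<in> {..J}"
      then show "(1 / (1 + d)) ^ K k * real m \<le> lam * 2 ^ k" using K(1)[of k] m by (simp add: pos_le_divide_eq)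
    qed simp
    also have "(\<Sum>k\<le>J. lam * 2 ^ k) = lam * (2 ^ Suc J - 1)"
    proof -
      have "(\<Sum>k\<le>J. (2 :: real) ^ k) = 2 ^ Suc J - 1" by (induction J) auto
      then show ?thesis by (simp only: sum_distrib_left[symmetric])
    qed
    also have "\<dots> / (real (Suc c) / Suc X) \<le> 1 / 30"
    proof -
      have "30 * real (Suc X) * (lam * (2 ^ Suc J - 1)) \<le> 30 * real (Suc X) * (lam * 2 ^ Suc J)"
        using lam by (intro mult_left_mono) auto
      also have "\<dots> \<le> real (Suc c)" using c by (simp add: mult_ac)
      finally have "lam * (2 ^ Suc J - 1) * real (Suc X) * 30 \<le> real (Suc c)" by (simp only: mult_ac)
      moreover have "x / (C / y) \<le> 1 / 30" if "x * y * 30 \<le> C" "C > 0" "y > 0" for x C y :: real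
        using that by (simp add: field_simps)
      ultimately show ?thesis by (metis of_nat_0_less_iff zero_less_Suc)
    qed
    finally show ?thesis .
  qed
  define bad where "bad = bad_acc \<union> (bad_top \<union> (bad_mass \<union> (bad_miss \<union> bad_many)))"
  have "measure_pmf.prob ?M bad \<le> 1 / 30 + (1 / 30 + (1 / 30 + (1 / 30 + 1 / 30)))"
    unfolding bad_def
    by (intro order_trans[OF measure_Un_le] add_mono p_acc p_top p_mass p_miss p_many order_refl) auto
  then have pbad: "measure_pmf.prob ?M bad \<le> 1 / 3" by simp
  have "UNIV - bad \<subseteq> ?G"
  proof
    fix V assume "V \<in> UNIV - bad"
    then have V: "V \<notin> bad_acc" "V \<notin> bad_top" "V \<notin> bad_mass" "V \<notin> bad_miss" "V \<notin> bad_many" by (auto simp: bad_def)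
    have Vacc: "(1 - \<epsilon> / 8) * occ u (u s) s t \<le> estimate d h (level h u V (u s) s t) \<and>
       estimate d h (level h u V (u s) s t) \<le> (1 + \<epsilon> / 8) * occ u (u s) s t" if "s < t" "t \<le> m" for s t
    proof -
      have "(s, t) \<in> {..<m} \<times> {1..m}" using that by auto
      then have "V \<notin> miscount s t" using V(1) unfolding bad_acc_def by auto
      then show ?thesis by (simp add: miscount_def)
    qed
    have Vtop: "V t < X - h" if "t < m" for t using V(2) that unfolding bad_top_def by (auto simp: not_le)
    have crowd: "card (crowded h (K k0) B X u d m V i) \<le> \<epsilon> / 8 * f i" if i: "i \<in> heavy" for i
    proof -
      have "real (card (crowded h (K k0) B X u d m V i)) * B \<le> 4 * X * (\<Sum>s\<in>{s \<in> {..<m}. K k0 \<le> V s}. real (occ u (u s) 0 m))"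
      proof (rule card_crowded[OF d0])
        fix s t assume st: "s < t" "t \<le> m"
        have "estimate d h (level h u V (u s) s t) \<le> (1 + \<epsilon> / 8) * occ u (u s) s t" using Vacc[OF st] by simp
        also have "\<dots> \<le> 2 * real (occ u (u s) s t)" using \<epsilon> by (intro mult_right_mono) auto
        finally show "estimate d h (level h u V (u s) s t) \<le> real (2 * occ u (u s) s t)" by simp
      qed
      also have "\<dots> \<le> 4 * X * (30 * q * F2s)"
        using V(3) unfolding bad_mass_def f_def by (intro mult_left_mono) auto
      also have "\<dots> \<le> 4 * X * (30 * (lam / F) * (H * F\<^sup>2))"
      proof -
        have "q \<le> lam * 2 ^ k0 / m" using K(1)[OF k0(1)] by (simp add: q_def)
        also have "\<dots> \<le> lam / F"
        proof -
          have "lam * (2 ^ k0 * F) \<le> lam * m" using lam k0 by (intro mult_left_mono) auto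
          then show ?thesis using F m by (simp add: field_simps)
        qed
        finally have "q * F2s \<le> (lam / F) * (H * F\<^sup>2)"
          using F2 F2s lam F q by (intro mult_mono) (auto simp: F2s_def f_def)
        then have "4 * X * (30 * (q * F2s)) \<le> 4 * X * (30 * ((lam / F) * (H * F\<^sup>2)))"
          by (intro mult_left_mono) auto
        then show ?thesis by (simp only: mult.assoc)
      qed
      \<comment> \<open>The constant is \<open>4 * 30 * 16\<close>: 4 from the double counting, 30
        from Markov's inequality for the sampled frequency, and 16 from
        \<open>\<epsilon> / 8\<close> times \<open>\<epsilon> / 2\<close>.\<close>
      also have "\<dots> = (1920 * X * lam * H) * F / 16" using F by (simp add: power2_eq_square)
      also have "\<dots> \<le> (B * \<epsilon>\<^sup>2) * F / 16" using B F by (intro divide_right_mono mult_right_mono) auto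
      also have "\<dots> = B * (\<epsilon> / 8 * (\<epsilon> / 2 * F))" by (simp add: power2_eq_square)
      also have "\<dots> \<le> B * (\<epsilon> / 8 * f i)" using i \<epsilon> by (intro mult_left_mono) (auto simp: heavy_def)
      finally have *: "real (card (crowded h (K k0) B X u d m V i)) * B \<le> (\<epsilon> / 8 * f i) * B" by (simp add: mult_ac)
      have "H > 0"
      proof (rule ccontr)
        assume "\<not> H > 0"
        then have "H * F\<^sup>2 \<le> 0" by (intro mult_nonpos_nonneg) auto
        then show False using F2 F2s by (simp add: F2s_def f_def)
      qed
      then have "0 < 1920 * X * lam * H" using X lam by simp
      then have "0 < B * \<epsilon>\<^sup>2" using B by linarith
      then have "B > 0" by (cases B) auto
      then show ?thesis using * by (simp add: mult_right_le_imp_le)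
    qed
    have hit: "\<exists>s<m. u s = i \<and> K k0 \<le> V s \<and> s \<notin> crowded h (K k0) B X u d m V i \<and> occ u i 0 s \<le> \<epsilon> / 4 * occ u i 0 m"
      if i: "i \<in> {1..n}" "\<epsilon> / 2 * F \<le> occ u i 0 m" for i
    proof -
      have ih: "i \<in> heavy" using i by (simp add: heavy_def f_def)
      define y where "y = \<epsilon> / 4 * f i"
      let ?E = "{s \<in> {..<m}. u s = i \<and> real (occ u i 0 s) \<le> y}"
      have "0 < \<epsilon> / 2 * F" using \<epsilon> F by simp
      then have fpos: "f i > 0" using i by (simp add: f_def)
      then have y: "0 < y" "y < f i" using \<epsilon> by (auto simp: y_def)
      have "?E = {s \<in> {..<m}. u s = i \<and> occ u i 0 s \<le> nat \<lfloor>y\<rfloor>}"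
        using y by (auto simp: le_nat_floor) (simp add: le_nat_iff le_floor_iff)
      then have "card ?E = min (Suc (nat \<lfloor>y\<rfloor>)) (occ u i 0 m)" by (simp only: card_early)
      moreover have "Suc (nat \<lfloor>y\<rfloor>) \<le> occ u i 0 m"
      proof -
        have "real (nat \<lfloor>y\<rfloor>) < occ u i 0 m" using y by (simp add: f_def) linarith
        then show ?thesis by linarith
      qed
      ultimately have cE: "card ?E = Suc (nat \<lfloor>y\<rfloor>)" by simp
      have cC: "card (crowded h (K k0) B X u d m V i) \<le> \<epsilon> / 8 * f i" by (rule crowd[OF ih])
      have "finite (crowded h (K k0) B X u d m V i)" by (simp add: crowded_def)
      then have "card ?E - card (crowded h (K k0) B X u d m V i) \<le> card (T i V)"
        unfolding T_def y_def[symmetric] by (rule diff_card_le_card_Diff)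
      then have "real (card ?E) - real (card (crowded h (K k0) B X u d m V i)) \<le> real (card (T i V))" by linarith
      then have "y - \<epsilon> / 8 * f i < real (card (T i V))" using cC cE by linarith
      then have "\<epsilon> / 8 * f i < real (card (T i V))" by (simp add: y_def)
      moreover have "\<epsilon> / 8 * f i \<ge> 0" using \<epsilon> fpos by simp
      ultimately have "N0 i \<le> card (T i V)" unfolding N0_def by linarith
      then have "\<exists>s\<in>T i V. K k0 \<le> V s" using V(4) ih unfolding bad_miss_def by (auto simp: not_less)
      then show ?thesis by (auto simp: T_def f_def)
    qed
    have "card {t \<in> {..<m}. state_at (bank_step h K B X J) (\<lambda>_ _. []) u V (Suc t) \<noteq> state_at (bank_step h K B X J) (\<lambda>_ _. []) u V t} \<le> c"
    proof -
      have "(\<Sum>k\<le>J. real (card {s \<in> {..<m}. K k \<le> V s})) < real (Suc c) / Suc X" using V(5) by (simp add: bad_many_def not_le)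
      then have "(\<Sum>k\<le>J. real (card {s \<in> {..<m}. K k \<le> V s})) * Suc X < Suc c" by (simp add: pos_less_divide_eq)
      then have "real ((\<Sum>k\<le>J. card {s \<in> {..<m}. K k \<le> V s}) * Suc X) < real (Suc c)"
        by (simp only: of_nat_mult of_nat_sum)
      then have "(\<Sum>k\<le>J. card {s \<in> {..<m}. K k \<le> V s}) * Suc X < Suc c" by (simp only: of_nat_less_iff)
      then show ?thesis using card_bank_changes[of m h K B X J u V] by linarith
    qed
    moreover have "\<bar>readout d h X J (state_at (bank_step h K B X J) (\<lambda>_ _. []) u V m) i - occ u i 0 m\<bar> \<le> \<epsilon> / 2 * F"
      if "i \<in> {1..n}" for i
    proof (rule readout_accurate[OF \<epsilon> d X k0(1) F(2)[OF that] F(1)])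
      show "\<exists>s<m. u s = i \<and> K k0 \<le> V s \<and> s \<notin> crowded h (K k0) B X u d m V i \<and> occ u i 0 s \<le> \<epsilon> / 4 * occ u i 0 m"
        if "\<epsilon> / 2 * F \<le> occ u i 0 m" by (rule hit[OF \<open>i \<in> {1..n}\<close> that])
    qed (use Vacc Vtop in blast)+
    ultimately show "V \<in> ?G" by blast
  qed
  then have "measure_pmf.prob ?M (UNIV - bad) \<le> measure_pmf.prob ?M ?G" by (intro measure_pmf.finite_measure_mono) auto
  moreover have "measure_pmf.prob ?M (UNIV - bad) = 1 - measure_pmf.prob ?M bad"
    using measure_pmf.prob_compl[of bad ?M] by simp
  ultimately show ?thesis using pbad by linarith
qed

section \<open>Norms and thresholds\<close>

text \<open>The tangent at 1 of a concave function, obtained from the convexity of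
  \<open>exp\<close> between 0 and \<open>ln z\<close>.\<close>

lemma powr_le_affine:
  fixes z \<theta> :: real
  assumes "z \<ge> 0" "0 < \<theta>" "\<theta> \<le> 1"
  shows "z powr \<theta> \<le> 1 + \<theta> * (z - 1)"
proof (cases "z = 0")
  case False
  then have z: "z > 0" using assms by simp
  have "exp ((1 - \<theta>) *\<^sub>R 0 + \<theta> *\<^sub>R ln z) \<le> (1 - \<theta>) * exp 0 + \<theta> * exp (ln z)"
    using assms by (intro convex_onD[OF exp_convex]) auto
  then show ?thesis using z by (simp add: powr_def algebra_simps)
qed (use assms in simp)

text \<open>The power mean inequality: each term is bounded by the tangent at the mean
  \<open>A\<close>, and the linear parts cancel in the sum.\<close>

lemma sum_powr_le:
  fixes y :: "'a \<Rightarrow> real"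
  assumes S: "finite S" "S \<noteq> {}" and y: "\<And>i. i \<in> S \<Longrightarrow> y i \<ge> 0" and \<theta>: "0 < \<theta>" "\<theta> \<le> 1"
  shows "(\<Sum>i\<in>S. y i powr \<theta>) \<le> real (card S) powr (1 - \<theta>) * (\<Sum>i\<in>S. y i) powr \<theta>"
proof (cases "(\<Sum>i\<in>S. y i) = 0")
  case True
  then have "y i = 0" if "i \<in> S" for i using sum_nonneg_eq_0_iff[OF S(1)] y that by blast
  then show ?thesis using \<theta> by simp
next
  case False
  define A where "A = (\<Sum>i\<in>S. y i) / card S"
  have c: "real (card S) > 0" using S by (simp add: card_gt_0_iff)
  have "(\<Sum>i\<in>S. y i) > 0" using False sum_nonneg[of S y] y by fastforce
  then have A: "A > 0" "(\<Sum>i\<in>S. y i) = card S * A" using c by (auto simp: A_def)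
  have "(\<Sum>i\<in>S. y i powr \<theta>) \<le> (\<Sum>i\<in>S. A powr \<theta> * (1 + \<theta> * (y i / A - 1)))"
  proof (rule sum_mono)
    fix i assume i: "i \<in> S"
    have "y i powr \<theta> = (A * (y i / A)) powr \<theta>" using A by simp
    also have "\<dots> = A powr \<theta> * (y i / A) powr \<theta>" using A y[OF i] by (subst powr_mult) auto
    also have "\<dots> \<le> A powr \<theta> * (1 + \<theta> * (y i / A - 1))"
      using A y[OF i] \<theta> by (intro mult_left_mono powr_le_affine) auto
    finally show "y i powr \<theta> \<le> A powr \<theta> * (1 + \<theta> * (y i / A - 1))" .
  qed
  also have "\<dots> = A powr \<theta> * card S"
  proof -
    have "(\<Sum>i\<in>S. 1 + \<theta> * (y i / A - 1)) = card S + \<theta> * ((\<Sum>i\<in>S. y i) / A - card S)"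
      by (simp add: sum.distrib sum_subtractf flip: sum_distrib_left sum_divide_distrib)
    also have "\<dots> = card S" using A by simp
    finally show ?thesis by (simp only: sum_distrib_left[symmetric])
  qed
  also have "\<dots> = real (card S) powr (1 - \<theta>) * (\<Sum>i\<in>S. y i) powr \<theta>"
    using A c by (simp add: powr_mult powr_diff field_simps)
  finally show ?thesis .
qed

lemma lp_norm_powr:
  assumes "p \<ge> 1"
  shows "lp_norm n p x powr p = (\<Sum>i=1..n. \<bar>x i\<bar> powr p)"
  using assms by (simp add: lp_norm_def powr_powr sum_nonneg)

lemma abs_le_lp_norm:
  assumes "p \<ge> 1" "i \<in> {1..n}"
  shows "\<bar>x i\<bar> \<le> lp_norm n p x"
proof -
  have "\<bar>x i\<bar> = (\<bar>x i\<bar> powr p) powr (1 / p)" using assms by (simp add: powr_powr)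
  also have "\<dots> \<le> lp_norm n p x" unfolding lp_norm_def
    using assms by (intro powr_mono2 member_le_sum) auto
  finally show ?thesis .
qed

lemma sum_abs_le_lp_norm:
  assumes p: "p \<ge> 1" and n: "n \<ge> 1"
  shows "(\<Sum>i=1..n. \<bar>x i\<bar>) \<le> real n powr (1 - 1 / p) * lp_norm n p x"
proof -
  have "(\<Sum>i=1..n. \<bar>x i\<bar>) = (\<Sum>i=1..n. (\<bar>x i\<bar> powr p) powr (1 / p))" using p by (simp add: powr_powr)
  also have "\<dots> \<le> real (card {1..n}) powr (1 - 1 / p) * (\<Sum>i=1..n. \<bar>x i\<bar> powr p) powr (1 / p)"
    using p n by (intro sum_powr_le) auto
  finally show ?thesis by (simp add: lp_norm_def)
qed

text \<open>For \<open>p \<le> 2\<close> the power \<open>2 - p\<close> of each entry is at most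
  that of the norm; for \<open>p > 2\<close> the power mean inequality applies with exponent
  \<open>2 / p\<close>. This factor enters the buffer capacity and causes the term
  \<open>n powr (1 - 2 / p)\<close> in the space.\<close>

lemma sum_squares_le_lp_norm:
  assumes p: "p \<ge> 1" and n: "n \<ge> 1"
  shows "(\<Sum>i=1..n. (x i)\<^sup>2) \<le> (if p \<le> 2 then 1 else real n powr (1 - 2 / p)) * (lp_norm n p x)\<^sup>2"
proof (cases "p \<le> 2")
  case False
  have "(\<Sum>i=1..n. (x i)\<^sup>2) = (\<Sum>i=1..n. (\<bar>x i\<bar> powr p) powr (2 / p))" using p
    by (simp add: powr_powr powr_numeral)
  also have "\<dots> \<le> real (card {1..n}) powr (1 - 2 / p) * (\<Sum>i=1..n. \<bar>x i\<bar> powr p) powr (2 / p)"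
    using p n False by (intro sum_powr_le) auto
  also have "(\<Sum>i=1..n. \<bar>x i\<bar> powr p) powr (2 / p) = (lp_norm n p x) powr 2"
    by (simp add: lp_norm_def powr_powr)
  also have "\<dots> = (lp_norm n p x)\<^sup>2" by (simp add: powr_numeral lp_norm_def)
  finally show ?thesis using False by simp
next
  case True
  define F where "F = lp_norm n p x"
  have F0: "F \<ge> 0" by (simp add: F_def lp_norm_def)
  show ?thesis
  proof (cases "F = 0")
    case True
    then have "x i = 0" if "i \<in> {1..n}" for i using abs_le_lp_norm[OF p that, of x] by (simp add: F_def)
    then show ?thesis by simp
  next
    case False
    then have Fp: "F > 0" using F0 by simp
    have "(\<Sum>i=1..n. (x i)\<^sup>2) \<le> (\<Sum>i=1..n. \<bar>x i\<bar> powr p * F powr (2 - p))"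
    proof (rule sum_mono)
      fix i assume i: "i \<in> {1..n}"
      have "(x i)\<^sup>2 = \<bar>x i\<bar> powr 2" by (simp add: powr_numeral)
      also have "\<dots> = \<bar>x i\<bar> powr p * \<bar>x i\<bar> powr (2 - p)" by (simp flip: powr_add)
      also have "\<dots> \<le> \<bar>x i\<bar> powr p * F powr (2 - p)"
        using abs_le_lp_norm[OF p i, of x] True by (intro mult_left_mono powr_mono2) (auto simp: F_def)
      finally show "(x i)\<^sup>2 \<le> \<bar>x i\<bar> powr p * F powr (2 - p)" .
    qed
    also have "\<dots> = F powr p * F powr (2 - p)"
      unfolding F_def lp_norm_powr[OF p] by (simp add: sum_distrib_right)
    also have "\<dots> = F\<^sup>2" using Fp by (simp add: powr_numeral flip: powr_add)
    finally show ?thesis using True by (simp add: F_def)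
  qed
qed

lemma lp_norm_le_sum_abs:
  assumes p: "p \<ge> 1"
  shows "lp_norm n p x \<le> (\<Sum>i=1..n. \<bar>x i\<bar>)"
proof -
  define M where "M = (\<Sum>i=1..n. \<bar>x i\<bar>)"
  have M0: "M \<ge> 0" by (simp add: M_def sum_nonneg)
  have "(\<Sum>i=1..n. \<bar>x i\<bar> powr p) \<le> (\<Sum>i=1..n. \<bar>x i\<bar> * M powr (p - 1))"
  proof (rule sum_mono)
    fix i assume i: "i \<in> {1..n}"
    have "\<bar>x i\<bar> \<le> M" unfolding M_def using i by (intro member_le_sum) auto
    moreover have "\<bar>x i\<bar> powr p = \<bar>x i\<bar> powr 1 * \<bar>x i\<bar> powr (p - 1)" by (simp only: powr_add[symmetric]) simp
    ultimately show "\<bar>x i\<bar> powr p \<le> \<bar>x i\<bar> * M powr (p - 1)"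
      using p by (simp add: mult_left_mono powr_mono2)
  qed
  also have "\<dots> = M powr 1 * M powr (p - 1)" using M0 by (simp add: M_def sum_distrib_right)
  also have "\<dots> = M powr p" by (simp only: powr_add[symmetric]) simp
  finally have "lp_norm n p x \<le> (M powr p) powr (1 / p)"
    unfolding lp_norm_def using p by (intro powr_mono2) (auto intro: sum_nonneg)
  then show ?thesis using p M0 by (simp add: powr_powr M_def)
qed

section \<open>Frequencies of a stream, dyadic guesses and sampling thresholds\<close>

lemma freq_occ: "freq us i = real (occ ((!) us) i 0 (length us))"
proof -
  have "{t \<in> {1..length us}. us ! (t - 1) = i} = Suc ` {t \<in> {0..<length us}. us ! t = i}"
  proof (rule set_eqI)
    fix t
    show "t \<in> {t \<in> {1..length us}. us ! (t - 1) = i} \<longleftrightarrow> t \<in> Suc ` {t \<in> {0..<length us}. us ! t = i}"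
      by (cases t) auto
  qed
  then show ?thesis by (simp add: freq_def occ_def card_image)
qed

lemma sum_stream:
  fixes g :: "nat \<Rightarrow> real"
  assumes "\<And>t. t < m \<Longrightarrow> u t \<in> {1..n}"
  shows "(\<Sum>t<m. g (u t)) = (\<Sum>i=1..n. real (occ u i 0 m) * g i)"
proof -
  have "(\<Sum>t<m. g (u t)) = (\<Sum>i=1..n. \<Sum>t\<in>{t \<in> {..<m}. u t = i}. g (u t))"
    using assms by (intro sum.group[symmetric]) auto
  also have "\<dots> = (\<Sum>i=1..n. real (occ u i 0 m) * g i)"
    by (intro sum.cong refl) (simp add: occ_def lessThan_atLeast0)
  finally show ?thesis .
qed

lemma power2_bracket:
  assumes "x \<ge> (1 :: real)"
  shows "\<exists>k :: nat. 2 ^ k \<le> x \<and> x < 2 * 2 ^ k \<and> real k \<le> 2 * ln x"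
proof -
  define k where "k = (LEAST k :: nat. x < 2 * 2 ^ k)"
  obtain k' :: nat where "x < 2 ^ k'" using real_arch_pow[of 2 x] by auto
  then have "x < 2 * 2 ^ k'" using zero_le_power[of "2 :: real" k'] by linarith
  then have k: "x < 2 * 2 ^ k" unfolding k_def by (rule LeastI)
  have le: "2 ^ k \<le> x"
  proof (cases k)
    case (Suc j)
    then have "\<not> x < 2 * 2 ^ j" using not_less_Least[of j "\<lambda>k. x < 2 * 2 ^ k"] by (simp add: k_def)
    then show ?thesis using Suc by simp
  qed (use assms in simp)
  have "1 / 2 \<le> ln (2 :: real)" using ln2_ge_two_thirds by linarith
  then have "real k * (1 / 2) \<le> real k * ln 2" by (intro mult_left_mono) auto
  also have "\<dots> = ln (2 ^ k)" by (simp add: ln_realpow)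
  also have "\<dots> \<le> ln x" using le assms by (subst ln_le_cancel_iff) auto
  finally have "real k \<le> 2 * ln x" by simp
  then show ?thesis using k le by blast
qed

text \<open>Sampling rates have to be powers of \<open>\<rho>\<close>. As
  \<open>\<rho> \<ge> 1 / 2\<close>, consecutive powers drop by at most a factor 2, so the first one
  that is at most \<open>r\<close> is at least \<open>r / 2\<close>, unless already
  \<open>K = 0\<close> will do.\<close>

lemma threshold_exists:
  fixes r \<rho> :: real
  assumes "r > 0" "1 / 2 \<le> \<rho>" "\<rho> < 1"
  shows "\<exists>K :: nat. \<rho> ^ K \<le> r \<and> (K = 0 \<or> r / 2 \<le> \<rho> ^ K)"
proof -
  define K where "K = (LEAST K :: nat. \<rho> ^ K \<le> r)"
  obtain K' where "\<rho> ^ K' < r" using real_arch_pow_inv[OF assms(1,3)] by blast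
  then have "\<rho> ^ K' \<le> r" by simp
  then have K: "\<rho> ^ K \<le> r" unfolding K_def by (rule LeastI)
  have "K = 0 \<or> r / 2 \<le> \<rho> ^ K"
  proof (cases K)
    case (Suc j)
    then have "j < (LEAST K. \<rho> ^ K \<le> r)" unfolding K_def[symmetric] by simp
    then have "\<not> \<rho> ^ j \<le> r" by (rule not_less_Least)
    then have "r \<le> \<rho> ^ j" by simp
    then have "(1 / 2) * r \<le> \<rho> * \<rho> ^ j" using assms by (intro mult_mono) simp_all
    then have "r / 2 \<le> \<rho> ^ Suc j" by simp
    then show ?thesis unfolding Suc ..
  qed simp
  then show ?thesis using K by blast
qed

section \<open>Choice of the parameters\<close>

text \<open>All parameters are fixed before the stream. The right copy depends on the norm and is
  selected in the analysis only; it is among the \<open>Suc J\<close> copies because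
  \<open>m / F\<close> lies between 1 and \<open>n powr (1 - 1/p)\<close>.\<close>

lemma finite_state_heavy_hitters:
  fixes \<epsilon> d lam H p :: real and K :: "nat \<Rightarrow> nat"
  assumes p: "p \<ge> 1" and n: "n \<ge> 1" and m: "m \<ge> 1" and \<epsilon>: "0 < \<epsilon>" "\<epsilon> < 1"
    and d: "d > 0" and dh: "1 \<le> d * real h" and X: "X > 0"
    and H: "H = (if p \<le> 2 then 1 else real n powr (1 - 2 / p))"
    and acc: "2 * (real m)\<^sup>2 * exp (- (\<epsilon> / 8)\<^sup>2 / (24 * d)) \<le> 1 / 30"
    and top: "m * (1 / (1 + d)) ^ (X - h) \<le> 1 / 30"
    and J: "real n powr (1 - 1 / p) \<le> 2 ^ J"
    and lam: "lam > 0" "lam * \<epsilon>\<^sup>2 / 64 \<ge> ln (30 * n)"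
    and K: "\<And>k. k \<le> J \<Longrightarrow> (1 / (1 + d)) ^ K k \<le> lam * 2 ^ k / m"
      "\<And>k. k \<le> J \<Longrightarrow> K k = 0 \<or> lam * 2 ^ k / (2 * m) \<le> (1 / (1 + d)) ^ K k"
    and B: "1920 * X * lam * H \<le> B * \<epsilon>\<^sup>2"
    and c: "30 * Suc X * lam * 2 ^ Suc J \<le> c"
    and l: "Suc n ^ (B * (Suc J * X)) * Suc c \<le> 2 ^ l" "l \<ge> 1"
  shows "\<exists>A. \<forall>us. insertion_stream n m us \<longrightarrow>
    measure_pmf.prob (final_output A us)
      {f'. linf_norm n (\<lambda>i. f' i - freq us i) \<le> \<epsilon> / 2 * lp_norm n p (freq us)} \<ge> 2 / 3
    \<and> state_changes_at_most A us c \<and> bits_at_most A us l"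
proof -
  define step where "step = bank_step h K B X J"
  define init :: "nat \<Rightarrow> nat \<Rightarrow> nat list" where "init = (\<lambda>_ _. [])"
  have "card (banks n B X J) * Suc c \<le> Suc n ^ (B * (Suc J * X)) * Suc c"
    using card_banks[of n B X J] by (intro mult_right_mono) auto
  then have card: "card (banks n B X J) * Suc c \<le> 2 ^ l" using l(1) by linarith
  have closed: "step b i v \<in> banks n B X J" if "b \<in> banks n B X J" "i \<in> {1..n}" for b i v
    unfolding step_def using banks_closed[OF that] .
  have init: "init \<in> banks n B X J" unfolding init_def by (rule banks_init)
  have "\<exists>A. \<forall>us. set us \<subseteq> {1..n} \<longrightarrow> state_changes_at_most A us c \<and> bits_at_most A us l \<and>
     (\<forall>E. measure_pmf.prob (coins {..<length us} d)
         {V. card {t \<in> {..<length us}. state_at step init ((!) us) V (Suc t) \<noteq> state_at step init ((!) us) V t} \<le> c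
           \<and> readout d h X J (state_at step init ((!) us) V (length us)) \<in> E} \<le> measure_pmf.prob (final_output A us) E)"
    by (rule finite_state_algorithm[OF conjunct1[OF card_banks] init closed card l(2)])
  then obtain A where A: "\<And>us. set us \<subseteq> {1..n} \<Longrightarrow> state_changes_at_most A us c \<and> bits_at_most A us l \<and>
     (\<forall>E. measure_pmf.prob (coins {..<length us} d)
         {V. card {t \<in> {..<length us}. state_at step init ((!) us) V (Suc t) \<noteq> state_at step init ((!) us) V t} \<le> c
           \<and> readout d h X J (state_at step init ((!) us) V (length us)) \<in> E} \<le> measure_pmf.prob (final_output A us) E)"
    by blast
  show ?thesis
  proof (intro exI[of _ A] allI impI)
    fix us assume "insertion_stream n m us"
    then have us: "length us = m" "set us \<subseteq> {1..n}" by (auto simp: insertion_stream_def)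
    define u where "u = (!) us"
    define F where "F = lp_norm n p (freq us)"
    have freq: "freq us i = real (occ u i 0 m)" for i unfolding u_def us(1)[symmetric] by (rule freq_occ)
    have absf: "\<bar>freq us i\<bar> = freq us i" for i by (simp add: freq)
    have u: "u t \<in> {1..n}" if "t < m" for t
    proof -
      have "us ! t \<in> set us" using us(1) that by (intro nth_mem) simp
      then show ?thesis using us(2) unfolding u_def by blast
    qed
    have stream: "(\<Sum>t<m. g (u t)) = (\<Sum>i=1..n. real (occ u i 0 m) * g i)" for g :: "nat \<Rightarrow> real"
      by (rule sum_stream) (rule u)
    have total: "(\<Sum>i=1..n. \<bar>freq us i\<bar>) = m"
      unfolding absf freq using stream[of "\<lambda>_. 1"] by simp
    have mF: "real m \<le> real n powr (1 - 1 / p) * F"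
      using sum_abs_le_lp_norm[OF p n, of "freq us"] unfolding total F_def .
    have Fm: "F \<le> m" using lp_norm_le_sum_abs[OF p, of n "freq us"] unfolding total F_def .
    have Fpos: "F > 0"
    proof (rule ccontr)
      assume "\<not> F > 0"
      then have "real n powr (1 - 1 / p) * F \<le> 0" by (intro mult_nonneg_nonpos) auto
      then show False using mF m by simp
    qed
    have Fge: "occ u i 0 m \<le> F" if "i \<in> {1..n}" for i
      using abs_le_lp_norm[OF p that, of "freq us"] by (simp add: F_def freq)
    have F2: "(\<Sum>t<m. real (occ u (u t) 0 m)) \<le> H * F\<^sup>2"
    proof -
      have "(\<Sum>t<m. real (occ u (u t) 0 m)) = (\<Sum>i=1..n. (freq us i)\<^sup>2)"
        using stream[of "\<lambda>i. real (occ u i 0 m)"] by (simp add: freq power2_eq_square)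
      then show ?thesis using sum_squares_le_lp_norm[OF p n, of "freq us"] by (simp add: F_def H)
    qed
    obtain k0 :: nat where k0: "2 ^ k0 \<le> real m / F" "real m / F < 2 * 2 ^ k0"
    proof -
      have "real m / F \<ge> 1" using Fm Fpos by simp
      from power2_bracket[OF this] show thesis using that by blast
    qed
    have k0F: "2 ^ k0 * F \<le> m" "m \<le> 2 * 2 ^ k0 * F"
      using k0 Fpos by (simp_all add: pos_le_divide_eq pos_divide_less_eq)
    have "2 ^ k0 * F \<le> 2 ^ J * F"
      using k0F(1) mF mult_right_mono[OF J, of F] Fpos by linarith
    then have "(2 :: real) ^ k0 \<le> 2 ^ J" using Fpos by simp
    then have "k0 \<le> J" by simp
    have "2 / 3 \<le> measure_pmf.prob (coins {..<m} d)
      {V. card {t \<in> {..<m}. state_at step init u V (Suc t) \<noteq> state_at step init u V t} \<le> c \<and>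
        (\<forall>i\<in>{1..n}. \<bar>readout d h X J (state_at step init u V m) i - occ u i 0 m\<bar> \<le> \<epsilon> / 2 * F)}"
      unfolding step_def init_def
    proof (rule bank_success_probability[OF \<epsilon> d dh X _ u Fpos _ F2 acc top \<open>k0 \<le> J\<close> k0F lam _ _ B c])
      show "m > 0" using m by simp
    qed (use Fge K in blast)+
    also have "\<dots> = measure_pmf.prob (coins {..<m} d)
      {V. card {t \<in> {..<m}. state_at step init u V (Suc t) \<noteq> state_at step init u V t} \<le> c \<and>
        readout d h X J (state_at step init u V m) \<in> {f'. linf_norm n (\<lambda>i. f' i - freq us i) \<le> \<epsilon> / 2 * lp_norm n p (freq us)}}"
    proof -
      have "linf_norm n (\<lambda>i. f' i - freq us i) \<le> \<epsilon> / 2 * lp_norm n p (freq us) \<longleftrightarrow>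
        (\<forall>i\<in>{1..n}. \<bar>f' i - occ u i 0 m\<bar> \<le> \<epsilon> / 2 * F)" for f'
        unfolding linf_norm_def F_def freq using n by (subst Max_le_iff) auto
      then show ?thesis by simp
    qed
    also have "\<dots> \<le> measure_pmf.prob (final_output A us)
        {f'. linf_norm n (\<lambda>i. f' i - freq us i) \<le> \<epsilon> / 2 * lp_norm n p (freq us)}"
      using A[OF us(2)] unfolding us(1) u_def by blast
    finally show "measure_pmf.prob (final_output A us)
      {f'. linf_norm n (\<lambda>i. f' i - freq us i) \<le> \<epsilon> / 2 * lp_norm n p (freq us)} \<ge> 2 / 3
      \<and> state_changes_at_most A us c \<and> bits_at_most A us l" using A[OF us(2)] by blast
  qed
qed

lemma ln_64_mult_le: "x > 0 \<Longrightarrow> exp (6 + ln x) \<ge> 64 * x" for x :: real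
proof -
  assume "x > 0"
  have "(2 :: real) ^ 6 \<le> exp 1 ^ 6" using exp_ge_add_one_self[of 1] by (intro power_mono) auto
  then have "(64 :: real) \<le> exp 6" using exp_of_nat_mult[of 6 "1 :: real"] by simp
  then show ?thesis using \<open>x > 0\<close> by (simp add: exp_add)
qed

text \<open>
  The estimates only need \<open>L \<ge> 1\<close>: the values below make every failure probability at most \<open>1 / 30\<close>
  through \<open>exp (6 * L) \<ge> 64 * (n * m)\<^sup>2\<close>.
\<close>

lemma heavy_hitters_single:
  fixes \<epsilon> p :: real and n m :: nat
  assumes p: "p \<ge> 1" and n: "n \<ge> 1" and m: "m \<ge> 1" and \<epsilon>: "0 < \<epsilon>" "\<epsilon> < 1"
  defines "L \<equiv> 1 + ln (real n * real m)"
    and "H \<equiv> (if p \<le> 2 then 1 else real n powr (1 - 2 / p))"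
  shows "\<exists>A (c :: nat) (l :: nat). (\<forall>us. insertion_stream n m us \<longrightarrow>
    measure_pmf.prob (final_output A us)
      {f'. linf_norm n (\<lambda>i. f' i - freq us i) \<le> \<epsilon> / 2 * lp_norm n p (freq us)} \<ge> 2 / 3
    \<and> state_changes_at_most A us c \<and> bits_at_most A us l)
    \<and> real c \<le> 10 ^ 20 * real n powr (1 - 1 / p) * (L ^ 3 * (1 / \<epsilon>) ^ 4)
    \<and> real l \<le> 10 ^ 30 * (L ^ 7 * (1 / \<epsilon>) ^ 8 * H)"
proof -
  define e where "e = 1 / \<epsilon>"
  define D where "D = real n powr (1 - 1 / p)"
  \<comment> \<open>The constant is \<open>64 * 24 * 6\<close>, which makes the exponent
    \<open>(\<epsilon> / 8)\<^sup>2 / (24 * d)\<close> of \<open>level_accuracy\<close> equal to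
    \<open>6 * L\<close>.\<close>
  define d where "d = \<epsilon>\<^sup>2 / (9216 * L)"
  define h where "h = nat \<lceil>1 / d\<rceil>"
  \<comment> \<open>With \<open>ln (1 + d) \<ge> d / 2\<close>, this many levels above
    \<open>h\<close> bring the chance of a single coin beyond the top level down to
    \<open>exp (- (6 * L))\<close>.\<close>
  define G where "G = nat \<lceil>12 * L / d\<rceil>"
  define X where "X = h + G"
  \<comment> \<open>The constant is \<open>64 * 6\<close>, so that
    \<open>lam * \<epsilon>\<^sup>2 / 64\<close> equals \<open>6 * L\<close> and dominates
    \<open>ln (30 * n)\<close>.\<close>
  define lam where "lam = 384 * L * e\<^sup>2"
  define r where "r = 1 / (1 + d)"
  define B where "B = nat \<lceil>1920 * X * lam * H * e\<^sup>2\<rceil>"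
  have e: "e \<ge> 1" "e > 0" "\<epsilon> * e = 1" using \<epsilon> by (auto simp: e_def)
  have nm: "ln (real n * real m) = ln n + ln m" using n m by (simp add: ln_mult)
  have ln0: "ln (real n) \<ge> 0" "ln (real m) \<ge> 0" using n m by auto
  have L: "L \<ge> 1" "L = 1 + ln n + ln m" using ln0 by (auto simp: L_def nm)
  have H1: "H \<ge> 1" using n by (auto simp: H_def intro!: ge_one_powr_ge_zero)
  have D1: "D \<ge> 1" using n p by (auto simp: D_def intro!: ge_one_powr_ge_zero)
  have Dn: "D \<le> n" using n p powr_mono[of "1 - 1/p" 1 "real n"] by (simp add: D_def)
  have dpos: "d > 0" using \<epsilon> L by (simp add: d_def)
  have dinv: "1 / d = 9216 * L * e\<^sup>2" using \<epsilon> by (simp add: d_def e_def power_divide)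
  have Le: "L * e\<^sup>2 \<ge> 1" using L e mult_mono[of 1 L 1 "e\<^sup>2"] by simp
  have d1: "d \<le> 1 / 2"
  proof -
    have "1 / d \<ge> 2" unfolding dinv using Le by simp
    then show ?thesis using dpos by (simp add: field_simps)
  qed
  have e2: "\<epsilon>\<^sup>2 * e\<^sup>2 = 1" using e(3) by (simp add: power_mult_distrib[symmetric])
  have dh: "1 \<le> d * real h"
  proof -
    have "1 / d \<le> real h" unfolding h_def using dpos by linarith
    then show ?thesis using dpos by (simp add: field_simps)
  qed
  have Xpos: "X > 0" using dh by (cases "h = 0") (auto simp: X_def)
  have rr: "r < 1" "1 / 2 \<le> r" using dpos d1 by (auto simp: r_def field_simps)
  have big: "64 * (real n * real m)\<^sup>2 * exp (- (6 * L)) \<le> 1" "64 * real n \<le> exp (6 * L)"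
  proof -
    have "64 * (real n * real m)\<^sup>2 \<le> exp (6 + ln ((real n * real m)\<^sup>2))" using n m by (intro ln_64_mult_le) auto
    also have "\<dots> = exp (6 + 2 * ln (real n * real m))" using n m by (simp add: ln_realpow)
    also have "\<dots> \<le> exp (6 * L)" using ln0 by (simp add: L_def nm)
    finally have *: "64 * (real n * real m)\<^sup>2 \<le> exp (6 * L)" .
    then show "64 * (real n * real m)\<^sup>2 * exp (- (6 * L)) \<le> 1" by (simp add: exp_minus field_simps)
    have "64 * real n \<le> exp (6 + ln (real n))" using n by (intro ln_64_mult_le) auto
    also have "\<dots> \<le> exp (6 * L)" using ln0 by (simp add: L)
    finally show "64 * real n \<le> exp (6 * L)" .
  qed
  have nm2: "(real m)\<^sup>2 \<le> (real n * real m)\<^sup>2" using n by (intro power_mono) (auto simp: mult_le_cancel_right1)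
  have acc: "2 * (real m)\<^sup>2 * exp (- (\<epsilon> / 8)\<^sup>2 / (24 * d)) \<le> 1 / 30"
  proof -
    have "(\<epsilon> / 8)\<^sup>2 / (24 * d) = 6 * L" using \<epsilon> L by (simp add: d_def power_divide field_simps)
    then have "2 * (real m)\<^sup>2 * exp (- (\<epsilon> / 8)\<^sup>2 / (24 * d)) = 2 * (real m)\<^sup>2 * exp (- (6 * L))" by simp
    also have "\<dots> \<le> 2 * (real n * real m)\<^sup>2 * exp (- (6 * L))" using nm2 by (intro mult_right_mono mult_left_mono) auto
    also have "\<dots> \<le> 1 / 30" using big(1) by linarith
    finally show ?thesis .
  qed
  have top: "m * (1 / (1 + d)) ^ (X - h) \<le> 1 / 30"
  proof -
    have "d * d \<le> d * (1 / 2)" using dpos d1 by (intro mult_left_mono) auto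
    then have "d / 2 \<le> ln (1 + d)" using ln_add_one_ge[of d] dpos
      unfolding power2_eq_square by linarith
    moreover have G: "12 * L / d \<le> real G" unfolding G_def using dpos L by linarith
    ultimately have "(d / 2) * (12 * L / d) \<le> ln (1 + d) * real G" using dpos L by (intro mult_mono) auto
    then have "6 * L \<le> real G * ln (1 + d)" using dpos by (simp add: mult.commute)
    then have "exp (- (real G * ln (1 + d))) \<le> exp (- (6 * L))" by simp
    moreover have "exp (- (real G * ln (1 + d))) = (1 / (1 + d)) ^ G"
      using dpos by (simp add: exp_minus exp_of_nat_mult power_divide inverse_eq_divide)
    ultimately have "(1 / (1 + d)) ^ (X - h) \<le> exp (- (6 * L))" by (simp add: X_def)
    then have "m * (1 / (1 + d)) ^ (X - h) \<le> m * exp (- (6 * L))" by (rule mult_left_mono) simp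
    also have "\<dots> \<le> (real n * real m)\<^sup>2 * exp (- (6 * L))"
    proof (rule mult_right_mono)
      have "real m \<le> (real m)\<^sup>2" using m by (simp add: power2_eq_square mult_le_cancel_left1)
      then show "real m \<le> (real n * real m)\<^sup>2" using nm2 by linarith
    qed simp
    also have "\<dots> \<le> 1 / 30"
    proof -
      have "0 \<le> (real n * real m)\<^sup>2 * exp (- (6 * L))" by simp
      then show ?thesis using big(1) by linarith
    qed
    finally show ?thesis .
  qed
  obtain j :: nat where j: "2 ^ j \<le> D" "D < 2 * 2 ^ j" "real j \<le> 2 * ln D" using power2_bracket[OF D1] by blast
  \<comment> \<open>One more than the exponent just below \<open>D\<close>, so that
    \<open>2 ^ J\<close> exceeds \<open>D\<close> while \<open>2 ^ Suc J\<close> is still at most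
    \<open>4 * D\<close>.\<close>
  define J where "J = Suc j"
  have J: "D \<le> 2 ^ J" "2 ^ Suc J \<le> 4 * D" using j by (auto simp: J_def)
  have "ln D \<le> ln n" using Dn D1 by (subst ln_le_cancel_iff) auto
  then have SJ: "real (Suc J) \<le> 2 * L" using j(3) ln0 L by (simp add: J_def)
  have lampos: "lam > 0" using L e by (simp add: lam_def)
  have lam: "ln (30 * n) \<le> lam * \<epsilon>\<^sup>2 / 64"
  proof -
    have "lam * \<epsilon>\<^sup>2 / 64 = 6 * L * (\<epsilon>\<^sup>2 * e\<^sup>2)" by (simp add: lam_def)
    then have "lam * \<epsilon>\<^sup>2 / 64 = 6 * L" by (simp add: e2)
    moreover have "ln (30 * real n) \<le> ln (exp (6 * L))" using big(2) n by (subst ln_le_cancel_iff) auto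
    ultimately show ?thesis by simp
  qed
  have "\<forall>k. \<exists>K :: nat. r ^ K \<le> lam * 2 ^ k / m \<and> (K = 0 \<or> lam * 2 ^ k / m / 2 \<le> r ^ K)"
    using rr lampos m by (intro allI threshold_exists) auto
  then obtain K :: "nat \<Rightarrow> nat" where K: "\<And>k. r ^ K k \<le> lam * 2 ^ k / m"
     "\<And>k. K k = 0 \<or> lam * 2 ^ k / m / 2 \<le> r ^ K k" by metis
  have Bge: "1920 * X * lam * H \<le> B * \<epsilon>\<^sup>2"
  proof -
    have "1920 * X * lam * H * e\<^sup>2 \<le> B" unfolding B_def using lampos H1 by linarith
    then have "1920 * X * lam * H * e\<^sup>2 * \<epsilon>\<^sup>2 \<le> B * \<epsilon>\<^sup>2" by (intro mult_right_mono) auto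
    moreover have "1920 * X * lam * H * e\<^sup>2 * \<epsilon>\<^sup>2 = 1920 * X * lam * H * (\<epsilon>\<^sup>2 * e\<^sup>2)" by (simp only: mult_ac)
    ultimately show ?thesis unfolding e2 by linarith
  qed
  define c where "c = nat \<lceil>30 * Suc X * lam * 2 ^ Suc J\<rceil>"
  have cge: "30 * Suc X * lam * 2 ^ Suc J \<le> c" unfolding c_def by linarith
  have ceiling_le: "real (nat \<lceil>x\<rceil>) \<le> x + 1" if "0 \<le> x" for x :: real
    using that by linarith
  have Xle: "real (Suc X) \<le> 10 ^ 6 * L\<^sup>2 * e\<^sup>2"
  proof -
    have "real h \<le> 1 / d + 1" unfolding h_def using dpos by (intro ceiling_le) simp
    moreover have "real G \<le> 12 * L / d + 1" unfolding G_def using dpos L by (intro ceiling_le) simp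
    moreover have "12 * L / d = 12 * L * (1 / d)" by simp
    moreover have "1 * (1 / d) \<le> L * (1 / d)" using L dpos by (intro mult_right_mono) auto
    moreover have "1 \<le> 1 / d" using d1 dpos by (simp add: pos_le_divide_eq)
    moreover have "real (Suc X) = real h + real G + 1" by (simp add: X_def)
    ultimately have "real (Suc X) \<le> 16 * (L * (1 / d))" by linarith
    also have "\<dots> = 147456 * (L\<^sup>2 * e\<^sup>2)" unfolding dinv by (simp add: power2_eq_square)
    also have "\<dots> \<le> 10 ^ 6 * (L\<^sup>2 * e\<^sup>2)" by (intro mult_right_mono) auto
    finally show ?thesis by (simp add: mult.assoc)
  qed
  have Le1: "1 \<le> L ^ a * e ^ b" for a b
  proof -
    have "1 * 1 \<le> L ^ a * e ^ b" using L e by (intro mult_mono one_le_power) auto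
    then show ?thesis by simp
  qed
  have cle: "real (Suc c) \<le> 10 ^ 13 * D * (L ^ 3 * e ^ 4)"
  proof -
    have "real c \<le> 30 * Suc X * lam * 2 ^ Suc J + 1"
      unfolding c_def using lampos by (intro ceiling_le mult_nonneg_nonneg) auto
    also have "30 * Suc X * lam * 2 ^ Suc J \<le> 30 * (10 ^ 6 * L\<^sup>2 * e\<^sup>2) * lam * (4 * D)"
      using Xle J lampos L e by (intro mult_mono) (auto simp del: of_nat_Suc power_Suc)
    also have "\<dots> = 46080 * 10 ^ 6 * (D * (L ^ 3 * e ^ 4))"
      by (simp add: lam_def power2_eq_square power3_eq_cube power4_eq_xxxx)
    finally have c: "real c \<le> 46080 * 10 ^ 6 * (D * (L ^ 3 * e ^ 4)) + 1" by simp
    have P: "1 * 1 \<le> D * (L ^ 3 * e ^ 4)" using Le1[of 3 4] D1 by (intro mult_mono) auto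
    have "real (Suc c) \<le> 10 ^ 13 * P" if "real c \<le> 46080 * 10 ^ 6 * P + 1" "1 * 1 \<le> P" for P
      using that by simp
    from this[OF c P] show ?thesis by (simp only: mult.assoc)
  qed
  have Ble: "real B \<le> 10 ^ 12 * (L ^ 3 * e ^ 6 * H)"
  proof -
    have "real B \<le> 1920 * X * lam * H * e\<^sup>2 + 1"
      unfolding B_def using lampos H1 by (intro ceiling_le mult_nonneg_nonneg) auto
    also have "1920 * X * lam * H * e\<^sup>2 \<le> 1920 * (10 ^ 6 * L\<^sup>2 * e\<^sup>2) * lam * H * e\<^sup>2"
    proof -
      have "real X \<le> 10 ^ 6 * L\<^sup>2 * e\<^sup>2" using Xle by simp
      then show ?thesis using lampos H1 by (intro mult_right_mono mult_left_mono) simp_all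
    qed
    also have "\<dots> = 737280 * 10 ^ 6 * (L ^ 3 * e ^ 6 * H)"
      by (simp add: lam_def power2_eq_square power3_eq_cube power_numeral_reduce)
    finally have b: "real B \<le> 737280 * 10 ^ 6 * (L ^ 3 * e ^ 6 * H) + 1" by simp
    have P: "1 * 1 \<le> L ^ 3 * e ^ 6 * H" using Le1[of 3 6] H1 by (intro mult_mono) auto
    have "real B \<le> 10 ^ 12 * P" if "real B \<le> 737280 * 10 ^ 6 * P + 1" "1 * 1 \<le> P" for P
      using that by simp
    from this[OF b P] show ?thesis .
  qed
  have "real (Suc n) \<ge> 1" "real (Suc c) \<ge> 1" by auto
  then obtain wn wc :: nat where
    wn: "real (Suc n) < 2 * 2 ^ wn" "real wn \<le> 2 * ln (Suc n)" and
    wc: "real (Suc c) < 2 * 2 ^ wc" "real wc \<le> 2 * ln (Suc c)"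
    using power2_bracket[of "real (Suc n)"] power2_bracket[of "real (Suc c)"] by blast
  define E where "E = B * (Suc J * X)"
  \<comment> \<open>There are \<open>E\<close> list slots in all buffers together, each worth
    \<open>Suc wn\<close> bits, and \<open>Suc wc\<close> bits cover the change count.\<close>
  define l where "l = Suc wn * E + Suc wc"
  have l: "Suc n ^ E * Suc c \<le> 2 ^ l"
  proof -
    have "real (Suc n) \<le> real (2 ^ Suc wn)" "real (Suc c) \<le> real (2 ^ Suc wc)" using wn wc by simp_all
    then have "Suc n \<le> 2 ^ Suc wn" "Suc c \<le> 2 ^ Suc wc" by (simp_all only: of_nat_le_iff)
    then have "Suc n ^ E * Suc c \<le> (2 ^ Suc wn) ^ E * 2 ^ Suc wc" by (intro mult_mono power_mono) auto
    also have "\<dots> = 2 ^ l" unfolding l_def power_add power_mult ..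
    finally show ?thesis .
  qed
  \<comment> \<open>The power 7 of \<open>L\<close> is 3 from \<open>B\<close>, 1 from the number of
    copies, 2 from the number of levels and 1 from the bits per slot; the power 8 of
    \<open>e\<close> is 6 from \<open>B\<close> and 2 from the levels.\<close>
  have lle: "real l \<le> 10 ^ 30 * (L ^ 7 * e ^ 8 * H)"
  proof -
    have "ln (real (Suc n)) \<le> ln (2 * real n)" using n by (subst ln_le_cancel_iff) auto
    also have "\<dots> \<le> 1 + ln n" using n ln_le_minus_one[of 2] by (simp add: ln_mult)
    finally have wnL: "real (Suc wn) \<le> 3 * L" using wn(2) ln0 L by simp
    have "real E \<le> 10 ^ 12 * (L ^ 3 * e ^ 6 * H) * (2 * L * (10 ^ 6 * L\<^sup>2 * e\<^sup>2))"
      unfolding E_def of_nat_mult using Ble SJ Xle L e H1 by (intro mult_mono) auto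
    also have "\<dots> = 2 * 10 ^ 18 * (L ^ 6 * e ^ 8 * H)" by (simp add: power2_eq_square power3_eq_cube power_numeral_reduce)
    finally have "real (Suc wn) * real E \<le> (3 * L) * (2 * 10 ^ 18 * (L ^ 6 * e ^ 8 * H))"
      using wnL L by (intro mult_mono) auto
    also have "\<dots> = 6 * 10 ^ 18 * (L ^ 7 * e ^ 8 * H)" by (simp add: power_numeral_reduce)
    finally have 1: "real (Suc wn * E) \<le> 6 * 10 ^ 18 * (L ^ 7 * e ^ 8 * H)" by (simp only: of_nat_mult)
    have "ln (real (Suc c)) \<le> ln (10 ^ 13 * D * (L ^ 3 * e ^ 4))"
    proof (subst ln_le_cancel_iff)
      show "0 < 10 ^ 13 * D * (L ^ 3 * e ^ 4)" using cle by linarith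
    qed (use cle in auto)
    also have "\<dots> = ln (10 ^ 13) + ln D + (3 * ln L + 4 * ln e)"
      using D1 L e by (simp add: ln_mult ln_realpow del: power_numeral)
    also have "\<dots> \<le> 10 ^ 13 + L + (3 * L + 4 * e)"
    proof -
      have "ln (10 ^ 13 :: real) \<le> 10 ^ 13" by (rule ln_bound) simp
      moreover have "ln D \<le> L" using \<open>ln D \<le> ln n\<close> L ln0 by linarith
      moreover have "ln L \<le> L" "ln e \<le> e" using L e by (auto intro: ln_bound)
      ultimately show ?thesis by linarith
    qed
    finally have wcle: "real (Suc wc) \<le> 2 * (10 ^ 13 + L + (3 * L + 4 * e)) + 1" using wc(2) by simp
    define P where "P = L ^ 7 * e ^ 8 * H"
    have P: "1 \<le> P" "L \<le> P" "e \<le> P"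
    proof -
      have a: "1 \<le> L ^ 6 * e ^ 8 * H" "1 \<le> L ^ 7 * e ^ 7 * H"
        using mult_mono[of 1 "L ^ 6 * e ^ 8" 1 H] mult_mono[of 1 "L ^ 7 * e ^ 7" 1 H] Le1[of 6 8] Le1[of 7 7] H1 by auto
      have "L * 1 \<le> L * (L ^ 6 * e ^ 8 * H)" "e * 1 \<le> e * (L ^ 7 * e ^ 7 * H)"
        using a L e by (intro mult_left_mono; simp)+
      then show "L \<le> P" "e \<le> P" by (simp_all add: P_def power_numeral_reduce mult_ac)
      then show "1 \<le> P" using L by linarith
    qed
    have "real l = real (Suc wn * E) + real (Suc wc)" by (simp only: l_def of_nat_add)
    also have "\<dots> \<le> 6 * 10 ^ 18 * P + (2 * (10 ^ 13 + L + (3 * L + 4 * e)) + 1)"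
      using 1 wcle unfolding P_def by linarith
    also have "\<dots> \<le> 10 ^ 30 * P" using P by simp
    finally show ?thesis by (simp add: P_def)
  qed
  have "\<exists>A. \<forall>us. insertion_stream n m us \<longrightarrow>
    measure_pmf.prob (final_output A us)
      {f'. linf_norm n (\<lambda>i. f' i - freq us i) \<le> \<epsilon> / 2 * lp_norm n p (freq us)} \<ge> 2 / 3
    \<and> state_changes_at_most A us c \<and> bits_at_most A us l"
  proof (rule finite_state_heavy_hitters[where B = B and K = K and J = J and H = H, OF p n m \<epsilon> dpos dh Xpos _ acc top _ lampos])
    show "H = (if p \<le> 2 then 1 else real n powr (1 - 2 / p))" unfolding H_def ..
    show "ln (30 * real n) \<le> lam * \<epsilon>\<^sup>2 / 64" using lam by simp
    show "1920 * real X * lam * H \<le> B * \<epsilon>\<^sup>2" using Bge by simp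
    show "real (30 * Suc X) * lam * 2 ^ Suc J \<le> c" using cge by simp
    show "Suc n ^ (B * (Suc J * X)) * Suc c \<le> 2 ^ l" using l by (simp only: E_def)
    show "l \<ge> 1" by (simp add: l_def)
    show "(1 / (1 + d)) ^ K k \<le> lam * 2 ^ k / m" for k using K(1) by (simp add: r_def)
    show "K k = 0 \<or> lam * 2 ^ k / (2 * real m) \<le> (1 / (1 + d)) ^ K k" for k using K(2)[of k] by (simp add: r_def mult.commute)
    show "real n powr (1 - 1 / p) \<le> 2 ^ J" using J(1) by (simp add: D_def)
  qed
  moreover have "real c \<le> 10 ^ 20 * D * (L ^ 3 * e ^ 4)"
  proof -
    have "10 ^ 13 * D * (L ^ 3 * e ^ 4) \<le> 10 ^ 20 * D * (L ^ 3 * e ^ 4)"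
      using D1 L e by (intro mult_right_mono) auto
    then show ?thesis using cle by simp
  qed
  ultimately show ?thesis using lle unfolding D_def e_def by blast
qed

lemma state_changes_at_most_mono: "state_changes_at_most A us K \<Longrightarrow> K \<le> K' \<Longrightarrow> state_changes_at_most A us K'"
  unfolding state_changes_at_most_def by force

lemma bits_at_most_mono: "bits_at_most A us S \<Longrightarrow> S \<le> S' \<Longrightarrow> bits_at_most A us S'"
  unfolding bits_at_most_def by force

theorem theorem1p1:
  fixes p :: real
  assumes "p \<ge> 1"
  shows "\<exists>(A :: real \<Rightarrow> nat \<Rightarrow> nat \<Rightarrow> stream_alg) (C :: real) (a :: nat) (b :: nat) (c :: nat).
    \<forall>(\<epsilon> :: real) (n :: nat) (m :: nat) (us :: nat list).
      0 < \<epsilon> \<longrightarrow> \<epsilon> < 1 \<longrightarrow> n \<ge> 1 \<longrightarrow> m \<ge> 1 \<longrightarrow> insertion_stream n m us \<longrightarrow>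
        measure_pmf.prob (final_output (A \<epsilon> n m) us)
          {f'. linf_norm n (\<lambda>i. f' i - freq us i) \<le> \<epsilon> / 2 * lp_norm n p (freq us)} \<ge> 2 / 3
        \<and> state_changes_at_most (A \<epsilon> n m) us
            (C * real n powr (1 - 1 / p) * ((1 + ln (real n * real m)) ^ a * (1 / \<epsilon>) ^ b))
        \<and> (p \<le> 2 \<longrightarrow> bits_at_most (A \<epsilon> n m) us
            (C * (1 / \<epsilon> powr (4 + 4 * p)) * (1 + ln (real n * real m)) ^ c))
        \<and> (p > 2 \<longrightarrow> bits_at_most (A \<epsilon> n m) us
            (let g = 1 / \<epsilon> powr (4 + 4 * p) * real n powr (1 - 2 / p)
             in C * g * (1 + ln g) ^ c * (1 + ln (real n * real m)) ^ c))"
proof -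
  define H where "H n = (if p \<le> 2 then 1 else real n powr (1 - 2 / p))" for n :: nat
  define Q where "Q \<epsilon> n m A \<longleftrightarrow> (\<exists>(c :: nat) (l :: nat). (\<forall>us. insertion_stream n m us \<longrightarrow>
    measure_pmf.prob (final_output A us)
      {f'. linf_norm n (\<lambda>i. f' i - freq us i) \<le> \<epsilon> / 2 * lp_norm n p (freq us)} \<ge> 2 / 3
    \<and> state_changes_at_most A us c \<and> bits_at_most A us l)
    \<and> real c \<le> 10 ^ 20 * real n powr (1 - 1 / p) * ((1 + ln (real n * real m)) ^ 3 * (1 / \<epsilon>) ^ 4)
    \<and> real l \<le> 10 ^ 30 * ((1 + ln (real n * real m)) ^ 7 * (1 / \<epsilon>) ^ 8 * H n))" for \<epsilon> n m A
  \<comment> \<open>Choice turns the separate existence statements into one family of algorithms, so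
    that the constant and the exponents can be quantified outside \<open>\<epsilon>\<close>,
    \<open>n\<close> and \<open>m\<close>.\<close>
  define A where "A \<epsilon> n m = (SOME A. Q \<epsilon> n m A)" for \<epsilon> n m
  have A: "Q \<epsilon> n m (A \<epsilon> n m)" if "0 < \<epsilon>" "\<epsilon> < 1" "n \<ge> 1" "m \<ge> 1" for \<epsilon> n m
  proof -
    have "\<exists>A. Q \<epsilon> n m A"
      unfolding Q_def H_def by (rule heavy_hitters_single[OF assms that(3,4,1,2)])
    then show ?thesis unfolding A_def by (rule someI_ex)
  qed
  show ?thesis
  proof (rule exI[of _ A], rule exI[of _ "10 ^ 30"], rule exI[of _ 3], rule exI[of _ 4], rule exI[of _ 7], intro allI impI)
    fix \<epsilon> :: real and n m :: nat and us
    assume \<epsilon>: "0 < \<epsilon>" "\<epsilon> < 1" and n: "n \<ge> 1" and m: "m \<ge> 1" and us: "insertion_stream n m us"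
    define L where "L = 1 + ln (real n * real m)"
    define g where "g = 1 / \<epsilon> powr (4 + 4 * p) * real n powr (1 - 2 / p)"
    have "real n * real m \<ge> 1" using n m mult_mono[of 1 "real n" 1 "real m"] by simp
    then have L: "L \<ge> 1" by (simp add: L_def)
    obtain c l :: nat where
      acc: "measure_pmf.prob (final_output (A \<epsilon> n m) us)
        {f'. linf_norm n (\<lambda>i. f' i - freq us i) \<le> \<epsilon> / 2 * lp_norm n p (freq us)} \<ge> 2 / 3" and
      sc: "state_changes_at_most (A \<epsilon> n m) us c" and bits: "bits_at_most (A \<epsilon> n m) us l" and
      c: "real c \<le> 10 ^ 20 * real n powr (1 - 1 / p) * (L ^ 3 * (1 / \<epsilon>) ^ 4)" and
      l: "real l \<le> 10 ^ 30 * (L ^ 7 * (1 / \<epsilon>) ^ 8 * H n)"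
      using A[OF \<epsilon> n m] us unfolding Q_def L_def by blast
    have "10 ^ 20 * real n powr (1 - 1 / p) * (L ^ 3 * (1 / \<epsilon>) ^ 4) \<le>
      10 ^ 30 * real n powr (1 - 1 / p) * (L ^ 3 * (1 / \<epsilon>) ^ 4)"
      using L \<epsilon> by (intro mult_right_mono) auto
    then have sc': "state_changes_at_most (A \<epsilon> n m) us (10 ^ 30 * real n powr (1 - 1 / p) * (L ^ 3 * (1 / \<epsilon>) ^ 4))"
      using c by (intro state_changes_at_most_mono[OF sc]) linarith
    \<comment> \<open>The exponent 8 obtained above fits because \<open>4 + 4 * p\<close> is at
      least 8 for \<open>p \<ge> 1\<close>, and \<open>\<epsilon>\<close> is below 1.\<close>
    have "\<epsilon> powr (4 + 4 * p) \<le> \<epsilon> powr 8" using \<epsilon> assms by (intro powr_mono') auto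
    then have "\<epsilon> powr (4 + 4 * p) \<le> \<epsilon> ^ 8" using \<epsilon> by (simp add: powr_numeral)
    then have e8: "(1 / \<epsilon>) ^ 8 \<le> 1 / \<epsilon> powr (4 + 4 * p)"
      using \<epsilon> by (simp add: power_one_over frac_le)
    have b1: "bits_at_most (A \<epsilon> n m) us (10 ^ 30 * (1 / \<epsilon> powr (4 + 4 * p)) * L ^ 7)" if "p \<le> 2"
    proof (rule bits_at_most_mono[OF bits])
      have "real l \<le> 10 ^ 30 * (L ^ 7 * (1 / \<epsilon>) ^ 8)" using l that by (simp add: H_def)
      also have "\<dots> \<le> 10 ^ 30 * (L ^ 7 * (1 / \<epsilon> powr (4 + 4 * p)))"
        using e8 L by (intro mult_left_mono) auto
      finally have "real l \<le> 10 ^ 30 * (L ^ 7 * (1 / \<epsilon> powr (4 + 4 * p)))" .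
      then show "real l \<le> 10 ^ 30 * (1 / \<epsilon> powr (4 + 4 * p)) * L ^ 7" by (simp only: mult_ac)
    qed
    have b2: "bits_at_most (A \<epsilon> n m) us (10 ^ 30 * g * (1 + ln g) ^ 7 * L ^ 7)" if "p > 2"
    proof (rule bits_at_most_mono[OF bits])
      have "1 \<le> (1 / \<epsilon>) ^ 8" using \<epsilon> by (intro one_le_power) auto
      then have "1 \<le> 1 / \<epsilon> powr (4 + 4 * p)" using e8 by linarith
      moreover have "1 \<le> real n powr (1 - 2 / p)" using n that by (auto intro!: ge_one_powr_ge_zero)
      ultimately have g: "g \<ge> 1" unfolding g_def using mult_mono[of 1 "1 / \<epsilon> powr (4 + 4 * p)" 1 "real n powr (1 - 2 / p)"] by simp
      have "H n = real n powr (1 - 2 / p)" using that by (simp add: H_def)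
      then have "(1 / \<epsilon>) ^ 8 * H n \<le> g" unfolding g_def by (simp only:) (rule mult_right_mono[OF e8], simp)
      \<comment> \<open>As \<open>g \<ge> 1\<close>, the logarithmic factor is at least 1.\<close>
      also have "g * 1 \<le> g * (1 + ln g) ^ 7" using g by (intro mult_left_mono one_le_power) auto
      finally have "(1 / \<epsilon>) ^ 8 * H n \<le> g * (1 + ln g) ^ 7" by simp
      then have "10 ^ 30 * (L ^ 7 * ((1 / \<epsilon>) ^ 8 * H n)) \<le> 10 ^ 30 * (L ^ 7 * (g * (1 + ln g) ^ 7))"
        using L by (intro mult_left_mono) auto
      with l have "real l \<le> 10 ^ 30 * (L ^ 7 * (g * (1 + ln g) ^ 7))"
        unfolding mult.assoc by (rule order_trans)
      then show "real l \<le> 10 ^ 30 * g * (1 + ln g) ^ 7 * L ^ 7" by (simp only: mult_ac)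
    qed
    show "measure_pmf.prob (final_output (A \<epsilon> n m) us)
          {f'. linf_norm n (\<lambda>i. f' i - freq us i) \<le> \<epsilon> / 2 * lp_norm n p (freq us)} \<ge> 2 / 3
        \<and> state_changes_at_most (A \<epsilon> n m) us
            (10 ^ 30 * real n powr (1 - 1 / p) * ((1 + ln (real n * real m)) ^ 3 * (1 / \<epsilon>) ^ 4))
        \<and> (p \<le> 2 \<longrightarrow> bits_at_most (A \<epsilon> n m) us
            (10 ^ 30 * (1 / \<epsilon> powr (4 + 4 * p)) * (1 + ln (real n * real m)) ^ 7))
        \<and> (p > 2 \<longrightarrow> bits_at_most (A \<epsilon> n m) us
            (let g = 1 / \<epsilon> powr (4 + 4 * p) * real n powr (1 - 2 / p)
             in 10 ^ 30 * g * (1 + ln g) ^ 7 * (1 + ln (real n * real m)) ^ 7))"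
      using acc sc' b1 b2 unfolding L_def g_def Let_def by blast
  qed
qed

end
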